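(* There exists an absolute constant $C_0>0$ such that for every $1<p<2$ and for every lacunary sequence $\Lambda=(\lambda_j)_{j\in\mathbb{N}_0}$ of positive integers with ratio $\rho_\Lambda\in(1,2)$ one has $$\sup_{\substack{\|f\|_{L^p(\mathbb{T})}=1\\ f\in H^p_A(\mathbb{T})}}\big\|S^{(\Lambda)}(f)\big\|_{L^p(\mathbb{T})}\le\frac{C_0}{p-1}(\rho_\Lambda-1)^{-1/2}.$$
   Context: $\mathbb{T}=\mathbb{R}/(2\pi\mathbb{Z})$; $\mathbb{N}$ is the set of positive integers and $\mathbb{N}_0=\mathbb{N}\cup\{0\}$. The norm on $L^p(\mathbb{T})$ is $\|f\|_{L^p(\mathbb{T})}=\big((2\pi)^{-1}\int_{\mathbb{T}}|f|^p\big)^{1/p}$ and $\widehat f(n)=(2\pi)^{-1}\int_{\mathbb{T}}f(x)e^{-inx}dx$. For $1\le p\le\infty$, the analytic Hardy space $H^p_A(\mathbb{T})$ is the class of all $f\in L^p(\mathbb{T})$ with $\mathrm{supp}(\widehat f)\subseteq\mathbb{N}_0$. A strictly increasing sequence $\Lambda=(\lambda_j)_{j\in\mathbb{N}_0}$ of positive integers is lacunary if its ratio $\rho_\Lambda:=\inf_{j\in\mathbb{N}_0}\lambda_{j+1}/\lambda_j$ is greater than $1$. For $N\in\mathbb{N}$, $S_N$ is the Fourier multiplier operator on $\mathbb{T}$ with symbol $\chi_{\{-N+1,\dots,N-1\}}$, i.e. $S_N(f)(x)=\sum_{|n|\le N-1}\widehat f(n)e^{inx}$. Set $\Delta^{(\Lambda)}_0:=S_{\lambda_0}$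 and $\Delta^{(\Lambda)}_j:=S_{\lambda_j}-S_{\lambda_{j-1}}$ for $j\in\mathbb{N}$. The Littlewood-Paley square function is $$S^{(\Lambda)}(f):=\Big(\sum_{j\in\mathbb{N}_0}\big|\Delta^{(\Lambda)}_j(f)\big|^2\Big)^{1/2}.$$ *)

theory Defs
  imports "HOL-Analysis.Analysis"
begin

text \<open>Functions on \<open>\<real> / 2\<pi>\<int>\<close> are represented by \<open>2\<pi>\<close>-periodic functions on the real line, and
  integrals over the circle by Lebesgue integrals over the period \<open>{0..2*pi}\<close>.\<close>

text \<open>Only positive exponents \<open>a\<close> are meant; in particular \<open>\<infinity>\<close> to the power \<open>a\<close> is \<open>\<infinity>\<close>.\<close>

definition ennreal_powr :: "ennreal \<Rightarrow> real \<Rightarrow> ennreal" where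
  "ennreal_powr x a = (if x = \<infinity> then \<infinity> else ennreal (enn2real x powr a))"

text \<open>The norm takes \<open>[0,\<infinity>]\<close>-valued functions, so that it also applies to square functions without
  presupposing that these are finite; for complex-valued \<open>f\<close> it is applied to \<open>\<lambda>x. cmod (f x)\<close>.
  The exponent ranges over \<open>1 \<le> p < \<infinity>\<close>.\<close>

definition circle_eLp_norm :: "real \<Rightarrow> (real \<Rightarrow> ennreal) \<Rightarrow> ennreal" where
  "circle_eLp_norm p g =
     ennreal_powr (ennreal (1 / (2 * pi)) *
       (\<integral>\<^sup>+x\<in>{0..2*pi}. ennreal_powr (g x) p \<partial>lebesgue)) (1 / p)"

definition circle_Lp_norm :: "real \<Rightarrow> (real \<Rightarrow> complex) \<Rightarrow> ennreal" where
  "circle_Lp_norm p f = circle_eLp_norm p (\<lambda>x. ennreal (cmod (f x)))"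

definition circle_Lp :: "real \<Rightarrow> (real \<Rightarrow> complex) set" where
  "circle_Lp p = {f. (\<forall>x. f (x + 2 * pi) = f x) \<and> f \<in> borel_measurable lebesgue \<and>
                     circle_Lp_norm p f < \<infinity>}"

definition fourier_coeff :: "(real \<Rightarrow> complex) \<Rightarrow> int \<Rightarrow> complex" where
  "fourier_coeff f n =
     complex_of_real (1 / (2 * pi)) *
       (LINT x:{0..2*pi}|lebesgue. f x * exp (- (\<i> * of_int n * of_real x)))"

definition analytic_Hardy :: "real \<Rightarrow> (real \<Rightarrow> complex) set" where
  "analytic_Hardy p = {f \<in> circle_Lp p. {n. fourier_coeff f n \<noteq> 0} \<subseteq> {0..}}"

definition lacunary_ratio :: "(nat \<Rightarrow> nat) \<Rightarrow> real" where
  "lacunary_ratio \<Lambda> = (INF j. real (\<Lambda> (Suc j)) / real (\<Lambda> j))"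

definition lacunary :: "(nat \<Rightarrow> nat) \<Rightarrow> bool" where
  "lacunary \<Lambda> \<longleftrightarrow> strict_mono \<Lambda> \<and> (\<forall>j. 0 < \<Lambda> j) \<and> 1 < lacunary_ratio \<Lambda>"

definition fourier_partial_sum :: "nat \<Rightarrow> (real \<Rightarrow> complex) \<Rightarrow> real \<Rightarrow> complex" where
  "fourier_partial_sum N f x =
     (\<Sum>n\<in>{- int N + 1..int N - 1}. fourier_coeff f n * exp (\<i> * of_int n * of_real x))"

fun LP_block :: "(nat \<Rightarrow> nat) \<Rightarrow> nat \<Rightarrow> (real \<Rightarrow> complex) \<Rightarrow> real \<Rightarrow> complex" where
  "LP_block \<Lambda> 0 f x = fourier_partial_sum (\<Lambda> 0) f x"
| "LP_block \<Lambda> (Suc j) f x =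
     fourier_partial_sum (\<Lambda> (Suc j)) f x - fourier_partial_sum (\<Lambda> j) f x"

definition square_function :: "(nat \<Rightarrow> nat) \<Rightarrow> (real \<Rightarrow> complex) \<Rightarrow> real \<Rightarrow> ennreal" where
  "square_function \<Lambda> f x =
     ennreal_powr (\<Sum>j. ennreal ((cmod (LP_block \<Lambda> j f x))\<^sup>2)) (1 / 2)"

end

theory Submission
  imports Defs
begin

text \<open>
Functions on the circle are extended harmonically to the disc with coordinates \<open>z = exp (t + \<i>x)\<close>, \<open>t \<le> 0\<close>.
All analytic input comes from one convexity principle (\<open>green_circle\<close>): the circle means of a subharmonic
function that is bounded above are nondecreasing in \<open>t\<close>, and the integral of its Laplacian against
\<open>- t\<close> is at most the increase of these means. It is applied to two nonlinear expressions.

The first compares \<open>\<bar>f\<bar> ^ p\<close> with the same power of the analytic and antianalytic parts of \<open>f\<close>. This is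
M. Riesz' theorem for \<open>\<ell>\<^sup>2\<close>-valued functions, with a constant of order \<open>1 / (p - 1)\<close>
(\<open>half_line_projections_l2\<close>).

The second yields a bilinear estimate for the product of the radial derivatives of \<open>F\<close> and \<open>h\<close>, integrated over
the disc, where \<open>F\<close> is analytic and \<open>h\<close> is an \<open>\<ell>\<^sup>2\<close>-valued harmonic function (\<open>bilinear_embedding\<close>). Its constant does not blow up as \<open>p\<close> tends to \<open>1\<close>,
because \<open>\<bar>F\<bar> ^ p\<close> is strongly subharmonic for analytic \<open>F\<close>; here the Hardy space is essential. Cutting the disc
into annuli and dualizing, one obtains smooth Littlewood--Paley pieces of \<open>F\<close>, one for each annulus, whose
square function has norm at most a constant times \<open>sqrt M\<close> if no point lies in more than \<open>M\<close> annuli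
(\<open>annulus_square_function\<close>).

A sharp block of frequencies \<open>{\<alpha>..<\<beta>}\<close> is recovered from the smooth piece of the annulus
\<open>- 2 / \<alpha> \<le> t \<le> - 1 / (2 * \<beta>)\<close>: on the block the symbol of the piece is bounded below and has bounded variation, so
summation by parts expresses the block by half-line projections of the piece. The Riesz theorem then
costs the factor \<open>1 / (p - 1)\<close>, once (\<open>interval_square_function\<close>). Blocks of any length are
covered, since the annuli may be arbitrarily thick. For a lacunary sequence of ratio \<open>\<rho>\<close> at most \<open>5 / (\<rho> - 1)\<close> of the annuli
overlap (\<open>lacunary_overlap\<close>), and \<open>sqrt M\<close> becomes the factor \<open>(\<rho> - 1) powr (- 1 / 2)\<close>. Fejer means and Fatou's
lemma carry the estimate from polynomials to the Hardy space.
\<close>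

section \<open>Laplacians and Green's formula on the disc\<close>

text \<open>The variables \<open>(t, x)\<close> are logarithmic polar coordinates \<open>z = exp (t + \<i>x)\<close> of the disc: subharmonicity
  in the plane is subharmonicity in \<open>(t, x)\<close>, and functions of \<open>z\<close> become \<open>2\<pi>\<close>-periodic in \<open>x\<close>.\<close>

definition derivs2 :: "(real \<Rightarrow> real \<Rightarrow> 'a::real_normed_vector) \<Rightarrow> (real \<Rightarrow> real \<Rightarrow> 'a) \<Rightarrow>
    (real \<Rightarrow> real \<Rightarrow> 'a) \<Rightarrow> (real \<Rightarrow> real \<Rightarrow> 'a) \<Rightarrow> (real \<Rightarrow> real \<Rightarrow> 'a) \<Rightarrow> bool" where
  "derivs2 u ut ux utt uxx \<longleftrightarrow>
     (\<forall>t x. ((\<lambda>t. u t x) has_vector_derivative ut t x) (at t)) \<and>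
     (\<forall>t x. ((\<lambda>x. u t x) has_vector_derivative ux t x) (at x)) \<and>
     (\<forall>t x. ((\<lambda>t. ut t x) has_vector_derivative utt t x) (at t)) \<and>
     (\<forall>t x. ((\<lambda>x. ux t x) has_vector_derivative uxx t x) (at x)) \<and>
     continuous_on UNIV (\<lambda>z. u (fst z) (snd z)) \<and>
     continuous_on UNIV (\<lambda>z. ut (fst z) (snd z)) \<and>
     continuous_on UNIV (\<lambda>z. ux (fst z) (snd z)) \<and>
     continuous_on UNIV (\<lambda>z. utt (fst z) (snd z)) \<and>
     continuous_on UNIV (\<lambda>z. uxx (fst z) (snd z))"

lemma derivs2D:
  assumes "derivs2 u ut ux utt uxx"
  shows "\<And>t x. ((\<lambda>t. u t x) has_vector_derivative ut t x) (at t)"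
    and "\<And>t x. ((\<lambda>x. u t x) has_vector_derivative ux t x) (at x)"
    and "\<And>t x. ((\<lambda>t. ut t x) has_vector_derivative utt t x) (at t)"
    and "\<And>t x. ((\<lambda>x. ux t x) has_vector_derivative uxx t x) (at x)"
    and "continuous_on UNIV (\<lambda>z. u (fst z) (snd z))"
    and "continuous_on UNIV (\<lambda>z. ut (fst z) (snd z))"
    and "continuous_on UNIV (\<lambda>z. ux (fst z) (snd z))"
    and "continuous_on UNIV (\<lambda>z. utt (fst z) (snd z))"
    and "continuous_on UNIV (\<lambda>z. uxx (fst z) (snd z))"
  using assms unfolding derivs2_def by blast+

text \<open>First derivatives and the Laplacian \<open>l\<close> are all that the chain and product rules for Laplacians and
  Green's formula involve, so the two pure second derivatives are not exposed.\<close>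

definition jet2 :: "(real \<Rightarrow> real \<Rightarrow> 'a::real_normed_vector) \<Rightarrow> (real \<Rightarrow> real \<Rightarrow> 'a) \<Rightarrow>
    (real \<Rightarrow> real \<Rightarrow> 'a) \<Rightarrow> (real \<Rightarrow> real \<Rightarrow> 'a) \<Rightarrow> bool" where
  "jet2 u ut ux l \<longleftrightarrow>
     (\<exists>utt uxx. derivs2 u ut ux utt uxx \<and> (\<forall>t x. l t x = utt t x + uxx t x))"

lemma jet2I:
  assumes "\<And>t x. ((\<lambda>t. u t x) has_vector_derivative ut t x) (at t)"
    and "\<And>t x. ((\<lambda>x. u t x) has_vector_derivative ux t x) (at x)"
    and "\<And>t x. ((\<lambda>t. ut t x) has_vector_derivative utt t x) (at t)"
    and "\<And>t x. ((\<lambda>x. ux t x) has_vector_derivative uxx t x) (at x)"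
    and "\<And>t x. l t x = utt t x + uxx t x"
    and "continuous_on UNIV (\<lambda>z. u (fst z) (snd z))"
    and "continuous_on UNIV (\<lambda>z. ut (fst z) (snd z))"
    and "continuous_on UNIV (\<lambda>z. ux (fst z) (snd z))"
    and "continuous_on UNIV (\<lambda>z. utt (fst z) (snd z))"
    and "continuous_on UNIV (\<lambda>z. uxx (fst z) (snd z))"
  shows "jet2 u ut ux l"
  unfolding jet2_def derivs2_def using assms by blast

lemma jet2_continuous:
  "jet2 u ut ux l \<Longrightarrow> continuous_on UNIV (\<lambda>z. u (fst z) (snd z))"
  by (auto simp: jet2_def derivs2_def)

lemma jet2_laplacian_continuous:
  assumes "jet2 u ut ux l"
  shows "continuous_on UNIV (\<lambda>z. l (fst z) (snd z))"
proof -
  from assms obtain utt uxx where d: "derivs2 u ut ux utt uxx"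
    and l: "\<And>t x. l t x = utt t x + uxx t x" unfolding jet2_def by blast
  show ?thesis unfolding l by (intro continuous_on_add derivs2D[OF d])
qed

lemma jet2_const: "jet2 (\<lambda>t x. c) (\<lambda>t x. 0) (\<lambda>t x. 0) (\<lambda>t x. 0)"
  by (rule jet2I[where utt = "\<lambda>t x. 0" and uxx = "\<lambda>t x. 0"]) auto

lemma jet2_add:
  assumes "jet2 u ut ux l" "jet2 v vt vx k"
  shows "jet2 (\<lambda>t x. u t x + v t x) (\<lambda>t x. ut t x + vt t x) (\<lambda>t x. ux t x + vx t x)
     (\<lambda>t x. l t x + k t x)"
proof -
  from assms(1) obtain utt uxx where du: "derivs2 u ut ux utt uxx"
    and lu: "\<And>t x. l t x = utt t x + uxx t x" unfolding jet2_def by blast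
  note u = derivs2D[OF du]
  from assms(2) obtain vtt vxx where dv: "derivs2 v vt vx vtt vxx"
    and lv: "\<And>t x. k t x = vtt t x + vxx t x" unfolding jet2_def by blast
  note v = derivs2D[OF dv]
  show ?thesis
    by (rule jet2I[where utt = "\<lambda>t x. utt t x + vtt t x" and uxx = "\<lambda>t x. uxx t x + vxx t x"])
      (intro has_vector_derivative_add continuous_on_add u v | simp add: lu lv)+
qed

lemma jet2_sum:
  assumes "finite I" "\<And>i. i \<in> I \<Longrightarrow> jet2 (u i) (ut i) (ux i) (l i)"
  shows "jet2 (\<lambda>t x. \<Sum>i\<in>I. u i t x) (\<lambda>t x. \<Sum>i\<in>I. ut i t x) (\<lambda>t x. \<Sum>i\<in>I. ux i t x)
     (\<lambda>t x. \<Sum>i\<in>I. l i t x)"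
  using assms
proof (induction I rule: finite_induct)
  case empty show ?case by (simp add: jet2_const)
next
  case (insert i I)
  then have "jet2 (u i) (ut i) (ux i) (l i)" 
    "jet2 (\<lambda>t x. \<Sum>i\<in>I. u i t x) (\<lambda>t x. \<Sum>i\<in>I. ut i t x) (\<lambda>t x. \<Sum>i\<in>I. ux i t x)
     (\<lambda>t x. \<Sum>i\<in>I. l i t x)" by auto
  from jet2_add[OF this] insert(1,2) show ?case by simp
qed

lemma has_vector_derivative_inner:
  fixes f g :: "real \<Rightarrow> 'a::real_inner"
  assumes "(f has_vector_derivative f') (at t)" "(g has_vector_derivative g') (at t)"
  shows "((\<lambda>t. f t \<bullet> g t) has_vector_derivative (f t \<bullet> g' + f' \<bullet> g t)) (at t)"
  using bounded_bilinear.has_vector_derivative[OF bounded_bilinear_inner assms] .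

lemma jet2_inner:
  fixes u v :: "real \<Rightarrow> real \<Rightarrow> 'a::real_inner"
  assumes "jet2 u ut ux l" "jet2 v vt vx k"
  shows "jet2 (\<lambda>t x. u t x \<bullet> v t x) (\<lambda>t x. u t x \<bullet> vt t x + ut t x \<bullet> v t x)
     (\<lambda>t x. u t x \<bullet> vx t x + ux t x \<bullet> v t x)
     (\<lambda>t x. u t x \<bullet> k t x + l t x \<bullet> v t x + 2 * (ut t x \<bullet> vt t x + ux t x \<bullet> vx t x))"
proof -
  from assms(1) obtain utt uxx where du: "derivs2 u ut ux utt uxx"
    and lu: "\<And>t x. l t x = utt t x + uxx t x" unfolding jet2_def by blast
  note u = derivs2D[OF du]
  from assms(2) obtain vtt vxx where dv: "derivs2 v vt vx vtt vxx"
    and lv: "\<And>t x. k t x = vtt t x + vxx t x" unfolding jet2_def by blast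
  note v = derivs2D[OF dv]
  show ?thesis
    by (rule jet2I[where utt = "\<lambda>t x. (u t x \<bullet> vtt t x + ut t x \<bullet> vt t x) + (ut t x \<bullet> vt t x + utt t x \<bullet> v t x)"
         and uxx = "\<lambda>t x. (u t x \<bullet> vxx t x + ux t x \<bullet> vx t x) + (ux t x \<bullet> vx t x + uxx t x \<bullet> v t x)"])
      (intro has_vector_derivative_add has_vector_derivative_inner continuous_on_add continuous_on_inner u v
        | simp add: lu lv inner_add_left inner_add_right algebra_simps)+
qed

lemma jet2_cmult:
  fixes u :: "real \<Rightarrow> real \<Rightarrow> real"
  assumes "jet2 u ut ux l"
  shows "jet2 (\<lambda>t x. c * u t x) (\<lambda>t x. c * ut t x) (\<lambda>t x. c * ux t x) (\<lambda>t x. c * l t x)"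
  using jet2_inner[OF jet2_const[of c] assms] by simp

text \<open>The exponents below are fractional, which is why the base has to stay away from zero; in the
  applications it is a sum of squares plus a positive constant.\<close>

lemma jet2_powr:
  fixes u :: "real \<Rightarrow> real \<Rightarrow> real"
  assumes j: "jet2 u ut ux l" and pos: "\<And>t x. 0 < u t x"
  shows "jet2 (\<lambda>t x. u t x powr a) (\<lambda>t x. a * u t x powr (a - 1) * ut t x)
     (\<lambda>t x. a * u t x powr (a - 1) * ux t x)
     (\<lambda>t x. a * u t x powr (a - 1) * l t x
        + a * (a - 1) * u t x powr (a - 2) * ((ut t x)\<^sup>2 + (ux t x)\<^sup>2))"
proof -
  from j obtain utt uxx where du: "derivs2 u ut ux utt uxx"
    and lu: "\<And>t x. l t x = utt t x + uxx t x" unfolding jet2_def by blast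
  note u = derivs2D[OF du]
  have pw: "((\<lambda>s. f s powr b) has_vector_derivative b * f s powr (b - 1) * f') (at s)"
    if "(f has_vector_derivative f') (at s)" "f s > 0" for f :: "real \<Rightarrow> real" and f' s b
    using that unfolding has_real_derivative_iff_has_vector_derivative[symmetric]
    by (auto intro!: derivative_eq_intros)
  have pw2: "((\<lambda>s. b * f s powr (b - 1) * f1 s) has_vector_derivative
      b * f s powr (b - 1) * f2 + b * (b - 1) * f s powr (b - 2) * (f1 s)\<^sup>2) (at s)"
    if "(f has_vector_derivative f1 s) (at s)" "(f1 has_vector_derivative f2) (at s)" "f s > 0"
    for f f1 :: "real \<Rightarrow> real" and f2 s b
    using that unfolding has_real_derivative_iff_has_vector_derivative[symmetric]
    by (auto intro!: derivative_eq_intros simp: power2_eq_square algebra_simps diff_diff_eq)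
  have cp: "continuous_on UNIV (\<lambda>z. u (fst z) (snd z) powr b)" for b
    by (intro continuous_on_powr u continuous_on_const) (metis less_irrefl pos)
  show ?thesis
    by (rule jet2I[where utt = "\<lambda>t x. a * u t x powr (a - 1) * utt t x + a * (a - 1) * u t x powr (a - 2) * (ut t x)\<^sup>2"
         and uxx = "\<lambda>t x. a * u t x powr (a - 1) * uxx t x + a * (a - 1) * u t x powr (a - 2) * (ux t x)\<^sup>2"])
      (intro pw pw2 u pos continuous_intros cp | simp add: lu algebra_simps)+
qed

lemma integral_deriv_param:
  fixes f :: "real \<Rightarrow> real \<Rightarrow> real"
  assumes "\<And>t x. ((\<lambda>t. f t x) has_vector_derivative ft t x) (at t)"
    and c: "continuous_on UNIV (\<lambda>z. f (fst z) (snd z))" "continuous_on UNIV (\<lambda>z. ft (fst z) (snd z))"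
  shows "((\<lambda>t. integral {a..b} (f t)) has_real_derivative integral {a..b} (ft t)) (at t)"
proof -
  have "((\<lambda>t. integral (cbox a b) (f t)) has_field_derivative integral (cbox a b) (ft t)) (at t within UNIV)"
  proof (rule leibniz_rule_field_derivative)
    show "\<And>s x. ((\<lambda>s. f s x) has_field_derivative ft s x) (at s within UNIV)"
      using assms(1) by (simp add: has_real_derivative_iff_has_vector_derivative)
    have "continuous_on {a..b} (f s)" for s
      using continuous_on_compose2[OF c(1), of "{a..b}" "\<lambda>x. (s, x)"]
      by (simp add: continuous_on_Pair)
    then show "\<And>s. f s integrable_on cbox a b"
      by (simp add: integrable_continuous_interval)
    show "continuous_on (UNIV \<times> cbox a b) (\<lambda>(x, t). ft x t)"
      using continuous_on_subset[OF c(2), of "UNIV \<times> cbox a b"] by (simp add: case_prod_unfold)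
  qed auto
  then show ?thesis by simp
qed

lemma continuous_slice:
  assumes c: "continuous_on UNIV (\<lambda>z. f (fst z) (snd z))"
  shows "continuous_on A (f (s::real) :: real \<Rightarrow> 'a::topological_space)"
  using continuous_on_compose2[OF c, of A "\<lambda>x. (s, x)"]
  by (simp add: continuous_on_Pair)

lemma continuous_integral_param:
  fixes f :: "real \<Rightarrow> real \<Rightarrow> real"
  assumes c: "continuous_on UNIV (\<lambda>z. f (fst z) (snd z))"
  shows "continuous_on A (\<lambda>t. integral {a..b} (f t))"
proof -
  have "continuous_on (A \<times> cbox a b) (\<lambda>(t, x). f t x)"
    using continuous_on_subset[OF c] by (simp add: case_prod_unfold)
  from integral_continuous_on_param[OF this] show ?thesis by simp
qed

text \<open>The circle mean \<open>m t\<close> of \<open>W t\<close> satisfies \<open>m'' = \<integral> l\<close>, because the second \<open>x\<close>-derivative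
  integrates to zero over a period. Hence \<open>m\<close> is convex, and a convex function that is bounded above near
  \<open>-\<infinity>\<close> cannot decrease anywhere on the half-line. Integrating \<open>-t m''\<close> by parts leaves the boundary term
  \<open>- T m' (- T) \<le> 0\<close>. The weight \<open>-t\<close> is Green's function \<open>ln (1 / \<bar>z\<bar>)\<close> of the disc.\<close>

lemma green_circle:
  fixes W :: "real \<Rightarrow> real \<Rightarrow> real"
  assumes j: "jet2 W Wt Wx l" and per: "\<And>t x. W t (x + 2 * pi) = W t x"
    and nonneg: "\<And>t x. 0 \<le> l t x" and bdd: "\<And>t x. t \<le> 0 \<Longrightarrow> W t x \<le> B"
    and T: "0 \<le> T"
  shows "integral {- T..0} (\<lambda>t. - t * integral {0..2*pi} (l t))
      \<le> integral {0..2*pi} (W 0) - integral {0..2*pi} (W (- T))"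
    and "integral {0..2*pi} (W (- T)) \<le> integral {0..2*pi} (W 0)"
proof -
  from j obtain Wtt Wxx where dw: "derivs2 W Wt Wx Wtt Wxx"
    and lw: "\<And>t x. l t x = Wtt t x + Wxx t x" unfolding jet2_def by blast
  note w = derivs2D[OF dw]
  define m where "m t = integral {0..2*pi} (W t)" for t
  define m1 where "m1 t = integral {0..2*pi} (Wt t)" for t
  define m2 where "m2 t = integral {0..2*pi} (l t)" for t
  have perx: "Wx t (x + 2 * pi) = Wx t x" for t x
  proof -
    have "((\<lambda>x. W t (x + 2 * pi)) has_vector_derivative Wx t (x + 2 * pi)) (at x)"
      using w(2)[of t "x + 2 * pi"]
      unfolding has_real_derivative_iff_has_vector_derivative[symmetric] by (simp only: DERIV_shift)
    then have "(W t has_vector_derivative Wx t (x + 2 * pi)) (at x)"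
      by (simp add: per)
    with w(2)[of t x] show ?thesis
      by (metis vector_derivative_at)
  qed
  have Wxx0: "(Wxx t has_integral 0) {0..2*pi}" for t
    using fundamental_theorem_of_calculus[of 0 "2*pi" "Wx t" "Wxx t"] w(4) perx[of t 0]
    by (auto intro: has_vector_derivative_at_within)
  have m2': "m2 t = integral {0..2*pi} (Wtt t)" for t
  proof -
    have "(Wtt t has_integral integral {0..2*pi} (Wtt t)) {0..2*pi}"
      by (intro integrable_integral integrable_continuous_interval continuous_slice w)
    from has_integral_add[OF this Wxx0[of t]] have "integral {0..2*pi} (\<lambda>x. l t x) = integral {0..2*pi} (Wtt t)"
      unfolding lw by (simp add: integral_unique)
    then show ?thesis by (simp add: m2_def)
  qed
  have dm: "(m has_real_derivative m1 t) (at t)" for t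
    unfolding m_def m1_def by (rule integral_deriv_param) (rule w)+
  have dm1: "(m1 has_real_derivative m2 t) (at t)" for t
    unfolding m1_def m2' by (rule integral_deriv_param) (rule w)+
  have cl: "continuous_on UNIV (\<lambda>z. l (fst z) (snd z))"
    unfolding lw by (intro continuous_intros w)
  have m2nn: "0 \<le> m2 t" for t
    unfolding m2_def by (intro integral_nonneg integrable_continuous_interval continuous_slice cl nonneg)
  have m1mono: "m1 s \<le> m1 t" if "s \<le> t" for s t
    using DERIV_nonneg_imp_nondecreasing[OF that, of m1] dm1 m2nn by blast
  have mB: "m t \<le> 2 * pi * B" if "t \<le> 0" for t
  proof -
    have "m t \<le> integral {0..2*pi} (\<lambda>x. B)"
      unfolding m_def using bdd[OF that]
      by (intro integral_le integrable_continuous_interval continuous_slice w) auto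
    then show ?thesis by simp
  qed
  have m1nn: "0 \<le> m1 t" if t: "t \<le> 0" for t
  proof (rule ccontr)
    assume neg: "\<not> 0 \<le> m1 t"
    \<comment> \<open>going back by d along a tangent of slope m1 t < 0 would raise m above its bound\<close>
    define d where "d = (2 * pi * B - m t + 1) / (- m1 t)"
    have d: "d > 0" unfolding d_def using neg mB[OF t] by (intro divide_pos_pos) auto
    have "\<exists>z>t - d. z < t \<and> m t - m (t - d) = (t - (t - d)) * m1 z"
      using MVT2[of "t - d" t m m1] d dm by auto
    then obtain z where z: "z < t" "m t - m (t - d) = d * m1 z" by auto
    have "d * m1 z \<le> d * m1 t" using z m1mono[of z t] d by simp
    also have "\<dots> = - (2 * pi * B - m t + 1)" unfolding d_def using neg by (simp add: field_simps)
    finally have "m (t - d) \<ge> 2 * pi * B + 1" using z(2) by linarith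
    with mB[of "t - d"] t d show False by linarith
  qed
  have "((\<lambda>t. - t * m2 t) has_integral ((\<lambda>t. - t * m1 t + m t) 0 - (\<lambda>t. - t * m1 t + m t) (- T))) {- T..0}"
  proof (rule fundamental_theorem_of_calculus)
    fix t assume "t \<in> {- T..0}"
    have "((\<lambda>t. - t * m1 t + m t) has_real_derivative - t * m2 t) (at t)"
      using dm[of t] dm1[of t] by (auto intro!: derivative_eq_intros)
    then show "((\<lambda>t. - t * m1 t + m t) has_vector_derivative - t * m2 t) (at t within {- T..0})"
      by (simp add: has_real_derivative_iff_has_vector_derivative has_vector_derivative_at_within)
  qed (use T in auto)
  from integral_unique[OF this]
  have "integral {- T..0} (\<lambda>t. - t * m2 t) = m 0 - (T * m1 (- T) + m (- T))"
    by simp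
  moreover have "0 \<le> T * m1 (- T)" using m1nn[of "- T"] T by simp
  ultimately show "integral {- T..0} (\<lambda>t. - t * integral {0..2*pi} (l t))
      \<le> integral {0..2*pi} (W 0) - integral {0..2*pi} (W (- T))"
    unfolding m_def m2_def by linarith
  have "m (- T) \<le> m 0"
    using DERIV_nonneg_imp_nondecreasing[of "- T" 0 m] dm m1nn T by (metis neg_le_0_iff_le)
  then show "integral {0..2*pi} (W (- T)) \<le> integral {0..2*pi} (W 0)" unfolding m_def .
qed

section \<open>Trigonometric polynomials and their harmonic extensions\<close>

lemma Cauchy_Schwarz_sum_inner:
  fixes h k :: "'i \<Rightarrow> 'a::real_inner"
  shows "(\<Sum>i\<in>I. h i \<bullet> k i)\<^sup>2 \<le> (\<Sum>i\<in>I. (norm (h i))\<^sup>2) * (\<Sum>i\<in>I. (norm (k i))\<^sup>2)"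
proof -
  have "\<bar>\<Sum>i\<in>I. h i \<bullet> k i\<bar> \<le> (\<Sum>i\<in>I. norm (h i) * norm (k i))"
    by (rule order_trans[OF sum_abs sum_mono]) (rule Cauchy_Schwarz_ineq2)
  then have "(\<Sum>i\<in>I. h i \<bullet> k i)\<^sup>2 \<le> (\<Sum>i\<in>I. norm (h i) * norm (k i))\<^sup>2"
    by (metis abs_ge_zero power2_abs power_mono)
  also have "\<dots> \<le> (\<Sum>i\<in>I. (norm (h i))\<^sup>2) * (\<Sum>i\<in>I. (norm (k i))\<^sup>2)"
    by (rule Cauchy_Schwarz_ineq_sum)
  finally show ?thesis .
qed

lemma jet2_norm_square:
  fixes h :: "'i \<Rightarrow> real \<Rightarrow> real \<Rightarrow> 'a::real_inner"
  assumes "finite I" and "\<And>i. i \<in> I \<Longrightarrow> jet2 (h i) (ht i) (hx i) (\<lambda>t x. 0)"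
  shows "jet2 (\<lambda>t x. \<Sum>i\<in>I. (norm (h i t x))\<^sup>2)
     (\<lambda>t x. 2 * (\<Sum>i\<in>I. h i t x \<bullet> ht i t x)) (\<lambda>t x. 2 * (\<Sum>i\<in>I. h i t x \<bullet> hx i t x))
     (\<lambda>t x. 2 * (\<Sum>i\<in>I. (norm (ht i t x))\<^sup>2 + (norm (hx i t x))\<^sup>2))"
proof -
  have "jet2 (\<lambda>t x. (norm (h i t x))\<^sup>2) (\<lambda>t x. 2 * (h i t x \<bullet> ht i t x)) (\<lambda>t x. 2 * (h i t x \<bullet> hx i t x))
     (\<lambda>t x. 2 * ((norm (ht i t x))\<^sup>2 + (norm (hx i t x))\<^sup>2))" if "i \<in> I" for i
    using jet2_inner[OF assms(2)[OF that] assms(2)[OF that]]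
    by (simp add: power2_norm_eq_inner inner_commute)
  from jet2_sum[OF assms(1) this] show ?thesis by (simp add: sum_distrib_left)
qed

text \<open>With \<open>U = \<bar>h\<bar>\<^sup>2\<close> this is \<open>\<bar>\<nabla>U\<bar>\<^sup>2 \<le> 2 U \<Delta>U\<close> for harmonic \<open>h\<close>. For holomorphic \<open>h\<close> the factor 2 disappears; that
  difference decides below whether powers of \<open>U\<close> lose a factor \<open>p - 1\<close>.\<close>

lemma gradient_norm_square_le:
  fixes h :: "'i \<Rightarrow> 'a::real_inner"
  shows "(2 * (\<Sum>i\<in>I. h i \<bullet> ht i))\<^sup>2 + (2 * (\<Sum>i\<in>I. h i \<bullet> hx i))\<^sup>2
    \<le> 2 * (\<Sum>i\<in>I. (norm (h i))\<^sup>2) * (2 * (\<Sum>i\<in>I. (norm (ht i))\<^sup>2 + (norm (hx i))\<^sup>2))"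
  using Cauchy_Schwarz_sum_inner[of h ht I] Cauchy_Schwarz_sum_inner[of h hx I]
  by (simp add: sum.distrib power2_eq_square algebra_simps)

text \<open>The bounded harmonic extension of \<open>exp (\<i>nx)\<close> from \<open>t = 0\<close> to \<open>t < 0\<close>: \<open>z ^ n\<close> for \<open>n \<ge> 0\<close> and the
  conjugate of \<open>z ^ \<bar>n\<bar>\<close> for \<open>n < 0\<close>.\<close>

definition harmonic_mode :: "int \<Rightarrow> real \<Rightarrow> real \<Rightarrow> complex" where
  "harmonic_mode n t x = exp (of_real (\<bar>real_of_int n\<bar> * t) + \<i> * of_int n * of_real x)"

definition harmonic_sum :: "int set \<Rightarrow> (int \<Rightarrow> complex) \<Rightarrow> real \<Rightarrow> real \<Rightarrow> complex" where
  "harmonic_sum A c t x = (\<Sum>n\<in>A. c n * harmonic_mode n t x)"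

abbreviation trig_sum :: "int set \<Rightarrow> (int \<Rightarrow> complex) \<Rightarrow> real \<Rightarrow> complex" where
  "trig_sum A c x \<equiv> (\<Sum>n\<in>A. c n * exp (\<i> * of_int n * of_real x))"

lemma harmonic_sum_0: "harmonic_sum A c 0 x = trig_sum A c x"
  by (simp add: harmonic_sum_def harmonic_mode_def)

lemma norm_harmonic_mode: "cmod (harmonic_mode n t x) = exp (\<bar>real_of_int n\<bar> * t)"
  by (simp add: harmonic_mode_def norm_exp_eq_Re)

lemma harmonic_mode_periodic: "harmonic_mode n t (x + 2 * pi) = harmonic_mode n t x"
proof -
  have "of_real (\<bar>real_of_int n\<bar> * t) + \<i> * of_int n * of_real (x + 2 * pi)
    = of_real (\<bar>real_of_int n\<bar> * t) + \<i> * of_int n * of_real x + \<i> * of_int n * of_real (2 * pi)"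
    by (simp add: algebra_simps)
  then have "harmonic_mode n t (x + 2 * pi) = harmonic_mode n t x * exp (\<i> * of_int n * of_real (2 * pi))"
    unfolding harmonic_mode_def by (simp only: exp_add)
  also have "exp (\<i> * of_int n * of_real (2 * pi)) = 1"
    using exp_integer_2pi[of "of_int n"] by (simp add: mult_ac)
  finally show ?thesis by simp
qed

lemma harmonic_sum_periodic: "harmonic_sum A c t (x + 2 * pi) = harmonic_sum A c t x"
  by (simp add: harmonic_sum_def harmonic_mode_periodic)

lemma norm_harmonic_sum_le:
  assumes "\<And>n. n \<in> A \<Longrightarrow> k \<le> \<bar>real_of_int n\<bar>" "t \<le> 0"
  shows "cmod (harmonic_sum A c t x) \<le> exp (k * t) * (\<Sum>n\<in>A. cmod (c n))"
proof -
  have "cmod (harmonic_sum A c t x) \<le> (\<Sum>n\<in>A. cmod (c n) * exp (\<bar>real_of_int n\<bar> * t))"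
    unfolding harmonic_sum_def by (rule order_trans[OF norm_sum]) (simp add: norm_mult norm_harmonic_mode)
  also have "\<dots> \<le> (\<Sum>n\<in>A. cmod (c n) * exp (k * t))"
    using assms by (intro sum_mono mult_left_mono) (auto intro: mult_right_mono_neg)
  finally show ?thesis by (simp add: sum_distrib_left mult.commute)
qed

lemma has_vector_derivative_harmonic_mode:
  "((\<lambda>t. harmonic_mode n t x) has_vector_derivative of_real \<bar>real_of_int n\<bar> * harmonic_mode n t x) (at t)"
  "((\<lambda>x. harmonic_mode n t x) has_vector_derivative \<i> * of_int n * harmonic_mode n t x) (at x)"
proof -
  have *: "((\<lambda>s. exp (a + b * of_real s)) has_vector_derivative b * exp (a + b * of_real s)) (at s)"
    for a b :: complex and s :: real
    by (rule has_vector_derivative_real_field) (auto intro!: derivative_eq_intros)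
  show "((\<lambda>t. harmonic_mode n t x) has_vector_derivative of_real \<bar>real_of_int n\<bar> * harmonic_mode n t x) (at t)"
    using *[of "\<i> * of_int n * of_real x" "of_real \<bar>real_of_int n\<bar>" t]
    by (simp add: harmonic_mode_def add.commute)
  show "((\<lambda>x. harmonic_mode n t x) has_vector_derivative \<i> * of_int n * harmonic_mode n t x) (at x)"
    using *[of "of_real (\<bar>real_of_int n\<bar> * t)" "\<i> * of_int n" x]
    by (simp add: harmonic_mode_def)
qed

lemma continuous_harmonic_mode: "continuous_on UNIV (\<lambda>z. harmonic_mode n (fst z) (snd z))"
  unfolding harmonic_mode_def by (intro continuous_intros)

lemma jet2_harmonic_sum:
  assumes "finite A"
  shows "jet2 (harmonic_sum A c) (harmonic_sum A (\<lambda>n. of_real \<bar>real_of_int n\<bar> * c n))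
     (harmonic_sum A (\<lambda>n. \<i> * of_int n * c n)) (\<lambda>t x. 0)"
proof -
  have "jet2 (\<lambda>t x. c n * harmonic_mode n t x) (\<lambda>t x. of_real \<bar>real_of_int n\<bar> * c n * harmonic_mode n t x)
     (\<lambda>t x. \<i> * of_int n * c n * harmonic_mode n t x) (\<lambda>t x. 0)" for n
  proof (rule jet2I)
    show "((\<lambda>t. c n * harmonic_mode n t x) has_vector_derivative
        of_real \<bar>real_of_int n\<bar> * c n * harmonic_mode n t x) (at t)" for t x
      using has_vector_derivative_mult_right[OF has_vector_derivative_harmonic_mode(1)[of n x t], of "c n"]
      by (simp add: mult_ac)
    show "((\<lambda>x. c n * harmonic_mode n t x) has_vector_derivative
        \<i> * of_int n * c n * harmonic_mode n t x) (at x)" for t x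
      using has_vector_derivative_mult_right[OF has_vector_derivative_harmonic_mode(2)[of n t x], of "c n"]
      by (simp add: mult_ac)
    show "\<And>t x. ((\<lambda>t. of_real \<bar>real_of_int n\<bar> * c n * harmonic_mode n t x) has_vector_derivative
        of_real \<bar>real_of_int n\<bar> * c n * (of_real \<bar>real_of_int n\<bar> * harmonic_mode n t x)) (at t)"
      by (intro has_vector_derivative_mult_right has_vector_derivative_harmonic_mode)
    show "\<And>t x. ((\<lambda>x. \<i> * of_int n * c n * harmonic_mode n t x) has_vector_derivative
        \<i> * of_int n * c n * (\<i> * of_int n * harmonic_mode n t x)) (at x)"
      by (intro has_vector_derivative_mult_right has_vector_derivative_harmonic_mode)
    have "of_real \<bar>real_of_int n\<bar> * of_real \<bar>real_of_int n\<bar> = (of_int n * of_int n :: complex)"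
      by (metis abs_mult_self_eq of_real_mult of_real_of_int_eq)
    then show "\<And>t x. 0 = of_real \<bar>real_of_int n\<bar> * c n * (of_real \<bar>real_of_int n\<bar> * harmonic_mode n t x) +
        \<i> * of_int n * c n * (\<i> * of_int n * harmonic_mode n t x)"
      by (simp add: algebra_simps)
  qed (intro continuous_intros continuous_harmonic_mode)+
  from jet2_sum[OF assms this] show ?thesis
    unfolding harmonic_sum_def by simp
qed

lemma continuous_harmonic_sum: "finite A \<Longrightarrow> continuous_on UNIV (\<lambda>z. harmonic_sum A c (fst z) (snd z))"
  unfolding harmonic_sum_def by (intro continuous_intros continuous_harmonic_mode)

lemma jet2_add_const:
  assumes "jet2 u ut ux l" shows "jet2 (\<lambda>t x. u t x + e) ut ux l"
  using jet2_add[OF assms jet2_const[of e]] by simp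

text \<open>Removes the positive constant that keeps the powers smooth where their base vanishes.\<close>

lemma integral_powr_add_tendsto:
  fixes g :: "real \<Rightarrow> real"
  assumes g: "continuous_on {0..2*pi} g" "\<And>x. 0 \<le> g x" and b: "0 < b"
  shows "((\<lambda>e. integral {0..2*pi} (\<lambda>x. (g x + e) powr b)) \<longlongrightarrow> integral {0..2*pi} (\<lambda>x. g x powr b)) (at_right 0)"
proof -
  have "continuous_on ({0..1} \<times> cbox 0 (2*pi)) (\<lambda>(e, x). (g x + e) powr b)"
    unfolding case_prod_unfold
  proof (intro continuous_on_powr' continuous_intros)
    show "continuous_on ({0..1} \<times> cbox 0 (2*pi)) (\<lambda>z. g (snd z))"
      by (rule continuous_on_compose2[OF g(1)]) (auto intro: continuous_intros)
  qed (use g b in \<open>auto simp: add_nonneg_nonneg\<close>)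
  from integral_continuous_on_param[OF this]
  have "continuous_on {0..1} (\<lambda>e. integral {0..2*pi} (\<lambda>x. (g x + e) powr b))" by simp
  from this[unfolded continuous_on_def, rule_format, of 0]
  have "((\<lambda>e. integral {0..2*pi} (\<lambda>x. (g x + e) powr b)) \<longlongrightarrow> integral {0..2*pi} (\<lambda>x. (g x + 0) powr b)) (at 0 within {0..1})"
    by simp
  moreover have "at 0 within {0..1::real} = at_right 0"
    by (simp add: at_within_Icc_at_right)
  ultimately show ?thesis by simp
qed

lemma powr_split:
  fixes u :: real assumes "0 < u"
  shows "u powr (a - 1) = u powr (a - 2) * u" "u powr a = u powr (a - 2) * u\<^sup>2"
proof -
  have "u powr (a - 2) * u powr 1 = u powr (a - 1)" unfolding powr_add[symmetric] by simp
  then show "u powr (a - 1) = u powr (a - 2) * u" using assms by simp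
  have "u powr (a - 2) * u powr 2 = u powr a" unfolding powr_add[symmetric] by simp
  then show "u powr a = u powr (a - 2) * u\<^sup>2" using assms by simp
qed

text \<open>The expression on the left is the Laplacian of \<open>u powr a\<close>, with \<open>g = \<bar>\<nabla>u\<bar>\<^sup>2\<close> and \<open>l = \<Delta>u\<close>.\<close>

lemma laplacian_powr_upper:
  fixes u :: real
  assumes "0 < u" "0 \<le> a" "a \<le> 1" "0 \<le> g"
  shows "a * u powr (a - 1) * l + a * (a - 1) * u powr (a - 2) * g \<le> a * u powr (a - 1) * l"
proof -
  have "a * (1 - a) * u powr (a - 2) * g \<ge> 0" using assms by simp
  then show ?thesis by (simp add: algebra_simps)
qed

text \<open>With \<open>a = p / 2\<close> the loss \<open>1 - k (1 - a)\<close> is \<open>p - 1\<close> for \<open>k = 2\<close> (harmonic functions) but \<open>p / 2\<close> for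
  \<open>k = 1\<close> (holomorphic functions), which stays away from zero as \<open>p\<close> tends to \<open>1\<close>.\<close>

lemma laplacian_powr_lower:
  fixes u :: real
  assumes "0 < u" "0 \<le> a" "a \<le> 1" "g \<le> k * u * l"
  shows "a * (1 - k * (1 - a)) * u powr (a - 1) * l
     \<le> a * u powr (a - 1) * l + a * (a - 1) * u powr (a - 2) * g"
proof -
  have "a * (1 - a) * u powr (a - 2) * g \<le> a * (1 - a) * u powr (a - 2) * (k * u * l)"
    using assms by (intro mult_left_mono) auto
  also have "\<dots> = a * (k * (1 - a)) * u powr (a - 1) * l"
    unfolding powr_split(1)[OF assms(1)] by simp
  finally show ?thesis by (simp add: algebra_simps)
qed

section \<open>The vector-valued Riesz projection\<close>

lemma continuous_l2_powr:
  fixes f :: "'i \<Rightarrow> 'b::topological_space \<Rightarrow> 'a::real_normed_vector"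
  assumes "\<And>i. i \<in> I \<Longrightarrow> continuous_on S (f i)" "0 < b"
  shows "continuous_on S (\<lambda>x. (\<Sum>i\<in>I. (norm (f i x))\<^sup>2) powr b)"
  by (intro continuous_on_powr' continuous_intros assms) (auto simp: sum_nonneg assms)

text \<open>Write \<open>f = G + R\<close> with \<open>G\<close> holomorphic and \<open>R\<close> antiholomorphic, both vector valued. By the parallelogram
  law \<open>\<bar>f\<bar>\<^sup>2\<close> and \<open>\<bar>G\<bar>\<^sup>2 + \<bar>R\<bar>\<^sup>2\<close> have the same Laplacian, while \<open>\<bar>f\<bar>\<^sup>2 \<le> 2 (\<bar>G\<bar>\<^sup>2 + \<bar>R\<bar>\<^sup>2)\<close>. As \<open>p / 2 \<le> 1\<close>, this makes
  \<open>2 / (p - 1) * \<bar>f\<bar> ^ p - (\<bar>G\<bar>\<^sup>2 + \<bar>R\<bar>\<^sup>2) powr (p / 2)\<close> subharmonic. Its value at the centre of the disc, where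
  \<open>R = 0\<close>, is nonnegative, hence so is its mean over the unit circle.\<close>

lemma riesz_projection_l2_perturbed:
  fixes c :: "'i \<Rightarrow> int \<Rightarrow> complex"
  assumes I: "finite I" and A: "finite A" and p: "1 < p" "p \<le> 2" and e: "0 < e"
  shows "integral {0..2*pi} (\<lambda>x. (\<Sum>i\<in>I. (cmod (trig_sum (A \<inter> {0..}) (c i) x))\<^sup>2) powr (p / 2))
    \<le> 2 / (p - 1) * integral {0..2*pi} (\<lambda>x. ((\<Sum>i\<in>I. (cmod (trig_sum A (c i) x))\<^sup>2) + 2 * e) powr (p / 2))"
proof -
  define a K where "a = p / 2" and "K = 2 / (p - 1)"
  have a: "0 < a" "1/2 < a" "a \<le> 1" and K: "K \<ge> 1" "K > 0" "K * (2 * a - 1) = 2"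
    using p by (auto simp: a_def K_def field_simps)
  define dt where "dt c n = of_real \<bar>real_of_int n\<bar> * c n" for c :: "int \<Rightarrow> complex" and n
  define dx where "dx c n = \<i> * of_int n * c n" for c :: "int \<Rightarrow> complex" and n
  define G R where "G i = harmonic_sum (A \<inter> {0..}) (c i)" and "R i = harmonic_sum (A \<inter> {..<0}) (c i)" for i
  define Gt Rt where "Gt i = harmonic_sum (A \<inter> {0..}) (dt (c i))"
    and "Rt i = harmonic_sum (A \<inter> {..<0}) (dt (c i))" for i
  define Gx Rx where "Gx i = harmonic_sum (A \<inter> {0..}) (dx (c i))"
    and "Rx i = harmonic_sum (A \<inter> {..<0}) (dx (c i))" for i
  have jG: "jet2 (G i) (Gt i) (Gx i) (\<lambda>t x. 0)" and jR: "jet2 (R i) (Rt i) (Rx i) (\<lambda>t x. 0)" for i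
    unfolding G_def Gt_def Gx_def R_def Rt_def Rx_def dt_def dx_def
    by (intro jet2_harmonic_sum finite_Int disjI1 A)+
  have f_eq: "G i t x + R i t x = harmonic_sum A (c i) t x" for i t x
  proof -
    have "harmonic_sum ((A \<inter> {0..}) \<union> (A \<inter> {..<0})) (c i) t x = G i t x + R i t x"
      unfolding G_def R_def harmonic_sum_def by (rule sum.union_disjoint) (use A in auto)
    moreover have "(A \<inter> {0..}) \<union> (A \<inter> {..<0}) = A" by auto
    ultimately show ?thesis by simp
  qed
  \<comment> \<open>the Cauchy--Riemann equations for the two halves of the spectrum\<close>
  have Gx: "Gx i t x = \<i> * Gt i t x" for i t x
    unfolding Gx_def Gt_def harmonic_sum_def dx_def dt_def sum_distrib_left
    by (intro sum.cong refl) (auto simp: mult_ac)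
  have Rx: "Rx i t x = - (\<i> * Rt i t x)" for i t x
    unfolding Rx_def Rt_def harmonic_sum_def dx_def dt_def sum_distrib_left sum_negf[symmetric]
    by (intro sum.cong refl) (auto simp: mult_ac)
  have par: "(cmod (Gt i t x + Rt i t x))\<^sup>2 + (cmod (Gx i t x + Rx i t x))\<^sup>2
      = 2 * ((cmod (Gt i t x))\<^sup>2 + (cmod (Rt i t x))\<^sup>2)" for i t x
    unfolding Gx Rx cmod_power2 by (simp add: power2_eq_square algebra_simps)
  define D where "D t x = (\<Sum>i\<in>I. (cmod (Gt i t x))\<^sup>2 + (cmod (Rt i t x))\<^sup>2)" for t x
  define U V where "U t x = (\<Sum>i\<in>I. (cmod (G i t x + R i t x))\<^sup>2)"
    and "V t x = (\<Sum>i\<in>I. (cmod (G i t x))\<^sup>2) + (\<Sum>i\<in>I. (cmod (R i t x))\<^sup>2)" for t x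
  define Ut Ux where "Ut t x = 2 * (\<Sum>i\<in>I. (G i t x + R i t x) \<bullet> (Gt i t x + Rt i t x))"
    and "Ux t x = 2 * (\<Sum>i\<in>I. (G i t x + R i t x) \<bullet> (Gx i t x + Rx i t x))" for t x
  define Vt Vx where "Vt t x = 2 * (\<Sum>i\<in>I. G i t x \<bullet> Gt i t x) + 2 * (\<Sum>i\<in>I. R i t x \<bullet> Rt i t x)"
    and "Vx t x = 2 * (\<Sum>i\<in>I. G i t x \<bullet> Gx i t x) + 2 * (\<Sum>i\<in>I. R i t x \<bullet> Rx i t x)" for t x
  have jf: "jet2 (\<lambda>t x. G i t x + R i t x) (\<lambda>t x. Gt i t x + Rt i t x) (\<lambda>t x. Gx i t x + Rx i t x) (\<lambda>t x. 0)" for i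
    using jet2_add[OF jG jR] by simp
  have jU: "jet2 U Ut Ux (\<lambda>t x. 4 * D t x)"
  proof -
    have "2 * (\<Sum>i\<in>I. (cmod (Gt i t x + Rt i t x))\<^sup>2 + (cmod (Gx i t x + Rx i t x))\<^sup>2) = 4 * D t x" for t x
      unfolding par D_def sum_distrib_left[symmetric] by simp
    with jet2_norm_square[OF I jf, of "\<lambda>i. i"] show ?thesis
      by (simp add: U_def[abs_def] Ut_def[abs_def] Ux_def[abs_def])
  qed
  have jV: "jet2 V Vt Vx (\<lambda>t x. 4 * D t x)"
  proof -
    have "2 * (\<Sum>i\<in>I. (cmod (Gt i t x))\<^sup>2 + (cmod (Gx i t x))\<^sup>2)
       + 2 * (\<Sum>i\<in>I. (cmod (Rt i t x))\<^sup>2 + (cmod (Rx i t x))\<^sup>2) = 4 * D t x" for t x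
      unfolding D_def Gx Rx by (simp add: norm_mult sum.distrib flip: sum_distrib_left)
    then show ?thesis
      using jet2_add[OF jet2_norm_square[OF I jG, of "\<lambda>i. i"] jet2_norm_square[OF I jR, of "\<lambda>i. i"]]
      by (simp add: V_def[abs_def] Vt_def[abs_def] Vx_def[abs_def])
  qed
  have Unn: "0 \<le> U t x" and Vnn: "0 \<le> V t x" and Dnn: "0 \<le> D t x" for t x
    unfolding U_def V_def D_def by (simp_all add: sum_nonneg)
  have gradU: "(Ut t x)\<^sup>2 + (Ux t x)\<^sup>2 \<le> 2 * U t x * (4 * D t x)" for t x
  proof -
    have "2 * (\<Sum>i\<in>I. (cmod (Gt i t x + Rt i t x))\<^sup>2 + (cmod (Gx i t x + Rx i t x))\<^sup>2) = 4 * D t x"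
      unfolding par D_def sum_distrib_left[symmetric] by simp
    then show ?thesis
      using gradient_norm_square_le[where h = "\<lambda>i. G i t x + R i t x" and ht = "\<lambda>i. Gt i t x + Rt i t x"
        and hx = "\<lambda>i. Gx i t x + Rx i t x" and I = I]
      unfolding U_def Ut_def Ux_def by simp
  qed
  have UV: "U t x \<le> 2 * V t x" for t x
  proof -
    have "(cmod (y + z))\<^sup>2 \<le> 2 * ((cmod y)\<^sup>2 + (cmod z)\<^sup>2)" for y z
    proof -
      have "(cmod (y + z))\<^sup>2 \<le> (cmod y + cmod z)\<^sup>2" by (simp add: norm_triangle_ineq power_mono)
      also have "\<dots> \<le> 2 * ((cmod y)\<^sup>2 + (cmod z)\<^sup>2)" using sum_squares_bound[of "cmod y" "cmod z"]
        by (simp add: power2_sum)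
      finally show ?thesis .
    qed
    then show ?thesis unfolding U_def V_def sum.distrib[symmetric] sum_distrib_left by (intro sum_mono)
  qed
  define W where "W t x = K * (U t x + 2 * e) powr a + (- 1) * (V t x + e) powr a" for t x
  define l where "l t x = K * (a * (U t x + 2 * e) powr (a - 1) * (4 * D t x)
      + a * (a - 1) * (U t x + 2 * e) powr (a - 2) * ((Ut t x)\<^sup>2 + (Ux t x)\<^sup>2))
    + (- 1) * (a * (V t x + e) powr (a - 1) * (4 * D t x)
      + a * (a - 1) * (V t x + e) powr (a - 2) * ((Vt t x)\<^sup>2 + (Vx t x)\<^sup>2))" for t x
  have Upos: "0 < U t x + 2 * e" and Vpos: "0 < V t x + e" for t x
    using Unn[of t x] Vnn[of t x] e by linarith+
  obtain Wt Wx where jW: "jet2 W Wt Wx l"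
    using jet2_add[OF jet2_cmult[OF jet2_powr[OF jet2_add_const[OF jU] Upos, of a], of K]
        jet2_cmult[OF jet2_powr[OF jet2_add_const[OF jV] Vpos, of a], of "- 1"]]
    unfolding W_def[symmetric] l_def[symmetric] by (rule that)
  have per: "W t (x + 2 * pi) = W t x" for t x
    by (simp add: W_def U_def V_def G_def R_def harmonic_sum_periodic)
  have lnn: "0 \<le> l t x" for t x
  proof -
    have "(V t x + e) powr (a - 1) \<le> 2 * (U t x + 2 * e) powr (a - 1)"
    proof -
      have "(V t x + e) powr (a - 1) \<le> ((U t x + 2 * e) / 2) powr (a - 1)"
        using UV[of t x] Upos[of t x] a by (intro powr_mono2') auto
      also have "\<dots> = 2 powr (1 - a) * (U t x + 2 * e) powr (a - 1)"
        using Upos[of t x] powr_minus_divide[of 2 "a - 1"] by (simp add: powr_divide)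
      also have "\<dots> \<le> 2 powr 1 * (U t x + 2 * e) powr (a - 1)"
        using a by (intro mult_right_mono powr_mono) auto
      finally show ?thesis by simp
    qed
    then have 1: "a * (V t x + e) powr (a - 1) * (4 * D t x) \<le> a * (2 * (U t x + 2 * e) powr (a - 1)) * (4 * D t x)"
      using a Dnn[of t x] by (intro mult_right_mono mult_left_mono) auto
    have 2: "a * (V t x + e) powr (a - 1) * (4 * D t x)
      + a * (a - 1) * (V t x + e) powr (a - 2) * ((Vt t x)\<^sup>2 + (Vx t x)\<^sup>2)
      \<le> a * (V t x + e) powr (a - 1) * (4 * D t x)"
      by (rule laplacian_powr_upper) (use Vpos a in auto)
    have g: "(Ut t x)\<^sup>2 + (Ux t x)\<^sup>2 \<le> 2 * (U t x + 2 * e) * (4 * D t x)"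
      using gradU[of t x] mult_nonneg_nonneg[OF less_imp_le[OF e] Dnn[of t x]] by (simp add: algebra_simps)
    have 3: "a * (1 - 2 * (1 - a)) * (U t x + 2 * e) powr (a - 1) * (4 * D t x)
      \<le> a * (U t x + 2 * e) powr (a - 1) * (4 * D t x)
      + a * (a - 1) * (U t x + 2 * e) powr (a - 2) * ((Ut t x)\<^sup>2 + (Ux t x)\<^sup>2)"
      by (rule laplacian_powr_lower[OF _ _ _ g]) (use Upos a in auto)
    have "a * (2 * (U t x + 2 * e) powr (a - 1)) * (4 * D t x)
      = (K * (2 * a - 1)) * (a * (U t x + 2 * e) powr (a - 1) * (4 * D t x))" unfolding K by simp
    also have "\<dots> = K * (a * (1 - 2 * (1 - a)) * (U t x + 2 * e) powr (a - 1) * (4 * D t x))"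
      by (simp add: algebra_simps)
    also have "\<dots> \<le> K * (a * (U t x + 2 * e) powr (a - 1) * (4 * D t x)
      + a * (a - 1) * (U t x + 2 * e) powr (a - 2) * ((Ut t x)\<^sup>2 + (Ux t x)\<^sup>2))"
      using 3 K by (intro mult_left_mono) auto
    finally have 4: "a * (2 * (U t x + 2 * e) powr (a - 1)) * (4 * D t x)
      \<le> K * (a * (U t x + 2 * e) powr (a - 1) * (4 * D t x)
      + a * (a - 1) * (U t x + 2 * e) powr (a - 2) * ((Ut t x)\<^sup>2 + (Ux t x)\<^sup>2))" .
    from order_trans[OF 2 order_trans[OF 1 4]] show ?thesis
      unfolding l_def by (simp only: mult_minus1 add_uminus_conv_diff diff_ge_0_iff_ge)
  qed
  define C where "C i = (\<Sum>n\<in>A. cmod (c i n))" for i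
  have C0: "0 \<le> C i" for i unfolding C_def by (simp add: sum_nonneg)
  have bf: "cmod (G i t x + R i t x) \<le> C i" if "t \<le> 0" for i t x
    using norm_harmonic_sum_le[of A 0 t "c i" x] that unfolding f_eq C_def by simp
  have bG: "cmod (G i t x) \<le> C i" if "t \<le> 0" for i t x
  proof -
    have "cmod (G i t x) \<le> (\<Sum>n\<in>A \<inter> {0..}. cmod (c i n))"
      using norm_harmonic_sum_le[of "A \<inter> {0..}" 0 t "c i" x] that unfolding G_def by simp
    also have "\<dots> \<le> C i" unfolding C_def by (intro sum_mono2 A) auto
    finally show ?thesis .
  qed
  have bR: "cmod (R i t x) \<le> exp t * C i" if "t \<le> 0" for i t x
  proof -
    have "cmod (R i t x) \<le> exp (1 * t) * (\<Sum>n\<in>A \<inter> {..<0}. cmod (c i n))"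
      using that unfolding R_def by (intro norm_harmonic_sum_le) auto
    also have "\<dots> \<le> exp (1 * t) * C i" unfolding C_def by (intro mult_left_mono sum_mono2 A) auto
    finally show ?thesis by simp
  qed
  have bdd: "W t x \<le> K * ((\<Sum>i\<in>I. (C i)\<^sup>2) + 2 * e) powr a" if "t \<le> 0" for t x
  proof -
    have "U t x \<le> (\<Sum>i\<in>I. (C i)\<^sup>2)" unfolding U_def using bf[OF that] by (intro sum_mono power_mono) auto
    then have "(U t x + 2 * e) powr a \<le> ((\<Sum>i\<in>I. (C i)\<^sup>2) + 2 * e) powr a"
      using a Upos[of t x] by (intro powr_mono2) auto
    then have "K * (U t x + 2 * e) powr a \<le> K * ((\<Sum>i\<in>I. (C i)\<^sup>2) + 2 * e) powr a" using K by simp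
    moreover have "0 \<le> (V t x + e) powr a" by simp
    ultimately show ?thesis unfolding W_def by linarith
  qed
  \<comment> \<open>so deep inside the disc that R is too small for W to be negative\<close>
  define T where "T = ln (1 + 2 * (\<Sum>i\<in>I. (C i)\<^sup>2) / e)"
  have sC: "0 \<le> (\<Sum>i\<in>I. (C i)\<^sup>2)" by (simp add: sum_nonneg)
  have T: "0 \<le> T" unfolding T_def using sC e by (intro ln_ge_zero) auto
  have eT: "2 * exp (- T) * (\<Sum>i\<in>I. (C i)\<^sup>2) \<le> e"
  proof -
    have pos: "e + 2 * (\<Sum>i\<in>I. (C i)\<^sup>2) \<noteq> 0" using sC e by linarith
    have "exp (- T) = e / (e + 2 * (\<Sum>i\<in>I. (C i)\<^sup>2))"
    proof -
      have "0 < 1 + 2 * (\<Sum>i\<in>I. (C i)\<^sup>2) / e" using sC e by (intro add_pos_nonneg) auto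
      then have "exp T = 1 + 2 * (\<Sum>i\<in>I. (C i)\<^sup>2) / e" unfolding T_def by simp
      then show ?thesis using e pos by (simp add: exp_minus field_simps)
    qed
    then have "e * exp (- T) + 2 * exp (- T) * (\<Sum>i\<in>I. (C i)\<^sup>2) = e" using pos by (simp add: field_simps)
    moreover have "0 \<le> e * exp (- T)" using e by simp
    ultimately show ?thesis by linarith
  qed
  have Wlow: "0 \<le> W (- T) x" for x
  proof -
    have "V (- T) x - U (- T) x \<le> (\<Sum>i\<in>I. 2 * exp (- T) * (C i)\<^sup>2)"
      unfolding V_def U_def sum.distrib[symmetric] sum_subtractf[symmetric]
    proof (rule sum_mono)
      fix i
      have 0: "(cmod y)\<^sup>2 + (cmod z)\<^sup>2 - (cmod (y + z))\<^sup>2 \<le> 2 * (cmod y * cmod z)" for y z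
      proof -
        have "(cmod (y + z))\<^sup>2 = (cmod y)\<^sup>2 + (cmod z)\<^sup>2 + 2 * (y \<bullet> z)"
          by (simp add: power2_norm_eq_inner inner_add_left inner_add_right inner_commute)
        with Cauchy_Schwarz_ineq2[of y z] show ?thesis by linarith
      qed
      have "cmod (G i (- T) x) * cmod (R i (- T) x) \<le> C i * (exp (- T) * C i)"
        using bG[of "- T" i x] bR[of "- T" i x] T C0[of i] by (intro mult_mono) auto
      with 0[of "G i (- T) x" "R i (- T) x"]
      show "(cmod (G i (- T) x))\<^sup>2 + (cmod (R i (- T) x))\<^sup>2 - (cmod (G i (- T) x + R i (- T) x))\<^sup>2
         \<le> 2 * exp (- T) * (C i)\<^sup>2" by (simp add: power2_eq_square mult_ac)
    qed
    then have "V (- T) x + e \<le> U (- T) x + 2 * e" using eT by (simp add: sum_distrib_left)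
    then have "(V (- T) x + e) powr a \<le> (U (- T) x + 2 * e) powr a"
      using a Vpos[of "- T" x] by (intro powr_mono2) auto
    also have "\<dots> \<le> K * (U (- T) x + 2 * e) powr a" using K by (simp add: mult_le_cancel_right1)
    finally show ?thesis unfolding W_def by simp
  qed
  have contU: "continuous_on UNIV (\<lambda>z. U (fst z) (snd z))" and contV: "continuous_on UNIV (\<lambda>z. V (fst z) (snd z))"
    unfolding U_def V_def G_def R_def by (intro continuous_intros continuous_harmonic_sum finite_Int disjI1 A)+
  have cU: "continuous_on {0..2*pi} (\<lambda>x. U 0 x)" and cV: "continuous_on {0..2*pi} (\<lambda>x. V 0 x)"
    using continuous_slice[OF contU] continuous_slice[OF contV] by auto
  have iU: "(\<lambda>x. (U 0 x + 2 * e) powr a) integrable_on {0..2*pi}"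
    by (intro integrable_continuous_interval continuous_on_powr continuous_intros cU) (metis Upos less_irrefl)
  have iV: "(\<lambda>x. (V 0 x + e) powr a) integrable_on {0..2*pi}"
    by (intro integrable_continuous_interval continuous_on_powr continuous_intros cV) (metis Vpos less_irrefl)
  have contW: "continuous_on UNIV (\<lambda>z. W (fst z) (snd z))"
    by (rule jet2_continuous[OF jW])
  have "0 \<le> integral {0..2*pi} (W (- T))"
    by (intro integral_nonneg integrable_continuous_interval continuous_slice[OF contW] Wlow)
  also have "\<dots> \<le> integral {0..2*pi} (W 0)"
    by (rule green_circle(2)[OF jW per lnn bdd T])
  also have "integral {0..2*pi} (W 0)
     = K * integral {0..2*pi} (\<lambda>x. (U 0 x + 2 * e) powr a) - integral {0..2*pi} (\<lambda>x. (V 0 x + e) powr a)"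
  proof -
    have "integral {0..2*pi} (W 0) = integral {0..2*pi} (\<lambda>x. K * (U 0 x + 2 * e) powr a - (V 0 x + e) powr a)"
      by (simp add: W_def[abs_def])
    also have "\<dots> = integral {0..2*pi} (\<lambda>x. K * (U 0 x + 2 * e) powr a) - integral {0..2*pi} (\<lambda>x. (V 0 x + e) powr a)"
      by (rule integral_diff) (use iU iV in \<open>auto intro: integrable_on_mult_right\<close>)
    finally show ?thesis by simp
  qed
  finally have main: "integral {0..2*pi} (\<lambda>x. (V 0 x + e) powr a) \<le> K * integral {0..2*pi} (\<lambda>x. (U 0 x + 2 * e) powr a)"
    by simp
  have "integral {0..2*pi} (\<lambda>x. (\<Sum>i\<in>I. (cmod (G i 0 x))\<^sup>2) powr a) \<le> integral {0..2*pi} (\<lambda>x. (V 0 x + e) powr a)"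
  proof (rule integral_le[OF _ iV])
    show "(\<lambda>x. (\<Sum>i\<in>I. (cmod (G i 0 x))\<^sup>2) powr a) integrable_on {0..2*pi}"
      unfolding G_def harmonic_sum_0
      by (intro integrable_continuous_interval continuous_l2_powr continuous_intros a)
    show "(\<Sum>i\<in>I. (cmod (G i 0 x))\<^sup>2) powr a \<le> (V 0 x + e) powr a" for x
      using a e by (intro powr_mono2) (auto simp: V_def sum_nonneg intro!: add_increasing2)
  qed
  moreover have "U 0 x = (\<Sum>i\<in>I. (cmod (trig_sum A (c i) x))\<^sup>2)" for x
    unfolding U_def f_eq harmonic_sum_0 ..
  ultimately show ?thesis
    using main unfolding G_def harmonic_sum_0 a_def K_def by simp
qed

text \<open>M. Riesz' theorem for \<open>\<ell>\<^sup>2\<close>-valued functions, stated for \<open>p\<close>-th powers.\<close>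

theorem riesz_projection_l2:
  fixes c :: "'i \<Rightarrow> int \<Rightarrow> complex"
  assumes I: "finite I" and A: "finite A" and p: "1 < p" "p \<le> 2"
  shows "integral {0..2*pi} (\<lambda>x. (\<Sum>i\<in>I. (cmod (trig_sum (A \<inter> {0..}) (c i) x))\<^sup>2) powr (p / 2))
    \<le> 2 / (p - 1) * integral {0..2*pi} (\<lambda>x. (\<Sum>i\<in>I. (cmod (trig_sum A (c i) x))\<^sup>2) powr (p / 2))"
proof (rule tendsto_lowerbound)
  show "((\<lambda>e. 2 / (p - 1) * integral {0..2*pi} (\<lambda>x. ((\<Sum>i\<in>I. (cmod (trig_sum A (c i) x))\<^sup>2) + e) powr (p / 2)))
     \<longlongrightarrow> 2 / (p - 1) * integral {0..2*pi} (\<lambda>x. (\<Sum>i\<in>I. (cmod (trig_sum A (c i) x))\<^sup>2) powr (p / 2))) (at_right 0)"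
    by (intro tendsto_mult_left integral_powr_add_tendsto continuous_intros) (use p in \<open>auto simp: sum_nonneg\<close>)
  show "\<forall>\<^sub>F e in at_right 0. integral {0..2*pi} (\<lambda>x. (\<Sum>i\<in>I. (cmod (trig_sum (A \<inter> {0..}) (c i) x))\<^sup>2) powr (p / 2))
     \<le> 2 / (p - 1) * integral {0..2*pi} (\<lambda>x. ((\<Sum>i\<in>I. (cmod (trig_sum A (c i) x))\<^sup>2) + e) powr (p / 2))"
    using riesz_projection_l2_perturbed[OF assms, of "_ / 2"]
    by (intro eventually_at_rightI[of 0 1]) auto
qed auto

section \<open>A bilinear embedding for analytic functions\<close>

text \<open>The inequality \<open>\<bar>\<nabla>X\<bar>\<^sup>2 \<le> C X \<Delta>X\<close> passes from \<open>u\<close> to \<open>X = u powr a\<close>: with \<open>C = 1\<close> for every \<open>a \<ge> 0\<close>, and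
  with \<open>C = 2\<close> for \<open>a \<ge> 1\<close>. As the constants do not depend on \<open>a\<close>, the exponents \<open>p / 2\<close> and \<open>q / 2\<close> are
  covered uniformly, also when \<open>q\<close> tends to infinity.\<close>

lemma gradient_powr_le_small:
  fixes u :: real
  assumes u: "0 < u" and a: "0 \<le> a" and g: "g \<le> u * l"
  shows "(a * u powr (a - 1))\<^sup>2 * g
     \<le> u powr a * (a * u powr (a - 1) * l + a * (a - 1) * u powr (a - 2) * g)"
proof -
  define w where "w = u powr (a - 2)"
  have "a * (w * u)\<^sup>2 * g \<le> a * (w * u)\<^sup>2 * (u * l)"
    using g a by (intro mult_left_mono) auto
  then show ?thesis
    unfolding powr_split[OF u, of a] w_def[symmetric] by (simp add: power2_eq_square algebra_simps)
qed

lemma gradient_powr_le_large: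
  fixes u :: real
  assumes u: "0 < u" and a: "1 \<le> a" and g: "0 \<le> g" "g \<le> 2 * u * l"
  shows "(a * u powr (a - 1))\<^sup>2 * g
     \<le> 2 * (u powr a * (a * u powr (a - 1) * l + a * (a - 1) * u powr (a - 2) * g))"
proof -
  define w where "w = u powr (a - 2)"
  have 1: "a * (w * u)\<^sup>2 * g \<le> a * (w * u)\<^sup>2 * (2 * u * l)"
    using g a by (intro mult_left_mono) auto
  have 2: "a * (w * u)\<^sup>2 * g * 1 \<le> a * (w * u)\<^sup>2 * g * a"
    using g a by (intro mult_left_mono) auto
  have "2 * (w * u\<^sup>2 * (a * (w * u) * l + a * (a - 1) * w * g)) - (a * (w * u))\<^sup>2 * g
    = (a * (w * u)\<^sup>2 * (2 * u * l) - a * (w * u)\<^sup>2 * g) + (a * (w * u)\<^sup>2 * g * a - a * (w * u)\<^sup>2 * g * 1)"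
    by (simp add: power2_eq_square algebra_simps)
  with 1 2 show ?thesis
    unfolding powr_split[OF u, of a] w_def[symmetric] by linarith
qed

lemma inner2_le:
  fixes a b c d :: real
  assumes sk: "0 < s" "0 \<le> k"
  shows "2 * \<bar>a * c + b * d\<bar> * k \<le> s * (a\<^sup>2 + b\<^sup>2) + k\<^sup>2 / s * (c\<^sup>2 + d\<^sup>2)"
proof -
  have *: "2 * \<bar>y * z\<bar> * k \<le> s * y\<^sup>2 + k\<^sup>2 / s * z\<^sup>2" for y z
  proof -
    have "0 \<le> (s * \<bar>y\<bar> - k * \<bar>z\<bar>)\<^sup>2 / s" using sk by simp
    also have "\<dots> = s * \<bar>y\<bar>\<^sup>2 + k\<^sup>2 / s * \<bar>z\<bar>\<^sup>2 - 2 * (\<bar>y\<bar> * \<bar>z\<bar>) * k"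
      using sk(1) unfolding power2_eq_square by (simp add: divide_simps) (simp add: algebra_simps)
    finally show ?thesis by (simp add: abs_mult)
  qed
  have "2 * \<bar>a * c + b * d\<bar> * k \<le> 2 * (\<bar>a * c\<bar> + \<bar>b * d\<bar>) * k"
    using sk by (intro mult_right_mono mult_left_mono abs_triangle_ineq) auto
  also have "\<dots> = 2 * \<bar>a * c\<bar> * k + 2 * \<bar>b * d\<bar> * k" by (simp add: algebra_simps)
  also have "\<dots> \<le> (s * a\<^sup>2 + k\<^sup>2 / s * c\<^sup>2) + (s * b\<^sup>2 + k\<^sup>2 / s * d\<^sup>2)"
    by (intro add_mono *)
  finally show ?thesis by (simp add: algebra_simps)
qed

text \<open>The right-hand side is the Laplacian of \<open>X powr s * v\<close>. The good term is \<open>X powr s * \<Delta>v\<close>; the cross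
  term is split by Young's inequality, half of the good term absorbing \<open>\<bar>\<nabla>v\<bar>\<^sup>2\<close>. What remains carries the factor
  \<open>v * X powr (s - 1) \<le> 1\<close>, and \<open>\<bar>\<nabla>X\<bar>\<^sup>2 \<le> 4 X \<Delta>X\<close> turns it into a multiple of \<open>\<Delta>X\<close>.\<close>

lemma laplacian_product_lower:
  fixes X v :: real
  assumes X: "0 < X" and v: "0 < v" and s: "0 \<le> s" "s \<le> 1"
    and vX: "v * X powr (s - 1) \<le> 1"
    and gX: "Xt\<^sup>2 + Xx\<^sup>2 \<le> 4 * X * LX" and gv: "vt\<^sup>2 + vx\<^sup>2 \<le> 2 * v * lv"
    and L: "0 \<le> LX" "0 \<le> lv"
  shows "X powr s * lv / 2 - 17 * LX
    \<le> X powr s * lv + (s * X powr (s - 1) * LX + s * (s - 1) * X powr (s - 2) * (Xt\<^sup>2 + Xx\<^sup>2)) * v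
       + 2 * ((s * X powr (s - 1) * Xt) * vt + (s * X powr (s - 1) * Xx) * vx)"
proof -
  define w where "w = X powr (s - 2)"
  have w: "0 < w" using X by (simp add: w_def)
  have wv: "v * (w * X) \<le> 1" using vX unfolding powr_split(1)[OF X, of s] w_def[symmetric] .
  have wvLX: "v * (w * X) * LX \<le> LX" using mult_right_mono[OF wv L(1)] by simp
  have wvLX0: "0 \<le> v * (w * X) * LX" using w X v L by simp
  have 1: "0 \<le> s * (w * X) * LX * v" using s w X L v by simp
  have 2: "s * (1 - s) * w * (Xt\<^sup>2 + Xx\<^sup>2) * v \<le> LX"
  proof -
    have "s * (1 - s) * w * (Xt\<^sup>2 + Xx\<^sup>2) * v \<le> s * (1 - s) * w * (4 * X * LX) * v"
      using s w v gX by (intro mult_right_mono mult_left_mono) auto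
    also have "\<dots> = (4 * (s * (1 - s))) * (v * (w * X) * LX)" by simp
    also have "\<dots> \<le> 1 * (v * (w * X) * LX)"
    proof (rule mult_right_mono[OF _ wvLX0])
      have "0 \<le> (2 * s - 1)\<^sup>2" by simp
      then show "4 * (s * (1 - s)) \<le> 1" by (simp add: power2_eq_square algebra_simps)
    qed
    finally show ?thesis using wvLX by simp
  qed
  have 3: "2 * \<bar>vt * Xt + vx * Xx\<bar> * (s * (w * X)) \<le> w * X\<^sup>2 * lv / 2 + 16 * LX"
  proof -
    \<comment> \<open>the weight X / (4 v) makes the v-part at most half of the good term\<close>
    have "2 * \<bar>vt * Xt + vx * Xx\<bar> * 1 \<le> X / (4 * v) * (vt\<^sup>2 + vx\<^sup>2) + 1\<^sup>2 / (X / (4 * v)) * (Xt\<^sup>2 + Xx\<^sup>2)"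
      by (rule inner2_le) (use X v in auto)
    also have "\<dots> \<le> X / (4 * v) * (2 * v * lv) + 1\<^sup>2 / (X / (4 * v)) * (4 * X * LX)"
      using X v gX gv by (intro add_mono mult_left_mono) auto
    also have "\<dots> = X * lv / 2 + 16 * v * LX" using X v by (simp add: field_simps)
    finally have "2 * \<bar>vt * Xt + vx * Xx\<bar> * (s * (w * X)) \<le> (X * lv / 2 + 16 * v * LX) * (s * (w * X))"
      using s w X by (intro mult_right_mono) auto
    also have "\<dots> \<le> (X * lv / 2 + 16 * v * LX) * (1 * (w * X))"
      using s w X L v by (intro mult_left_mono mult_right_mono) auto
    also have "\<dots> = w * X\<^sup>2 * lv / 2 + 16 * (v * (w * X) * LX)" by (simp add: power2_eq_square algebra_simps)
    finally show ?thesis using wvLX by linarith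
  qed
  have 4: "- (2 * \<bar>vt * Xt + vx * Xx\<bar> * (s * (w * X))) \<le> 2 * ((s * (w * X) * Xt) * vt + (s * (w * X) * Xx) * vx)"
  proof -
    have "- \<bar>vt * Xt + vx * Xx\<bar> * (2 * s * (w * X)) \<le> (vt * Xt + vx * Xx) * (2 * s * (w * X))"
      using s w X by (intro mult_right_mono) auto
    then show ?thesis by (simp add: algebra_simps)
  qed
  have "w * X\<^sup>2 * lv + (s * (w * X) * LX + s * (s - 1) * w * (Xt\<^sup>2 + Xx\<^sup>2)) * v
    = w * X\<^sup>2 * lv + s * (w * X) * LX * v - s * (1 - s) * w * (Xt\<^sup>2 + Xx\<^sup>2) * v"
    by (simp add: algebra_simps)
  with 1 2 3 4 show ?thesis unfolding powr_split[OF X, of s] w_def[symmetric] by linarith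
qed

text \<open>Green's formula is applied to \<open>Z = 18 X + X powr s * v\<close>, where \<open>u = \<bar>F\<bar>\<^sup>2 + e\<close>, \<open>v = \<bar>h\<bar>\<^sup>2 + e\<close>,
  \<open>X = u powr (p / 2) + v powr (q / 2)\<close> and \<open>s = 1 - 2 / q\<close>. The exponent \<open>s\<close> is the one for which
  \<open>X powr s * v \<le> X\<close>, so that \<open>Z\<close> is comparable with \<open>X\<close>. The Laplacian of \<open>Z\<close> dominates both
  \<open>u powr (p / 2 - 1) \<bar>F'\<bar>\<^sup>2\<close> and \<open>u powr (1 - p / 2) \<bar>\<nabla>h\<bar>\<^sup>2\<close>, and the geometric mean of these is \<open>\<bar>F'\<bar> \<bar>\<nabla>h\<bar>\<close>.
  All constants are absolute because \<open>F\<close> is holomorphic: \<open>\<bar>\<nabla>u\<bar>\<^sup>2 \<le> u \<Delta>u\<close>.\<close>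

theorem bilinear_embedding_perturbed:
  fixes c :: "int \<Rightarrow> complex" and b :: "'i \<Rightarrow> int \<Rightarrow> complex"
  assumes A: "finite A" "A \<subseteq> {0..}" and B: "finite B" and I: "finite I"
    and p: "1 < p" "p < 2" and T: "0 \<le> T" and e: "0 < e"
  defines "q \<equiv> p / (p - 1)"
  shows "integral {- T..0} (\<lambda>t. - t * integral {0..2*pi} (\<lambda>x.
        cmod (harmonic_sum A (\<lambda>n. of_real \<bar>real_of_int n\<bar> * c n) t x)
        * sqrt (\<Sum>i\<in>I. (cmod (harmonic_sum B (\<lambda>n. of_real \<bar>real_of_int n\<bar> * b i n) t x))\<^sup>2)))
    \<le> 10 * (integral {0..2*pi} (\<lambda>x. ((cmod (trig_sum A c x))\<^sup>2 + e) powr (p / 2))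
          + integral {0..2*pi} (\<lambda>x. ((\<Sum>i\<in>I. (cmod (trig_sum B (b i) x))\<^sup>2) + e) powr (q / 2)))"
proof -
  define a d s where "a = p / 2" and "d = q / 2" and "s = 1 - 1 / d"
  have q: "2 < q" using p by (simp add: q_def field_simps)
  have a: "0 < a" "1/2 < a" "a < 1" and d: "1 < d" and s: "0 < s" "s < 1"
    using p q by (auto simp: a_def d_def s_def field_simps)
  have as: "a * s = 1 - a" using p unfolding a_def s_def d_def q_def by (simp add: field_simps)
  define F Ft Fx where "F = harmonic_sum A c"
    and "Ft = harmonic_sum A (\<lambda>n. of_real \<bar>real_of_int n\<bar> * c n)"
    and "Fx = harmonic_sum A (\<lambda>n. \<i> * of_int n * c n)"
  define h ht hx where "h i = harmonic_sum B (b i)"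
    and "ht i = harmonic_sum B (\<lambda>n. of_real \<bar>real_of_int n\<bar> * b i n)"
    and "hx i = harmonic_sum B (\<lambda>n. \<i> * of_int n * b i n)" for i
  have jF: "jet2 F Ft Fx (\<lambda>t x. 0)" unfolding F_def Ft_def Fx_def by (rule jet2_harmonic_sum[OF A(1)])
  have jh: "jet2 (h i) (ht i) (hx i) (\<lambda>t x. 0)" for i
    unfolding h_def ht_def hx_def by (rule jet2_harmonic_sum[OF B])
  have Fx: "Fx t x = \<i> * Ft t x" for t x
    unfolding Fx_def Ft_def harmonic_sum_def sum_distrib_left
    using A(2) by (intro sum.cong refl) (auto simp: mult_ac)
  define N where "N t x = sqrt (\<Sum>i\<in>I. (cmod (ht i t x))\<^sup>2)" for t x
  define u ut ux lu where "u t x = (cmod (F t x))\<^sup>2 + e" and "ut t x = 2 * (F t x \<bullet> Ft t x)"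
    and "ux t x = 2 * (F t x \<bullet> Fx t x)" and "lu t x = 4 * (cmod (Ft t x))\<^sup>2" for t x
  define v vt vx lv where "v t x = (\<Sum>i\<in>I. (cmod (h i t x))\<^sup>2) + e"
    and "vt t x = 2 * (\<Sum>i\<in>I. h i t x \<bullet> ht i t x)"
    and "vx t x = 2 * (\<Sum>i\<in>I. h i t x \<bullet> hx i t x)"
    and "lv t x = 2 * (\<Sum>i\<in>I. (cmod (ht i t x))\<^sup>2 + (cmod (hx i t x))\<^sup>2)" for t x
  have ju: "jet2 u ut ux lu"
    using jet2_add_const[OF jet2_norm_square[of "{()}" "\<lambda>_. F", OF _ jF], of e]
    by (simp add: u_def[abs_def] ut_def[abs_def] ux_def[abs_def] lu_def[abs_def] Fx norm_mult)
  have jv: "jet2 v vt vx lv"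
    using jet2_add_const[OF jet2_norm_square[OF I jh, of "\<lambda>i. i"], of e]
    by (simp add: v_def[abs_def] vt_def[abs_def] vx_def[abs_def] lv_def[abs_def])
  have upos: "0 < u t x" and vpos: "0 < v t x" for t x
    unfolding u_def v_def using e by (auto intro!: add_nonneg_pos sum_nonneg)
  have lu0: "0 \<le> lu t x" and lv0: "0 \<le> lv t x" for t x
    unfolding lu_def lv_def by (auto intro!: sum_nonneg)
  \<comment> \<open>this is where analyticity of F is used; a harmonic F would only give twice the right-hand side\<close>
  have gu: "(ut t x)\<^sup>2 + (ux t x)\<^sup>2 \<le> u t x * lu t x" for t x
  proof -
    have "(ut t x)\<^sup>2 + (ux t x)\<^sup>2 = (cmod (F t x))\<^sup>2 * lu t x"
      unfolding ut_def ux_def lu_def Fx cmod_power2 inner_complex_def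
      by (simp add: power2_eq_square algebra_simps)
    also have "\<dots> \<le> u t x * lu t x" unfolding u_def using e lu0 by (intro mult_right_mono) auto
    finally show ?thesis .
  qed
  have gv: "(vt t x)\<^sup>2 + (vx t x)\<^sup>2 \<le> 2 * v t x * lv t x" for t x
  proof -
    have "(vt t x)\<^sup>2 + (vx t x)\<^sup>2 \<le> 2 * (\<Sum>i\<in>I. (cmod (h i t x))\<^sup>2) * lv t x"
      unfolding vt_def vx_def lv_def by (rule gradient_norm_square_le)
    also have "\<dots> \<le> 2 * v t x * lv t x" unfolding v_def using e lv0 by (intro mult_right_mono) auto
    finally show ?thesis .
  qed
  define L1 where "L1 t x = a * u t x powr (a - 1) * lu t x
     + a * (a - 1) * u t x powr (a - 2) * ((ut t x)\<^sup>2 + (ux t x)\<^sup>2)" for t x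
  define L2 where "L2 t x = d * v t x powr (d - 1) * lv t x
     + d * (d - 1) * v t x powr (d - 2) * ((vt t x)\<^sup>2 + (vx t x)\<^sup>2)" for t x
  define X Xt Xx where "X t x = u t x powr a + v t x powr d"
    and "Xt t x = a * u t x powr (a - 1) * ut t x + d * v t x powr (d - 1) * vt t x"
    and "Xx t x = a * u t x powr (a - 1) * ux t x + d * v t x powr (d - 1) * vx t x" for t x
  have jX: "jet2 X Xt Xx (\<lambda>t x. L1 t x + L2 t x)"
    unfolding X_def[abs_def] Xt_def[abs_def] Xx_def[abs_def] L1_def L2_def
    by (intro jet2_add jet2_powr ju jv upos vpos)
  have Xpos: "0 < X t x" for t x unfolding X_def using upos[of t x] by (simp add: add_pos_nonneg)
  have L1: "a\<^sup>2 * u t x powr (a - 1) * lu t x \<le> L1 t x" for t x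
    using laplacian_powr_lower[OF upos, of a "(ut t x)\<^sup>2 + (ux t x)\<^sup>2" 1 t x "lu t x"] gu[of t x] a
    unfolding L1_def by (simp add: power2_eq_square)
  have L10: "0 \<le> L1 t x" for t x
    by (rule order_trans[OF _ L1]) (use a lu0 in auto)
  have L20: "0 \<le> L2 t x" for t x unfolding L2_def using d lv0 by auto
  have gX: "(Xt t x)\<^sup>2 + (Xx t x)\<^sup>2 \<le> 4 * X t x * (L1 t x + L2 t x)" for t x
  proof -
    define y1 y2 where "y1 = a * u t x powr (a - 1)" and "y2 = d * v t x powr (d - 1)"
    have sq: "(y + z)\<^sup>2 \<le> 2 * y\<^sup>2 + 2 * z\<^sup>2" for y z :: real
      using sum_squares_bound[of y z] by (simp add: power2_sum)
    have "(Xt t x)\<^sup>2 + (Xx t x)\<^sup>2 \<le> 2 * (y1\<^sup>2 * ((ut t x)\<^sup>2 + (ux t x)\<^sup>2)) + 2 * (y2\<^sup>2 * ((vt t x)\<^sup>2 + (vx t x)\<^sup>2))"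
      unfolding Xt_def Xx_def y1_def[symmetric] y2_def[symmetric]
      using sq[of "y1 * ut t x" "y2 * vt t x"] sq[of "y1 * ux t x" "y2 * vx t x"]
      by (simp add: power_mult_distrib algebra_simps)
    also have "\<dots> \<le> 2 * (u t x powr a * L1 t x) + 2 * (2 * (v t x powr d * L2 t x))"
      unfolding y1_def y2_def L1_def L2_def
      by (intro add_mono mult_left_mono gradient_powr_le_small gradient_powr_le_large upos vpos gu gv)
         (use a d in auto)
    also have "\<dots> \<le> 4 * X t x * (L1 t x + L2 t x)"
      unfolding X_def using L10[of t x] L20[of t x] by (simp add: algebra_simps add_nonneg_nonneg)
    finally show ?thesis .
  qed
  have vX1: "v t x \<le> X t x powr (1 - s)" for t x
  proof -
    have "v t x = (v t x powr d) powr (1 / d)" using vpos[of t x] d by (simp add: powr_powr)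
    also have "\<dots> \<le> X t x powr (1 / d)" unfolding X_def using d by (intro powr_mono2) auto
    finally show ?thesis unfolding s_def by simp
  qed
  have vX: "v t x * X t x powr (s - 1) \<le> 1" for t x
  proof -
    have "v t x * X t x powr (s - 1) \<le> X t x powr (1 - s) * X t x powr (s - 1)"
      by (intro mult_right_mono vX1) auto
    also have "\<dots> = 1" using Xpos[of t x] by (simp add: powr_add[symmetric])
    finally show ?thesis .
  qed
  define Ys where "Ys t x = s * X t x powr (s - 1) * (L1 t x + L2 t x)
     + s * (s - 1) * X t x powr (s - 2) * ((Xt t x)\<^sup>2 + (Xx t x)\<^sup>2)" for t x
  \<comment> \<open>17 copies of X pay for the product rule, and the 18th dominates the F-part\<close>
  define Z where "Z t x = 18 * X t x + X t x powr s * v t x" for t x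
  define l where "l t x = 18 * (L1 t x + L2 t x) + (X t x powr s * lv t x + Ys t x * v t x
     + 2 * ((s * X t x powr (s - 1) * Xt t x) * vt t x + (s * X t x powr (s - 1) * Xx t x) * vx t x))" for t x
  obtain Zt Zx where jZ: "jet2 Z Zt Zx l"
    using jet2_add[OF jet2_cmult[OF jX, of 18] jet2_inner[OF jet2_powr[OF jX Xpos, of s] jv]]
    unfolding inner_real_def Ys_def[symmetric] Z_def[symmetric] l_def[symmetric] by (rule that)
  have lower: "2 * (cmod (Ft t x) * N t x) \<le> l t x" for t x
  proof -
    have 1: "X t x powr s * lv t x / 2 - 17 * (L1 t x + L2 t x)
      \<le> X t x powr s * lv t x + Ys t x * v t x
       + 2 * ((s * X t x powr (s - 1) * Xt t x) * vt t x + (s * X t x powr (s - 1) * Xx t x) * vx t x)"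
      unfolding Ys_def
      by (rule laplacian_product_lower[OF Xpos vpos _ _ vX gX gv])
         (use s L10 L20 lv0 in \<open>auto intro: less_imp_le\<close>)
    have "u t x powr (1 - a) \<le> X t x powr s"
    proof -
      have "u t x powr (1 - a) = (u t x powr a) powr s" using as by (simp add: powr_powr)
      also have "\<dots> \<le> X t x powr s" unfolding X_def using s by (intro powr_mono2) auto
      finally show ?thesis .
    qed
    then have 2: "u t x powr (1 - a) * lv t x \<le> X t x powr s * lv t x" using lv0 by (intro mult_right_mono)
    have 3: "u t x powr (a - 1) * lu t x / 4 \<le> L1 t x"
    proof -
      have "(1/2)\<^sup>2 \<le> a\<^sup>2" using a by (intro power_mono) auto
      then have "(1/4) * (u t x powr (a - 1) * lu t x) \<le> a\<^sup>2 * (u t x powr (a - 1) * lu t x)"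
        using lu0 by (intro mult_right_mono) (auto simp: power2_eq_square)
      with L1[of t x] show ?thesis by simp
    qed
    have 4: "2 * (N t x)\<^sup>2 \<le> lv t x"
      unfolding N_def lv_def by (auto simp: sum_nonneg sum.distrib)
    define y where "y = u t x powr ((1 - a) / 2)"
    have y: "0 < y" "u t x powr (1 - a) = y\<^sup>2" "u t x powr (a - 1) = inverse (y\<^sup>2)"
      using upos[of t x] unfolding y_def
      by (auto simp: power2_eq_square powr_add[symmetric] powr_minus[symmetric])
    have "y\<^sup>2 * (2 * (N t x)\<^sup>2) \<le> y\<^sup>2 * lv t x" using 4 by (intro mult_left_mono) auto
    then have 5: "y\<^sup>2 * (N t x)\<^sup>2 \<le> X t x powr s * lv t x / 2" using 2 unfolding y by simp
    have 6: "inverse (y\<^sup>2) * (cmod (Ft t x))\<^sup>2 \<le> L1 t x" using 3 unfolding lu_def y by simp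
    have "X t x powr s * lv t x / 2 + (L1 t x + L2 t x) \<le> l t x"
      using add_left_mono[OF 1, of "18 * (L1 t x + L2 t x)"] unfolding l_def[symmetric] by simp
    then have "y\<^sup>2 * (N t x)\<^sup>2 + inverse (y\<^sup>2) * (cmod (Ft t x))\<^sup>2 \<le> l t x"
      using 5 6 L20[of t x] by linarith
    moreover have "2 * (cmod (Ft t x) * N t x) \<le> y\<^sup>2 * (N t x)\<^sup>2 + inverse (y\<^sup>2) * (cmod (Ft t x))\<^sup>2"
      using sum_squares_bound[of "y * N t x" "inverse y * cmod (Ft t x)"] y(1)
      by (simp add: power_mult_distrib power_inverse field_simps)
    ultimately show ?thesis by linarith
  qed
  have N0: "0 \<le> N t x" for t x unfolding N_def by (simp add: sum_nonneg)
  have lnn: "0 \<le> l t x" for t x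
    by (rule order_trans[OF _ lower]) (simp add: N0)
  have per: "Z t (x + 2 * pi) = Z t x" for t x
    by (simp add: Z_def X_def u_def v_def F_def h_def harmonic_sum_periodic)
  have ZX: "Z t x \<le> 19 * X t x" for t x
  proof -
    have "X t x powr s * v t x \<le> X t x powr s * X t x powr (1 - s)" by (intro mult_left_mono vX1) auto
    also have "\<dots> = X t x" using Xpos[of t x] by (simp add: powr_add[symmetric])
    finally show ?thesis unfolding Z_def by simp
  qed
  have Z0: "0 \<le> Z t x" for t x
    unfolding Z_def using Xpos[of t x] vpos[of t x] by (intro add_nonneg_nonneg mult_nonneg_nonneg) auto
  have bdd: "Z t x \<le> 19 * (((\<Sum>n\<in>A. cmod (c n))\<^sup>2 + e) powr a
       + ((\<Sum>i\<in>I. (\<Sum>n\<in>B. cmod (b i n))\<^sup>2) + e) powr d)" if "t \<le> 0" for t x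
  proof -
    have "cmod (F t x) \<le> (\<Sum>n\<in>A. cmod (c n))" and "cmod (h i t x) \<le> (\<Sum>n\<in>B. cmod (b i n))" for i
      using norm_harmonic_sum_le[of A 0 t c x] norm_harmonic_sum_le[of B 0 t "b i" x] that
      unfolding F_def h_def by auto
    then have "u t x \<le> (\<Sum>n\<in>A. cmod (c n))\<^sup>2 + e" "v t x \<le> (\<Sum>i\<in>I. (\<Sum>n\<in>B. cmod (b i n))\<^sup>2) + e"
      unfolding u_def v_def by (auto intro!: sum_mono power_mono)
    then show ?thesis
      using ZX[of t x] upos[of t x] vpos[of t x] a d unfolding X_def
      by (intro order_trans[OF ZX[of t x]] mult_left_mono) (auto simp: X_def intro!: add_mono powr_mono2)
  qed
  have contZ: "continuous_on UNIV (\<lambda>z. Z (fst z) (snd z))" and contX: "continuous_on UNIV (\<lambda>z. X (fst z) (snd z))"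
    by (rule jet2_continuous[OF jZ], rule jet2_continuous[OF jX])
  have contl: "continuous_on UNIV (\<lambda>z. l (fst z) (snd z))" by (rule jet2_laplacian_continuous[OF jZ])
  have contFN: "continuous_on UNIV (\<lambda>z. cmod (Ft (fst z) (snd z)) * N (fst z) (snd z))"
    unfolding N_def Ft_def ht_def by (intro continuous_intros continuous_harmonic_sum A B)
  have iuv: "(\<lambda>x. u 0 x powr a) integrable_on {0..2*pi}" "(\<lambda>x. v 0 x powr d) integrable_on {0..2*pi}"
    using continuous_slice[OF jet2_continuous[OF jet2_powr[OF ju upos, of a]]]
      continuous_slice[OF jet2_continuous[OF jet2_powr[OF jv vpos, of d]]]
    by (auto intro!: integrable_continuous_interval)
  have int0: "integral {- T..0} (\<lambda>t. - t * integral {0..2*pi} (\<lambda>x. 2 * (cmod (Ft t x) * N t x)))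
     \<le> integral {- T..0} (\<lambda>t. - t * integral {0..2*pi} (l t))"
  proof (rule integral_le)
    show "(\<lambda>t. - t * integral {0..2*pi} (\<lambda>x. 2 * (cmod (Ft t x) * N t x))) integrable_on {- T..0}"
      by (intro integrable_continuous_interval continuous_on_mult continuous_integral_param continuous_intros contFN)
    show "(\<lambda>t. - t * integral {0..2*pi} (l t)) integrable_on {- T..0}"
      by (intro integrable_continuous_interval continuous_on_mult continuous_integral_param continuous_intros contl)
    fix t assume t: "t \<in> {- T..0}"
    show "- t * integral {0..2*pi} (\<lambda>x. 2 * (cmod (Ft t x) * N t x)) \<le> - t * integral {0..2*pi} (l t)"
    proof (intro mult_left_mono integral_le lower)
      show "(\<lambda>x. 2 * (cmod (Ft t x) * N t x)) integrable_on {0..2*pi}"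
        by (intro integrable_continuous_interval continuous_on_mult[OF continuous_on_const] continuous_slice[OF contFN])
      show "l t integrable_on {0..2*pi}"
        by (intro integrable_continuous_interval continuous_slice[OF contl])
    qed (use t in auto)
  qed
  also have "\<dots> \<le> integral {0..2*pi} (Z 0) - integral {0..2*pi} (Z (- T))"
    by (rule green_circle(1)[OF jZ per lnn bdd T])
  also have "\<dots> \<le> integral {0..2*pi} (Z 0)"
    by (simp, intro integral_nonneg integrable_continuous_interval continuous_slice[OF contZ] Z0)
  also have "\<dots> \<le> integral {0..2*pi} (\<lambda>x. 19 * X 0 x)"
    by (intro integral_le ZX integrable_continuous_interval continuous_on_mult[OF continuous_on_const] continuous_slice[OF contZ] continuous_slice[OF contX])
  also have "\<dots> = 19 * (integral {0..2*pi} (\<lambda>x. u 0 x powr a) + integral {0..2*pi} (\<lambda>x. v 0 x powr d))"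
    unfolding X_def by (simp add: integral_add iuv)
  finally have "integral {- T..0} (\<lambda>t. - t * integral {0..2*pi} (\<lambda>x. 2 * (cmod (Ft t x) * N t x)))
     \<le> 19 * (integral {0..2*pi} (\<lambda>x. u 0 x powr a) + integral {0..2*pi} (\<lambda>x. v 0 x powr d))" .
  moreover have "integral {- T..0} (\<lambda>t. - t * integral {0..2*pi} (\<lambda>x. 2 * (cmod (Ft t x) * N t x)))
     = 2 * integral {- T..0} (\<lambda>t. - t * integral {0..2*pi} (\<lambda>x. cmod (Ft t x) * N t x))"
    unfolding integral_mult_right mult.left_commute[of _ 2] ..
  moreover have "0 \<le> integral {0..2*pi} (\<lambda>x. u 0 x powr a)" "0 \<le> integral {0..2*pi} (\<lambda>x. v 0 x powr d)"
    by (intro integral_nonneg iuv; simp)+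
  ultimately have "integral {- T..0} (\<lambda>t. - t * integral {0..2*pi} (\<lambda>x. cmod (Ft t x) * N t x))
     \<le> 10 * (integral {0..2*pi} (\<lambda>x. u 0 x powr a) + integral {0..2*pi} (\<lambda>x. v 0 x powr d))"
    by argo
  then show ?thesis
    unfolding N_def Ft_def ht_def u_def v_def F_def h_def harmonic_sum_0 a_def d_def .
qed

text \<open>The left-hand side is homogeneous in \<open>F\<close> and in \<open>h\<close> separately, the right-hand side is not; the choice of \<open>h\<close>
  in the duality argument below therefore contains a small factor.\<close>

theorem bilinear_embedding:
  fixes c :: "int \<Rightarrow> complex" and b :: "'i \<Rightarrow> int \<Rightarrow> complex"
  assumes A: "finite A" "A \<subseteq> {0..}" and B: "finite B" and I: "finite I"
    and p: "1 < p" "p < 2" and T: "0 \<le> T"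
  defines "q \<equiv> p / (p - 1)"
  shows "integral {- T..0} (\<lambda>t. - t * integral {0..2*pi} (\<lambda>x.
        cmod (harmonic_sum A (\<lambda>n. of_real \<bar>real_of_int n\<bar> * c n) t x)
        * sqrt (\<Sum>i\<in>I. (cmod (harmonic_sum B (\<lambda>n. of_real \<bar>real_of_int n\<bar> * b i n) t x))\<^sup>2)))
    \<le> 10 * (integral {0..2*pi} (\<lambda>x. ((cmod (trig_sum A c x))\<^sup>2) powr (p / 2))
          + integral {0..2*pi} (\<lambda>x. (\<Sum>i\<in>I. (cmod (trig_sum B (b i) x))\<^sup>2) powr (q / 2)))"
proof (rule tendsto_lowerbound)
  have q: "0 < q / 2" using p by (simp add: q_def)
  show "((\<lambda>e. 10 * (integral {0..2*pi} (\<lambda>x. ((cmod (trig_sum A c x))\<^sup>2 + e) powr (p / 2))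
          + integral {0..2*pi} (\<lambda>x. ((\<Sum>i\<in>I. (cmod (trig_sum B (b i) x))\<^sup>2) + e) powr (q / 2)))) \<longlongrightarrow>
     10 * (integral {0..2*pi} (\<lambda>x. ((cmod (trig_sum A c x))\<^sup>2) powr (p / 2))
          + integral {0..2*pi} (\<lambda>x. (\<Sum>i\<in>I. (cmod (trig_sum B (b i) x))\<^sup>2) powr (q / 2)))) (at_right 0)"
    by (intro tendsto_mult_left tendsto_add integral_powr_add_tendsto continuous_intros)
       (use p q in \<open>auto simp: sum_nonneg\<close>)
qed (use bilinear_embedding_perturbed[OF assms(1-7)] in
      \<open>auto simp: q_def intro!: eventually_at_rightI[of 0 1]\<close>)

section \<open>Fourier coefficients and Fejer means\<close>

lemma has_integral_character:
  "((\<lambda>x. exp (\<i> * of_int n * of_real x)) has_integral (if n = 0 then of_real (2 * pi) else 0)) {0..2*pi}"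
proof (cases "n = 0")
  case True
  then show ?thesis using has_integral_const_real[of "1::complex" 0 "2*pi"] by (simp add: scaleR_conv_of_real)
next
  case False
  define F where "F x = exp (\<i> * of_int n * of_real x) / (\<i> * of_int n)" for x :: real
  have "((\<lambda>x. exp (\<i> * of_int n * of_real x)) has_integral F (2*pi) - F 0) {0..2*pi}"
  proof (rule fundamental_theorem_of_calculus)
    fix x
    show "(F has_vector_derivative exp (\<i> * of_int n * of_real x)) (at x within {0..2*pi})"
      unfolding F_def using False
      by (intro has_vector_derivative_real_field) (auto intro!: derivative_eq_intros)
  qed auto
  moreover have "F (2*pi) = F 0"
    using exp_integer_2pi[of "of_int n"] by (simp add: F_def mult_ac)
  ultimately show ?thesis using False by simp
qed

abbreviation circle :: "real measure" where "circle \<equiv> lebesgue_on {0..2*pi}"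

lemma fourier_coeff_circle:
  "fourier_coeff f n = of_real (1 / (2 * pi)) * (\<integral>x. f x * exp (- (\<i> * of_int n * of_real x)) \<partial>circle)"
  unfolding fourier_coeff_def set_lebesgue_integral_def by (subst integral_restrict_space) auto

lemma continuous_measurable_circle:
  fixes f :: "real \<Rightarrow> 'a::euclidean_space"
  shows "continuous_on UNIV f \<Longrightarrow> f \<in> borel_measurable circle"
  by (rule continuous_imp_measurable_on_sets_lebesgue[OF continuous_on_subset]) auto

lemma integrable_circle_mult_bounded:
  fixes f g :: "real \<Rightarrow> complex"
  assumes "integrable circle f" "continuous_on UNIV g" "\<And>x. cmod (g x) \<le> B"
  shows "integrable circle (\<lambda>x. f x * g x)"
proof (rule Bochner_Integration.integrable_bound[of _ "\<lambda>x. of_real B * f x"])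
  show "(\<lambda>x. f x * g x) \<in> borel_measurable circle"
    by (intro borel_measurable_times borel_measurable_integrable assms continuous_measurable_circle)
  have "cmod (f x) * cmod (g x) \<le> \<bar>B\<bar> * cmod (f x)" for x
    using mult_left_mono[OF order_trans[OF assms(3)[of x] abs_ge_self], of "cmod (f x)"] by (simp add: mult.commute)
  then show "AE x in circle. cmod (f x * g x) \<le> cmod (of_real B * f x)"
    by (simp add: norm_mult)
qed (use assms in simp)

text \<open>Parseval's identity for the real inner product of the complex plane.\<close>

lemma integral_trig_sum_inner:
  assumes H: "continuous_on UNIV H" and A: "finite A"
  shows "((\<lambda>x. trig_sum A g x \<bullet> H x) has_integral 2 * pi * (\<Sum>n\<in>A. g n \<bullet> fourier_coeff H n)) {0..2*pi}"
proof -
  have "((\<lambda>x. (g n * exp (\<i> * of_int n * of_real x)) \<bullet> H x) has_integral 2 * pi * (g n \<bullet> fourier_coeff H n)) {0..2*pi}" for n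
  proof -
    have c: "continuous_on {0..2*pi} (\<lambda>x. H x * exp (- (\<i> * of_int n * of_real x)))"
      by (intro continuous_intros continuous_on_subset[OF H]) auto
    have "((\<lambda>x. H x * exp (- (\<i> * of_int n * of_real x))) has_integral
         integral {0..2*pi} (\<lambda>x. H x * exp (- (\<i> * of_int n * of_real x)))) {0..2*pi}"
      by (intro integrable_integral integrable_continuous_interval c)
    also have "integral {0..2*pi} (\<lambda>x. H x * exp (- (\<i> * of_int n * of_real x))) = of_real (2 * pi) * fourier_coeff H n"
      unfolding fourier_coeff_def
      by (subst set_lebesgue_integral_eq_integral(2)[OF absolutely_integrable_continuous_real[OF c]]) simp
    finally have "((\<lambda>x. g n \<bullet> (H x * exp (- (\<i> * of_int n * of_real x)))) has_integral
         g n \<bullet> (of_real (2 * pi) * fourier_coeff H n)) {0..2*pi}"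
      by (rule has_integral_linear[OF _ bounded_linear_inner_right, unfolded o_def])
    moreover have "(y * exp (\<i> * of_int n * of_real x)) \<bullet> z = y \<bullet> (z * exp (- (\<i> * of_int n * of_real x)))" for y z x
      by (simp add: inner_complex_def Re_exp Im_exp algebra_simps)
    moreover have "g n \<bullet> (of_real (2 * pi) * fourier_coeff H n) = 2 * pi * (g n \<bullet> fourier_coeff H n)"
      by (simp add: inner_complex_def algebra_simps)
    ultimately show ?thesis by simp
  qed
  then have "((\<lambda>x. \<Sum>n\<in>A. (g n * exp (\<i> * of_int n * of_real x)) \<bullet> H x) has_integral
     (\<Sum>n\<in>A. 2 * pi * (g n \<bullet> fourier_coeff H n))) {0..2*pi}"
    by (intro has_integral_sum A)
  then show ?thesis by (simp add: inner_sum_left sum_distrib_left)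
qed

lemma fourier_coeff_trig_sum:
  assumes A: "finite A"
  shows "fourier_coeff (trig_sum A g) m = (if m \<in> A then g m else 0)"
proof -
  have c: "continuous_on {0..2*pi} (\<lambda>x. trig_sum A g x * exp (- (\<i> * of_int m * of_real x)))"
    by (intro continuous_intros)
  have "((\<lambda>x. \<Sum>n\<in>A. g n * exp (\<i> * of_int (n - m) * of_real x)) has_integral
     (\<Sum>n\<in>A. g n * (if n - m = 0 then of_real (2 * pi) else 0))) {0..2*pi}"
    by (intro has_integral_sum A has_integral_mult_right has_integral_character)
  moreover have "(\<Sum>n\<in>A. g n * (if n - m = 0 then of_real (2 * pi) else 0)) = of_real (2 * pi) * (if m \<in> A then g m else 0)"
    using A by (simp add: if_distrib[of "\<lambda>y. g _ * y"] sum.delta cong: if_cong)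
  moreover have "(\<Sum>n\<in>A. g n * exp (\<i> * of_int (n - m) * of_real x)) = trig_sum A g x * exp (- (\<i> * of_int m * of_real x))" for x
    unfolding sum_distrib_right by (intro sum.cong refl) (simp add: algebra_simps exp_diff exp_minus field_simps)
  ultimately have "integral {0..2*pi} (\<lambda>x. trig_sum A g x * exp (- (\<i> * of_int m * of_real x))) = of_real (2 * pi) * (if m \<in> A then g m else 0)"
    by (simp add: integral_unique)
  then show ?thesis unfolding fourier_coeff_def
    by (subst set_lebesgue_integral_eq_integral(2)[OF absolutely_integrable_continuous_real[OF c]]) simp
qed

text \<open>The arithmetic mean of the first \<open>K\<close> partial sums, as a double sum that exhibits the kernel as a square.\<close>

definition fejer_mean :: "nat \<Rightarrow> (real \<Rightarrow> complex) \<Rightarrow> real \<Rightarrow> complex" where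
  "fejer_mean K f x = (1 / of_nat K) *
     (\<Sum>k<K. \<Sum>l<K. fourier_coeff f (int k - int l) * exp (\<i> * of_int (int k - int l) * of_real x))"

definition fejer_weight :: "nat \<Rightarrow> int \<Rightarrow> real" where
  "fejer_weight K n = real (K - nat \<bar>n\<bar>) / real K"

definition fejer_kernel :: "nat \<Rightarrow> real \<Rightarrow> real" where
  "fejer_kernel K x = (cmod (\<Sum>k<K. exp (\<i> * of_nat k * of_real x)))\<^sup>2 / real K"

lemma fejer_kernel_nonneg: "0 \<le> fejer_kernel K x"
  by (simp add: fejer_kernel_def)

lemma fejer_kernel_expand:
  "of_real (fejer_kernel K (x - y)) = (1 / of_nat K) *
     (\<Sum>k<K. \<Sum>l<K. exp (\<i> * of_int (int k - int l) * of_real x) * exp (- (\<i> * of_int (int k - int l) * of_real y)))"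
proof -
  have "complex_of_real ((cmod (\<Sum>k<K. exp (\<i> * of_nat k * of_real (x - y))))\<^sup>2)
    = (\<Sum>k<K. exp (\<i> * of_nat k * of_real (x - y))) * cnj (\<Sum>l<K. exp (\<i> * of_nat l * of_real (x - y)))"
    by (rule complex_norm_square)
  also have "\<dots> = (\<Sum>k<K. \<Sum>l<K. exp (\<i> * of_nat k * of_real (x - y)) * exp (- (\<i> * of_nat l * of_real (x - y))))"
    by (simp add: sum_product exp_cnj)
  also have "\<dots> = (\<Sum>k<K. \<Sum>l<K. exp (\<i> * of_int (int k - int l) * of_real x) * exp (- (\<i> * of_int (int k - int l) * of_real y)))"
    unfolding exp_add[symmetric] by (intro sum.cong refl arg_cong[of _ _ exp]) (simp add: algebra_simps)
  finally show ?thesis by (simp add: fejer_kernel_def)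
qed

lemma continuous_fejer_kernel: "continuous_on UNIV (\<lambda>y. fejer_kernel K (x - y))"
  unfolding fejer_kernel_def divide_inverse by (intro continuous_intros)

lemma fejer_kernel_le: "fejer_kernel K x \<le> real K"
proof -
  have "cmod (\<Sum>k<K. exp (\<i> * of_nat k * of_real x)) \<le> (\<Sum>k<K. cmod (exp (\<i> * of_nat k * of_real x)))"
    by (rule norm_sum)
  also have "\<dots> = real K" by (simp add: norm_exp_eq_Re)
  finally have "(cmod (\<Sum>k<K. exp (\<i> * of_nat k * of_real x)))\<^sup>2 \<le> (real K)\<^sup>2" by (intro power_mono) auto
  then show ?thesis unfolding fejer_kernel_def by (cases "K = 0") (auto simp: field_simps power2_eq_square)
qed

lemma integrable_fejer_kernel:
  assumes "integrable circle f"
  shows "integrable circle (\<lambda>y. f y * complex_of_real (fejer_kernel K (x - y)))"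
  by (rule integrable_circle_mult_bounded[OF assms, of _ "real K"])
     (auto intro!: continuous_intros continuous_fejer_kernel simp: fejer_kernel_nonneg fejer_kernel_le)

lemma fejer_mean_kernel:
  assumes f: "integrable circle f"
  shows "fejer_mean K f x = of_real (1 / (2 * pi)) * (\<integral>y. f y * of_real (fejer_kernel K (x - y)) \<partial>circle)"
proof -
  have i: "integrable circle (\<lambda>y. f y * exp (- (\<i> * of_int n * of_real y)))" for n
    by (rule integrable_circle_mult_bounded[OF f, of _ 1]) (auto intro!: continuous_intros simp: norm_exp_eq_Re)
  have "(\<integral>y. f y * of_real (fejer_kernel K (x - y)) \<partial>circle)
    = (\<integral>y. (1 / of_nat K) * (\<Sum>k<K. \<Sum>l<K. exp (\<i> * of_int (int k - int l) * of_real x) * (f y * exp (- (\<i> * of_int (int k - int l) * of_real y)))) \<partial>circle)"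
    unfolding fejer_kernel_expand by (simp add: sum_distrib_left mult_ac)
  also have "\<dots> = (1 / of_nat K) * (\<Sum>k<K. \<Sum>l<K. exp (\<i> * of_int (int k - int l) * of_real x)
        * (\<integral>y. f y * exp (- (\<i> * of_int (int k - int l) * of_real y)) \<partial>circle))"
    by (simp only: integral_mult_right_zero Bochner_Integration.integral_sum Bochner_Integration.integrable_sum integrable_mult_right i)
  finally show ?thesis
    unfolding fejer_mean_def fourier_coeff_circle by (simp add: sum_distrib_left mult_ac)
qed

lemma fejer_mean_trig_sum:
  "fejer_mean K f x = trig_sum {- int K..int K} (\<lambda>n. of_real (fejer_weight K n) * fourier_coeff f n) x"
proof -
  define g where "g n = fourier_coeff f n * exp (\<i> * of_int n * of_real x)" for n
  define P where "P = {..<K} \<times> {..<K}"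
  define d where "d = (\<lambda>(k, l). int k - int l)"
  have card: "card {p \<in> P. d p = n} = K - nat \<bar>n\<bar>" for n
  proof -
    have "{p \<in> P. d p = n} = (\<lambda>m. (m + nat n, m + nat (- n))) ` {..<K - nat \<bar>n\<bar>}"
    proof (intro equalityI subsetI)
      fix p assume "p \<in> {p \<in> P. d p = n}"
      then obtain k l where p: "p = (k, l)" "k < K" "l < K" "int k - int l = n" by (auto simp: P_def d_def)
      have "p = (\<lambda>m. (m + nat n, m + nat (- n))) (min k l)" "min k l < K - nat \<bar>n\<bar>" using p by auto
      then show "p \<in> (\<lambda>m. (m + nat n, m + nat (- n))) ` {..<K - nat \<bar>n\<bar>}" by blast
    qed (auto simp: P_def d_def)
    moreover have "inj_on (\<lambda>m. (m + nat n, m + nat (- n))) {..<K - nat \<bar>n\<bar>}" by (auto simp: inj_on_def)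
    ultimately show ?thesis by (simp add: card_image)
  qed
  have "(\<Sum>k<K. \<Sum>l<K. g (int k - int l)) = (\<Sum>p\<in>P. g (d p))"
    unfolding P_def d_def sum.cartesian_product by (simp add: case_prod_unfold)
  also have "\<dots> = (\<Sum>n\<in>{- int K..int K}. \<Sum>p\<in>{p \<in> P. d p = n}. g (d p))"
    by (rule sum.group[symmetric]) (auto simp: P_def d_def)
  also have "\<dots> = (\<Sum>n\<in>{- int K..int K}. of_nat (K - nat \<bar>n\<bar>) * g n)"
    by (intro sum.cong refl) (simp add: card[symmetric])
  finally show ?thesis
    unfolding fejer_mean_def g_def[symmetric] fejer_weight_def
    by (simp add: g_def sum_distrib_left sum_divide_distrib mult_ac)
qed

lemma fejer_weight_tendsto: "(\<lambda>K. fejer_weight K n) \<longlonglongrightarrow> 1"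
proof -
  have "(\<lambda>K. 1 - real (nat \<bar>n\<bar>) / real K) \<longlonglongrightarrow> 1 - 0"
    by (intro tendsto_diff tendsto_const lim_const_over_n)
  moreover have "\<forall>\<^sub>F K in sequentially. 1 - real (nat \<bar>n\<bar>) / real K = fejer_weight K n"
    using eventually_ge_at_top[of "Suc (nat \<bar>n\<bar>)"]
    by eventually_elim (auto simp: fejer_weight_def of_nat_diff field_simps)
  ultimately show ?thesis by (simp add: tendsto_cong)
qed

lemma integral_fejer_mean:
  assumes "0 < K"
  shows "(fejer_mean K f has_integral of_real (2 * pi) * fourier_coeff f 0) {0..2*pi}"
proof -
  have "(trig_sum {- int K..int K} (\<lambda>n. of_real (fejer_weight K n) * fourier_coeff f n) has_integral
    (\<Sum>n\<in>{- int K..int K}. of_real (fejer_weight K n) * fourier_coeff f n * (if n = 0 then of_real (2 * pi) else 0))) {0..2*pi}"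
    by (intro has_integral_sum has_integral_mult_right has_integral_character) auto
  also have "(\<Sum>n\<in>{- int K..int K}. of_real (fejer_weight K n) * fourier_coeff f n * (if n = 0 then of_real (2 * pi) else 0))
    = (\<Sum>n\<in>{- int K..int K}. if n = 0 then of_real (fejer_weight K n) * fourier_coeff f n * of_real (2 * pi) else 0)"
    by (intro sum.cong) auto
  also have "\<dots> = of_real (2 * pi) * fourier_coeff f 0" using assms by (simp add: sum.delta fejer_weight_def)
  finally show ?thesis unfolding fejer_mean_trig_sum[abs_def] .
qed

lemma fejer_mean_one: assumes "0 < K" shows "fejer_mean K (\<lambda>_. 1) x = 1"
proof -
  have "fourier_coeff (\<lambda>_. 1) n = (if n = 0 then 1 else 0)" for n
    using fourier_coeff_trig_sum[of "{0}" "\<lambda>_. 1" n] by simp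
  then show ?thesis
    using assms unfolding fejer_mean_trig_sum
    by (simp add: if_distrib[of "\<lambda>y. _ * y"] if_distrib[of "\<lambda>y. y * _"] sum.delta fejer_weight_def cong: if_cong)
qed

lemma power2_powr:
  fixes w :: real
  assumes "0 \<le> w" shows "(w\<^sup>2) powr c = w powr (2 * c)"
proof (cases "w = 0")
  case False
  with assms have "w\<^sup>2 = w powr 2" by simp
  then show ?thesis by (simp add: powr_powr)
qed simp

text \<open>The convex function \<open>\<bar>h\<bar> ^ r\<close> lies above its tangent at \<open>b\<close>. Integrating this against a probability
  density with barycentre \<open>b\<close> gives Jensen's inequality.\<close>

lemma l2_powr_tangent:
  fixes h b :: "'i \<Rightarrow> complex"
  assumes r: "1 \<le> r" and pos: "0 < (\<Sum>i\<in>I. (cmod (b i))\<^sup>2)"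
  shows "(\<Sum>i\<in>I. (cmod (b i))\<^sup>2) powr (r / 2)
      + r * (\<Sum>i\<in>I. (cmod (b i))\<^sup>2) powr (r / 2 - 1) * ((\<Sum>i\<in>I. h i \<bullet> b i) - (\<Sum>i\<in>I. (cmod (b i))\<^sup>2))
    \<le> (\<Sum>i\<in>I. (cmod (h i))\<^sup>2) powr (r / 2)"
proof -
  define y z where "y = sqrt (\<Sum>i\<in>I. (cmod (h i))\<^sup>2)" and "z = sqrt (\<Sum>i\<in>I. (cmod (b i))\<^sup>2)"
  have y: "0 \<le> y" "(\<Sum>i\<in>I. (cmod (h i))\<^sup>2) = y\<^sup>2" and z: "0 < z" "(\<Sum>i\<in>I. (cmod (b i))\<^sup>2) = z\<^sup>2"
    using pos unfolding y_def z_def by (auto simp: sum_nonneg)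
  note sq = power2_powr
  have "(\<Sum>i\<in>I. h i \<bullet> b i)\<^sup>2 \<le> (y * z)\<^sup>2"
    using Cauchy_Schwarz_sum_inner[of h b I] unfolding y z by (simp add: power_mult_distrib)
  then have cs: "(\<Sum>i\<in>I. h i \<bullet> b i) \<le> y * z"
    using y z by (metis abs_le_square_iff abs_le_D1 abs_of_nonneg mult_nonneg_nonneg less_imp_le)
  have tang: "z powr r + r * z powr (r - 1) * (y - z) \<le> y powr r"
  proof (cases "y = 0")
    case True
    have "z powr r = z powr (r - 1) * z" using z by (simp add: powr_diff)
    then have "z powr r + r * z powr (r - 1) * (y - z) = (1 - r) * (z powr (r - 1) * z)" using True by (simp add: algebra_simps)
    also have "\<dots> \<le> 0" using r z by (intro mult_nonpos_nonneg) auto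
    finally show ?thesis using True by simp
  next
    case False
    then have yp: "0 < y" using y by simp
    have "r * z powr (r - 1) * (y - z) \<le> y powr r - z powr r"
      by (rule convex_on_imp_above_tangent[OF powr_convex[OF r]])
        (use z yp in \<open>auto intro!: derivative_eq_intros simp: interior_open\<close>)
    then show ?thesis by simp
  qed
  have "r * (z\<^sup>2) powr (r / 2 - 1) * ((\<Sum>i\<in>I. h i \<bullet> b i) - z\<^sup>2) \<le> r * (z\<^sup>2) powr (r / 2 - 1) * (y * z - z\<^sup>2)"
    using r cs by (intro mult_left_mono) auto
  also have "\<dots> = r * (z powr (r - 2) * z) * (y - z)"
    using sq[of z "r / 2 - 1"] z(1) by (simp add: power2_eq_square[of z] algebra_simps)
  also have "z powr (r - 2) * z = z powr (r - 1)"
    using powr_split(1)[OF z(1), of r] by simp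
  finally show ?thesis using tang y z unfolding y z by (simp add: sq)
qed

text \<open>Jensen's inequality bounds \<open>\<bar>fejer_mean K h\<bar> ^ r\<close> pointwise by the Fejer mean of \<open>\<bar>h\<bar> ^ r\<close>. As the kernel is a
  finite sum of products of functions of \<open>x\<close> and of \<open>y\<close>, the integral over \<open>x\<close> just picks out the
  frequency zero, that is, the integral of \<open>\<bar>h\<bar> ^ r\<close>.\<close>

theorem fejer_mean_contraction:
  fixes h :: "'i \<Rightarrow> real \<Rightarrow> complex"
  assumes I: "finite I" and h: "\<And>i. i \<in> I \<Longrightarrow> integrable circle (h i)"
    and r: "1 \<le> r" and K: "0 < K"
    and hr: "integrable circle (\<lambda>y. (\<Sum>i\<in>I. (cmod (h i y))\<^sup>2) powr (r / 2))"
  shows "integral {0..2*pi} (\<lambda>x. (\<Sum>i\<in>I. (cmod (fejer_mean K (h i) x))\<^sup>2) powr (r / 2))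
     \<le> (\<integral>y. (\<Sum>i\<in>I. (cmod (h i y))\<^sup>2) powr (r / 2) \<partial>circle)"
proof -
  define \<Phi> where "\<Phi> y = (\<Sum>i\<in>I. (cmod (h i y))\<^sup>2) powr (r / 2)" for y
  have i\<Phi>: "integrable circle \<Phi>" using hr unfolding \<Phi>_def .
  have ic\<Phi>: "integrable circle (\<lambda>y. complex_of_real (\<Phi> y))" using i\<Phi> by simp
  have rk: "integrable circle (\<lambda>y. f y * fejer_kernel K (x - y))"
    "Re (fejer_mean K (\<lambda>y. of_real (f y)) x) = (1 / (2 * pi)) * (\<integral>y. f y * fejer_kernel K (x - y) \<partial>circle)"
    if f: "integrable circle f" for f x
  proof -
    have f': "integrable circle (\<lambda>y. complex_of_real (f y))" using f by simp
    from integrable_Re[OF integrable_fejer_kernel[OF this, of K x]]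
    show "integrable circle (\<lambda>y. f y * fejer_kernel K (x - y))" by simp
    have "(\<integral>y. complex_of_real (f y) * of_real (fejer_kernel K (x - y)) \<partial>circle)
       = of_real (\<integral>y. f y * fejer_kernel K (x - y) \<partial>circle)"
      unfolding of_real_mult[symmetric] by (rule integral_complex_of_real)
    then show "Re (fejer_mean K (\<lambda>y. of_real (f y)) x) = (1 / (2 * pi)) * (\<integral>y. f y * fejer_kernel K (x - y) \<partial>circle)"
      unfolding fejer_mean_kernel[OF f'] by simp
  qed
  have one: "integrable circle (\<lambda>y. 1::real)"
    by (rule continuous_imp_integrable_real) simp
  have k1: "(1 / (2 * pi)) * (\<integral>y. fejer_kernel K (x - y) \<partial>circle) = 1" for x
    using rk(2)[OF one, of x] fejer_mean_one[OF K, of x] by simp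
  have pointwise: "(\<Sum>i\<in>I. (cmod (fejer_mean K (h i) x))\<^sup>2) powr (r / 2) \<le> Re (fejer_mean K (\<lambda>y. of_real (\<Phi> y)) x)" for x
  proof -
    define b where "b i = fejer_mean K (h i) x" for i
    define s where "s = (\<Sum>i\<in>I. (cmod (b i))\<^sup>2)"
    define k where "k y = fejer_kernel K (x - y)" for y
    have s0: "0 \<le> s" unfolding s_def by (simp add: sum_nonneg)
    show ?thesis
    proof (cases "s = 0")
      case True
      have "0 \<le> (\<integral>y. \<Phi> y * k y \<partial>circle)"
        by (intro integral_nonneg_AE AE_I2) (auto simp: \<Phi>_def k_def fejer_kernel_nonneg)
      then show ?thesis using True unfolding rk(2)[OF i\<Phi>] s_def b_def k_def by simp
    next
      case False
      then have sp: "0 < s" using s0 by simp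
      define c where "c = r * s powr (r / 2 - 1)"
      have ib: "integrable circle (\<lambda>y. (h i y \<bullet> b i) * k y)"
        "(\<integral>y. (h i y \<bullet> b i) * k y \<partial>circle) = 2 * pi * (cmod (b i))\<^sup>2" if i: "i \<in> I" for i
      proof -
        have i1: "integrable circle (\<lambda>y. h i y * complex_of_real (k y))"
          unfolding k_def by (rule integrable_fejer_kernel[OF h[OF i]])
        have e: "(h i y \<bullet> b i) * k y = (h i y * complex_of_real (k y)) \<bullet> b i" for y
          by (simp add: inner_complex_def algebra_simps)
        show "integrable circle (\<lambda>y. (h i y \<bullet> b i) * k y)"
          unfolding e using i1 by simp
        have "(\<integral>y. (h i y \<bullet> b i) * k y \<partial>circle) = (\<integral>y. h i y * complex_of_real (k y) \<partial>circle) \<bullet> b i"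
          unfolding e using i1 by simp
        also have "(\<integral>y. h i y * complex_of_real (k y) \<partial>circle) = of_real (2 * pi) * b i"
          unfolding b_def k_def fejer_mean_kernel[OF h[OF i]] by simp
        finally show "(\<integral>y. (h i y \<bullet> b i) * k y \<partial>circle) = 2 * pi * (cmod (b i))\<^sup>2"
          by (simp add: power2_norm_eq_inner inner_complex_def algebra_simps)
      qed
      have ik: "integrable circle k" using rk(1)[OF one, of x] by (simp add: k_def[abs_def])
      have iS: "integrable circle (\<lambda>y. (\<Sum>i\<in>I. (h i y \<bullet> b i) * k y))" by (intro Bochner_Integration.integrable_sum ib)
      have iR: "integrable circle (\<lambda>y. (s powr (r / 2) - c * s) * k y + c * (\<Sum>i\<in>I. (h i y \<bullet> b i) * k y))"
        by (intro Bochner_Integration.integrable_add integrable_mult_right ik iS)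
      have "(\<integral>y. (s powr (r / 2) - c * s) * k y + c * (\<Sum>i\<in>I. (h i y \<bullet> b i) * k y) \<partial>circle)
        \<le> (\<integral>y. \<Phi> y * k y \<partial>circle)"
      proof (rule integral_mono[OF iR])
        show "integrable circle (\<lambda>y. \<Phi> y * k y)" using rk(1)[OF i\<Phi>, of x] by (simp add: k_def)
        fix y
        have "s powr (r / 2) + c * ((\<Sum>i\<in>I. h i y \<bullet> b i) - s) \<le> \<Phi> y"
          using l2_powr_tangent[OF r, of b I "\<lambda>i. h i y"] sp unfolding s_def c_def \<Phi>_def by simp
        then have "(s powr (r / 2) + c * ((\<Sum>i\<in>I. h i y \<bullet> b i) - s)) * k y \<le> \<Phi> y * k y"
          unfolding k_def by (intro mult_right_mono fejer_kernel_nonneg)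
        then show "(s powr (r / 2) - c * s) * k y + c * (\<Sum>i\<in>I. (h i y \<bullet> b i) * k y) \<le> \<Phi> y * k y"
          unfolding sum_distrib_right[symmetric] by (simp add: algebra_simps)
      qed
      also have "(\<integral>y. (s powr (r / 2) - c * s) * k y + c * (\<Sum>i\<in>I. (h i y \<bullet> b i) * k y) \<partial>circle)
        = (s powr (r / 2) - c * s) * (\<integral>y. k y \<partial>circle) + c * (\<Sum>i\<in>I. 2 * pi * (cmod (b i))\<^sup>2)"
        using ik iS ib by (simp add: Bochner_Integration.integral_add Bochner_Integration.integral_sum)
      also have "(\<integral>y. k y \<partial>circle) = 2 * pi" using k1[of x] by (simp add: k_def field_simps)
      also have "(s powr (r / 2) - c * s) * (2 * pi) + c * (\<Sum>i\<in>I. 2 * pi * (cmod (b i))\<^sup>2) = 2 * pi * s powr (r / 2)"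
        unfolding sum_distrib_left[symmetric] s_def[symmetric] by (simp add: algebra_simps)
      finally show ?thesis unfolding rk(2)[OF i\<Phi>] s_def b_def k_def by (simp add: field_simps)
    qed
  qed
  have cont: "continuous_on {0..2*pi} (\<lambda>x. fejer_mean K g x)" for g
    unfolding fejer_mean_trig_sum by (intro continuous_intros)
  have "integral {0..2*pi} (\<lambda>x. (\<Sum>i\<in>I. (cmod (fejer_mean K (h i) x))\<^sup>2) powr (r / 2))
    \<le> integral {0..2*pi} (\<lambda>x. Re (fejer_mean K (\<lambda>y. of_real (\<Phi> y)) x))"
    by (intro integral_le pointwise integrable_continuous_interval continuous_l2_powr continuous_intros cont) (use r in auto)
  also have "\<dots> = Re (of_real (2 * pi) * fourier_coeff (\<lambda>y. of_real (\<Phi> y)) 0)"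
    by (intro integral_unique has_integral_linear[OF integral_fejer_mean[OF K] bounded_linear_Re, unfolded o_def])
  also have "\<dots> = (\<integral>y. \<Phi> y \<partial>circle)"
    unfolding fourier_coeff_circle by simp
  finally show ?thesis unfolding \<Phi>_def .
qed

section \<open>Square functions of annular multipliers\<close>

text \<open>\<open>annulus_profile (n * t)\<close> is an antiderivative in \<open>t\<close> of \<open>4 * (- t) * n\<^sup>2 * exp (2 * n * t)\<close>, the density
  with which Green's formula at height \<open>t\<close> sees the frequency \<open>n\<close>. The difference over \<open>{a..b}\<close> is therefore
  the symbol of the operator obtained by restricting Green's formula to the annulus \<open>a \<le> t \<le> b\<close>; it
  is concentrated on the frequencies between \<open>1 / \<bar>a\<bar>\<close> and \<open>1 / \<bar>b\<bar>\<close>.\<close>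

definition annulus_profile :: "real \<Rightarrow> real" where
  "annulus_profile y = (1 - 2 * y) * exp (2 * y)"

definition annulus_multiplier :: "real \<Rightarrow> real \<Rightarrow> int \<Rightarrow> real" where
  "annulus_multiplier a b n = annulus_profile (of_int n * b) - annulus_profile (of_int n * a)"

lemma has_integral_annulus_multiplier:
  assumes "a \<le> b"
  shows "((\<lambda>t. 4 * (- t * ((of_int n)\<^sup>2 * exp (2 * of_int n * t)))) has_integral annulus_multiplier a b n) {a..b}"
  unfolding annulus_multiplier_def
proof (rule fundamental_theorem_of_calculus[OF assms])
  fix t
  have "((\<lambda>t. annulus_profile (of_int n * t)) has_real_derivative
      4 * (- t * ((of_int n)\<^sup>2 * exp (2 * of_int n * t)))) (at t)"
    unfolding annulus_profile_def
    by (auto intro!: derivative_eq_intros simp: algebra_simps power2_eq_square)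
  then show "((\<lambda>t. annulus_profile (of_int n * t)) has_vector_derivative
      4 * (- t * ((of_int n)\<^sup>2 * exp (2 * of_int n * t)))) (at t within {a..b})"
    by (simp add: has_real_derivative_iff_has_vector_derivative has_vector_derivative_at_within)
qed

lemma harmonic_sum_slice: "harmonic_sum A c t x = trig_sum A (\<lambda>n. of_real (exp (\<bar>real_of_int n\<bar> * t)) * c n) x"
  unfolding harmonic_sum_def harmonic_mode_def exp_add exp_of_real by (simp add: mult_ac)

text \<open>By Parseval's identity the pairing of the \<open>j\<close>-th piece with \<open>h j\<close> is \<open>4\<close> times the integral of
  \<open>- t\<close> times \<open>F\<^sub>t \<bullet> (h j)\<^sub>t\<close> over its annulus. At each height at most \<open>M\<close> annuli are active, so summing over
  \<open>j\<close> by Cauchy--Schwarz costs \<open>sqrt M\<close> and leaves the integrand of the bilinear embedding.\<close>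

lemma annulus_pairing:
  fixes c :: "int \<Rightarrow> complex" and d :: "'j \<Rightarrow> int \<Rightarrow> complex"
  assumes A: "finite A" "A \<subseteq> {0..}" and B: "finite B" and J: "finite J"
    and p: "1 < p" "p < 2"
    and ab: "\<And>j. j \<in> J \<Longrightarrow> - T \<le> a j \<and> a j \<le> b j \<and> b j \<le> 0" and T: "0 \<le> T"
    and M: "\<And>t. real (card {j \<in> J. a j \<le> t \<and> t \<le> b j}) \<le> M"
  defines "q \<equiv> p / (p - 1)"
  shows "(\<Sum>j\<in>J. integral {0..2*pi} (\<lambda>x.
       trig_sum A (\<lambda>n. of_real (annulus_multiplier (a j) (b j) n) * c n) x \<bullet> trig_sum B (d j) x))
    \<le> 40 * sqrt M * (integral {0..2*pi} (\<lambda>x. ((cmod (trig_sum A c x))\<^sup>2) powr (p / 2))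
          + integral {0..2*pi} (\<lambda>x. (\<Sum>j\<in>J. (cmod (trig_sum B (d j) x))\<^sup>2) powr (q / 2)))"
proof -
  define Ft where "Ft = harmonic_sum A (\<lambda>n. of_real \<bar>real_of_int n\<bar> * c n)"
  define ht where "ht j = harmonic_sum B (\<lambda>n. of_real \<bar>real_of_int n\<bar> * d j n)" for j
  define N where "N t x = sqrt (\<Sum>j\<in>J. (cmod (ht j t x))\<^sup>2)" for t x
  define \<phi> where "\<phi> j t = - t * integral {0..2*pi} (\<lambda>x. Ft t x \<bullet> ht j t x)" for j t
  define D where "D j n = (if n \<in> B then c n \<bullet> d j n else 0)" for j n
  have slice: "integral {0..2*pi} (\<lambda>x. Ft t x \<bullet> ht j t x)
     = 2 * pi * (\<Sum>n\<in>A. (of_int n)\<^sup>2 * exp (2 * of_int n * t) * D j n)" for j t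
  proof -
    let ?C = "\<lambda>n. of_real (exp (\<bar>real_of_int n\<bar> * t)) * (of_real \<bar>real_of_int n\<bar> * c n)"
    let ?D = "\<lambda>n. of_real (exp (\<bar>real_of_int n\<bar> * t)) * (of_real \<bar>real_of_int n\<bar> * d j n)"
    have "integral {0..2*pi} (\<lambda>x. Ft t x \<bullet> ht j t x) = 2 * pi * (\<Sum>n\<in>A. ?C n \<bullet> fourier_coeff (trig_sum B ?D) n)"
      unfolding Ft_def ht_def harmonic_sum_slice
      by (intro integral_unique integral_trig_sum_inner continuous_intros A)
    also have "(\<Sum>n\<in>A. ?C n \<bullet> fourier_coeff (trig_sum B ?D) n) = (\<Sum>n\<in>A. (of_int n)\<^sup>2 * exp (2 * of_int n * t) * D j n)"
    proof (intro sum.cong refl)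
      fix n assume "n \<in> A"
      then have n: "\<bar>real_of_int n\<bar> = real_of_int n" using A by auto
      have e: "exp (2 * real_of_int n * t) = exp (real_of_int n * t) * exp (real_of_int n * t)"
        by (simp add: exp_add[symmetric])
      have "(of_real y * (of_real z * w)) \<bullet> (of_real y * (of_real z * w')) = z\<^sup>2 * (y * y) * (w \<bullet> w')" for y z and w w' :: complex
        by (simp add: inner_complex_def power2_eq_square algebra_simps)
      then show "?C n \<bullet> fourier_coeff (trig_sum B ?D) n = (of_int n)\<^sup>2 * exp (2 * of_int n * t) * D j n"
        unfolding fourier_coeff_trig_sum[OF B] n D_def e
        by (simp del: of_real_of_int_eq of_real_exp)
    qed
    finally show ?thesis .
  qed
  have contI: "continuous_on UNIV (\<lambda>z. Ft (fst z) (snd z) \<bullet> ht j (fst z) (snd z))" for j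
    unfolding Ft_def ht_def by (intro continuous_intros continuous_harmonic_sum A B)
  have cont\<phi>: "continuous_on S (\<phi> j)" for j S
    unfolding \<phi>_def by (intro continuous_intros continuous_integral_param contI)
  have contFN: "continuous_on UNIV (\<lambda>z. cmod (Ft (fst z) (snd z)) * N (fst z) (snd z))"
    unfolding N_def Ft_def ht_def by (intro continuous_intros continuous_harmonic_sum A B)
  have part: "integral {0..2*pi} (\<lambda>x. trig_sum A (\<lambda>n. of_real (annulus_multiplier (a j) (b j) n) * c n) x \<bullet> trig_sum B (d j) x)
     = 4 * integral {a j..b j} (\<phi> j)" if j: "j \<in> J" for j
  proof -
    have "((\<lambda>t. \<Sum>n\<in>A. 2 * pi * D j n * (4 * (- t * ((of_int n)\<^sup>2 * exp (2 * of_int n * t))))) has_integral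
       (\<Sum>n\<in>A. 2 * pi * D j n * annulus_multiplier (a j) (b j) n)) {a j..b j}"
      using ab[OF j] by (intro has_integral_sum A has_integral_mult_right has_integral_annulus_multiplier) auto
    moreover have "(\<Sum>n\<in>A. 2 * pi * D j n * (4 * (- t * ((of_int n)\<^sup>2 * exp (2 * of_int n * t))))) = 4 * \<phi> j t" for t
      unfolding \<phi>_def slice by (simp add: sum_distrib_left mult_ac)
    ultimately have "((\<lambda>t. 4 * \<phi> j t) has_integral (\<Sum>n\<in>A. 2 * pi * D j n * annulus_multiplier (a j) (b j) n)) {a j..b j}"
      by simp
    from integral_unique[OF this]
    have "4 * integral {a j..b j} (\<phi> j) = (\<Sum>n\<in>A. 2 * pi * D j n * annulus_multiplier (a j) (b j) n)" by simp
    also have "\<dots> = 2 * pi * (\<Sum>n\<in>A. (of_real (annulus_multiplier (a j) (b j) n) * c n) \<bullet> fourier_coeff (trig_sum B (d j)) n)"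
      unfolding fourier_coeff_trig_sum[OF B] D_def sum_distrib_left
      by (intro sum.cong refl) (simp add: inner_complex_def algebra_simps)
    also have "\<dots> = integral {0..2*pi} (\<lambda>x. trig_sum A (\<lambda>n. of_real (annulus_multiplier (a j) (b j) n) * c n) x \<bullet> trig_sum B (d j) x)"
      by (intro integral_unique[symmetric] integral_trig_sum_inner continuous_intros A)
    finally show ?thesis by simp
  qed
  define \<psi> where "\<psi> j t = (if t \<in> {a j..b j} then \<phi> j t else 0)" for j t
  have \<psi>: "(\<psi> j has_integral integral {a j..b j} (\<phi> j)) {- T..0}" if "j \<in> J" for j
  proof -
    have sub: "{a j..b j} \<subseteq> {- T..0}" using ab[OF that] by auto
    have "(\<phi> j has_integral integral {a j..b j} (\<phi> j)) {a j..b j}"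
      by (intro integrable_integral integrable_continuous_interval cont\<phi>)
    then show ?thesis unfolding \<psi>_def[abs_def] has_integral_restrict[OF sub] .
  qed
  have pt: "(\<Sum>j\<in>J. \<psi> j t) \<le> sqrt M * (- t * integral {0..2*pi} (\<lambda>x. cmod (Ft t x) * N t x))"
    if t: "t \<in> {- T..0}" for t
  proof -
    define Jt where "Jt = {j \<in> J. a j \<le> t \<and> t \<le> b j}"
    have fJt: "finite Jt" "Jt \<subseteq> J" using J by (auto simp: Jt_def)
    have "(\<Sum>j\<in>J. \<psi> j t) = (\<Sum>j\<in>Jt. \<phi> j t)"
      unfolding \<psi>_def Jt_def by (auto simp: sum.inter_filter[OF J])
    also have "\<dots> = - t * integral {0..2*pi} (\<lambda>x. \<Sum>j\<in>Jt. Ft t x \<bullet> ht j t x)"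
      unfolding \<phi>_def
      by (subst integral_sum[OF fJt(1)])
         (auto intro!: integrable_continuous_interval continuous_slice[OF contI] simp: sum_distrib_left)
    also have "\<dots> \<le> - t * integral {0..2*pi} (\<lambda>x. sqrt M * (cmod (Ft t x) * N t x))"
    proof (intro mult_left_mono integral_le)
      show "(\<lambda>x. \<Sum>j\<in>Jt. Ft t x \<bullet> ht j t x) integrable_on {0..2*pi}"
        by (intro integrable_sum fJt integrable_continuous_interval continuous_slice[OF contI])
      show "(\<lambda>x. sqrt M * (cmod (Ft t x) * N t x)) integrable_on {0..2*pi}"
        by (intro integrable_continuous_interval continuous_on_mult[OF continuous_on_const] continuous_slice[OF contFN])
      fix x
      have "(\<Sum>j\<in>Jt. Ft t x \<bullet> ht j t x) \<le> (\<Sum>j\<in>Jt. cmod (Ft t x) * cmod (ht j t x))"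
        by (intro sum_mono norm_cauchy_schwarz)
      also have "\<dots> = cmod (Ft t x) * (\<Sum>j\<in>Jt. 1 * cmod (ht j t x))" by (simp add: sum_distrib_left)
      also have "(\<Sum>j\<in>Jt. 1 * cmod (ht j t x)) \<le> sqrt M * N t x"
      proof -
        have "(\<Sum>j\<in>Jt. 1 * cmod (ht j t x))\<^sup>2 \<le> (\<Sum>j\<in>Jt. 1\<^sup>2) * (\<Sum>j\<in>Jt. (cmod (ht j t x))\<^sup>2)"
          by (rule Cauchy_Schwarz_ineq_sum)
        also have "\<dots> \<le> M * (\<Sum>j\<in>J. (cmod (ht j t x))\<^sup>2)"
          using M[of t] fJt J unfolding Jt_def[symmetric]
          by (intro mult_mono sum_mono2) (auto intro: sum_nonneg)
        finally have "(\<Sum>j\<in>Jt. 1 * cmod (ht j t x)) \<le> sqrt (M * (\<Sum>j\<in>J. (cmod (ht j t x))\<^sup>2))"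
          by (rule real_le_rsqrt)
        then show ?thesis by (simp add: N_def real_sqrt_mult)
      qed
      finally show "(\<Sum>j\<in>Jt. Ft t x \<bullet> ht j t x) \<le> sqrt M * (cmod (Ft t x) * N t x)"
        by (simp add: mult_left_mono mult.left_commute)
    qed (use t in auto)
    finally show ?thesis by (simp add: mult_ac)
  qed
  have "(\<Sum>j\<in>J. integral {a j..b j} (\<phi> j)) = integral {- T..0} (\<lambda>t. \<Sum>j\<in>J. \<psi> j t)"
    by (intro integral_unique[symmetric] has_integral_sum J \<psi>)
  also have "\<dots> \<le> integral {- T..0} (\<lambda>t. sqrt M * (- t * integral {0..2*pi} (\<lambda>x. cmod (Ft t x) * N t x)))"
  proof (intro integral_le pt)
    show "(\<lambda>t. \<Sum>j\<in>J. \<psi> j t) integrable_on {- T..0}"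
      by (intro integrable_sum J has_integral_integrable[OF \<psi>])
    show "(\<lambda>t. sqrt M * (- t * integral {0..2*pi} (\<lambda>x. cmod (Ft t x) * N t x))) integrable_on {- T..0}"
      by (intro integrable_continuous_interval continuous_on_mult[OF continuous_on_const] continuous_on_mult
          continuous_on_minus continuous_on_id continuous_integral_param contFN)
  qed
  also have "\<dots> = sqrt M * integral {- T..0} (\<lambda>t. - t * integral {0..2*pi} (\<lambda>x. cmod (Ft t x) * N t x))"
    by (rule integral_mult_right)
  also have "\<dots> \<le> sqrt M * (10 * (integral {0..2*pi} (\<lambda>x. ((cmod (trig_sum A c x))\<^sup>2) powr (p / 2))
          + integral {0..2*pi} (\<lambda>x. (\<Sum>j\<in>J. (cmod (trig_sum B (d j) x))\<^sup>2) powr (q / 2))))"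
    unfolding N_def Ft_def ht_def q_def
    using M[of 0] by (intro mult_left_mono bilinear_embedding A B J p T) (auto intro: order_trans[OF of_nat_0_le_iff])
  finally have "4 * (\<Sum>j\<in>J. integral {a j..b j} (\<phi> j)) \<le> 40 * sqrt M *
      (integral {0..2*pi} (\<lambda>x. ((cmod (trig_sum A c x))\<^sup>2) powr (p / 2))
          + integral {0..2*pi} (\<lambda>x. (\<Sum>j\<in>J. (cmod (trig_sum B (d j) x))\<^sup>2) powr (q / 2)))"
    by (simp add: algebra_simps)
  then show ?thesis using part by (simp add: sum_distrib_left)
qed

text \<open>Duality: \<open>h j\<close> is the extremal choice \<open>G j * s powr (p / 2 - 1)\<close>, where \<open>s\<close> is the square of the square
  function plus \<open>e\<close>, so that \<open>\<bar>h\<bar> ^ q\<close> and \<open>G \<bullet> h\<close> are both about \<open>s powr (p / 2)\<close>. Since \<open>h j\<close> is not a trigonometric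
  polynomial, the pairing is evaluated on its Fejer means, which do not increase the \<open>q\<close>-norm.\<close>

theorem annulus_square_function_perturbed:
  fixes c :: "int \<Rightarrow> complex"
  assumes A: "finite A" "A \<subseteq> {0..}" and J: "finite J" and p: "1 < p" "p < 2"
    and ab: "\<And>j. j \<in> J \<Longrightarrow> - T \<le> a j \<and> a j \<le> b j \<and> b j \<le> 0" and T: "0 \<le> T"
    and M: "\<And>t. real (card {j \<in> J. a j \<le> t \<and> t \<le> b j}) \<le> M" and M0: "0 < M" and e: "0 < e"
  shows "integral {0..2*pi} (\<lambda>x. ((\<Sum>j\<in>J. (cmod (trig_sum A (\<lambda>n. of_real (annulus_multiplier (a j) (b j) n) * c n) x))\<^sup>2) / M + e) powr (p / 2))
     \<le> 6400 * integral {0..2*pi} (\<lambda>x. ((cmod (trig_sum A c x))\<^sup>2) powr (p / 2)) + 4 * pi * e powr (p / 2)"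
proof -
  define q where "q = p / (p - 1)"
  have q: "2 < q" using p by (simp add: q_def field_simps)
  define g where "g j n = of_real (annulus_multiplier (a j) (b j) n) * c n" for j n
  define G where "G j x = trig_sum A (g j) x" for j x
  define s where "s x = (\<Sum>j\<in>J. (cmod (G j x))\<^sup>2) / M + e" for x
  have s: "e \<le> s x" "0 < s x" for x
  proof -
    have "0 \<le> (\<Sum>j\<in>J. (cmod (G j x))\<^sup>2) / M" using M0 by (simp add: sum_nonneg)
    then show "e \<le> s x" "0 < s x" using e unfolding s_def by linarith+
  qed
  \<comment> \<open>the factor 1 / 80 = 1 / (2 * 40) lets the term with s on the right be absorbed: it enters there with power q > 2\<close>
  define H where "H j x = of_real (s x powr (p / 2 - 1) / (80 * sqrt M)) * G j x" for j x
  have contG: "continuous_on S (G j)" for j S unfolding G_def by (intro continuous_intros)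
  have conts: "continuous_on S (\<lambda>x. s x powr r)" for S r
    unfolding s_def by (intro continuous_on_powr continuous_intros contG) (use M0 s in \<open>auto simp: s_def less_le\<close>)
  have contH: "continuous_on S (H j)" for j S
    unfolding H_def using M0 by (intro continuous_intros conts contG) auto
  define Ip where "Ip = integral {0..2*pi} (\<lambda>x. ((cmod (trig_sum A c x))\<^sup>2) powr (p / 2))"
  define Is where "Is = integral {0..2*pi} (\<lambda>x. s x powr (p / 2))"
  have ints: "(\<lambda>x. s x powr (p / 2)) integrable_on {0..2*pi}"
    by (intro integrable_continuous_interval conts)
  have Hq: "(\<Sum>j\<in>J. (cmod (H j x))\<^sup>2) powr (q / 2) \<le> s x powr (p / 2) / 6400" for x
  proof -
    have sq: "(\<Sum>j\<in>J. (cmod (G j x))\<^sup>2) = M * (s x - e)" unfolding s_def using M0 by simp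
    have "(\<Sum>j\<in>J. (cmod (H j x))\<^sup>2) = (s x powr (p / 2 - 1) / (80 * sqrt M))\<^sup>2 * (M * (s x - e))"
      unfolding sq[symmetric] sum_distrib_left H_def norm_mult norm_of_real power_mult_distrib power2_abs ..
    also have "\<dots> = (s x powr (p / 2 - 1))\<^sup>2 * (s x - e) / 6400"
      using M0 by (simp add: power_divide power_mult_distrib)
    also have "\<dots> \<le> (s x powr (p / 2 - 1))\<^sup>2 * s x / 6400"
      using e by (intro divide_right_mono mult_left_mono) auto
    also have "(s x powr (p / 2 - 1))\<^sup>2 * s x = s x powr (p - 2) * s x"
      by (simp add: power2_eq_square powr_add[symmetric])
    also have "\<dots> = s x powr (p - 1)" using powr_split(1)[OF s(2), of x p] by simp
    finally have "(\<Sum>j\<in>J. (cmod (H j x))\<^sup>2) \<le> s x powr (p - 1) / 6400" .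
    then have "(\<Sum>j\<in>J. (cmod (H j x))\<^sup>2) powr (q / 2) \<le> (s x powr (p - 1) / 6400) powr (q / 2)"
      using q by (intro powr_mono2) (auto simp: sum_nonneg)
    also have "\<dots> = s x powr (p / 2) / 6400 powr (q / 2)"
    proof -
      have "(p - 1) * q = p" using p by (simp add: q_def)
      then have "(p - 1) * (q / 2) = p / 2" by simp
      then show ?thesis by (simp add: powr_divide powr_powr)
    qed
    also have "\<dots> \<le> s x powr (p / 2) / 6400 powr 1"
      using q by (intro divide_left_mono powr_mono) auto
    finally show ?thesis by simp
  qed
  have contHq: "continuous_on {0..2*pi} (\<lambda>x. (\<Sum>j\<in>J. (cmod (H j x))\<^sup>2) powr (q / 2))"
    using q by (intro continuous_l2_powr contH) auto
  have fej: "(\<Sum>j\<in>J. 2 * pi * (\<Sum>n\<in>A. g j n \<bullet> (of_real (fejer_weight K n) * fourier_coeff (H j) n)))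
      \<le> 40 * sqrt M * (Ip + Is / 6400)" if K: "0 < K" for K
  proof -
    let ?B = "{- int K..int K}" and ?d = "\<lambda>j n. of_real (fejer_weight K n) * fourier_coeff (H j) n"
    have "fourier_coeff (trig_sum ?B (?d j)) n = ?d j n" for j n
      unfolding fourier_coeff_trig_sum[OF finite_atLeastAtMost_int] by (auto simp: fejer_weight_def)
    then have "2 * pi * (\<Sum>n\<in>A. g j n \<bullet> ?d j n) = integral {0..2*pi} (\<lambda>x. trig_sum A (g j) x \<bullet> trig_sum ?B (?d j) x)" for j
      using integral_unique[OF integral_trig_sum_inner[OF _ A(1), of "trig_sum ?B (?d j)" "g j"]]
      by (simp add: continuous_intros)
    then have "(\<Sum>j\<in>J. 2 * pi * (\<Sum>n\<in>A. g j n \<bullet> ?d j n))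
      \<le> 40 * sqrt M * (Ip + integral {0..2*pi} (\<lambda>x. (\<Sum>j\<in>J. (cmod (trig_sum ?B (?d j) x))\<^sup>2) powr (q / 2)))"
      using annulus_pairing[OF A _ J p ab T M, of ?B c ?d] unfolding g_def Ip_def q_def by simp
    also have "integral {0..2*pi} (\<lambda>x. (\<Sum>j\<in>J. (cmod (trig_sum ?B (?d j) x))\<^sup>2) powr (q / 2))
      \<le> (\<integral>x. (\<Sum>j\<in>J. (cmod (H j x))\<^sup>2) powr (q / 2) \<partial>circle)"
      unfolding fejer_mean_trig_sum[symmetric]
      using q by (intro fejer_mean_contraction J K continuous_imp_integrable_real contH contHq) auto
    also have "\<dots> = integral {0..2*pi} (\<lambda>x. (\<Sum>j\<in>J. (cmod (H j x))\<^sup>2) powr (q / 2))"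
      by (intro lebesgue_integral_eq_integral continuous_imp_integrable_real contHq) auto
    also have "\<dots> \<le> integral {0..2*pi} (\<lambda>x. s x powr (p / 2) / 6400)"
      by (intro integral_le Hq integrable_continuous_interval contHq continuous_intros conts) auto
    also have "\<dots> = Is / 6400" unfolding Is_def by simp
    finally show ?thesis using M0 by simp
  qed
  have "(\<lambda>K. \<Sum>j\<in>J. 2 * pi * (\<Sum>n\<in>A. g j n \<bullet> (of_real (fejer_weight K n) * fourier_coeff (H j) n)))
     \<longlonglongrightarrow> (\<Sum>j\<in>J. 2 * pi * (\<Sum>n\<in>A. g j n \<bullet> (of_real 1 * fourier_coeff (H j) n)))"
    by (intro tendsto_intros fejer_weight_tendsto)
  moreover have "\<forall>\<^sub>F K in sequentially. (\<Sum>j\<in>J. 2 * pi * (\<Sum>n\<in>A. g j n \<bullet> (of_real (fejer_weight K n) * fourier_coeff (H j) n)))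
      \<le> 40 * sqrt M * (Ip + Is / 6400)"
    using eventually_gt_at_top[of 0] by eventually_elim (rule fej)
  ultimately have "(\<Sum>j\<in>J. 2 * pi * (\<Sum>n\<in>A. g j n \<bullet> (of_real 1 * fourier_coeff (H j) n))) \<le> 40 * sqrt M * (Ip + Is / 6400)"
    by (rule tendsto_upperbound) simp
  also have "(\<Sum>j\<in>J. 2 * pi * (\<Sum>n\<in>A. g j n \<bullet> (of_real 1 * fourier_coeff (H j) n)))
     = integral {0..2*pi} (\<lambda>x. \<Sum>j\<in>J. G j x \<bullet> H j x)"
    unfolding G_def of_real_1 mult_1
    by (intro integral_unique[symmetric] has_integral_sum J integral_trig_sum_inner contH A)
  finally have upper: "integral {0..2*pi} (\<lambda>x. \<Sum>j\<in>J. G j x \<bullet> H j x) \<le> 40 * sqrt M * (Ip + Is / 6400)" .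
  have "sqrt M / 80 * (Is - 2 * pi * e powr (p / 2)) = integral {0..2*pi} (\<lambda>x. sqrt M / 80 * (s x powr (p / 2) - e powr (p / 2)))"
    using integral_diff[OF ints integrable_const_ivl, of "e powr (p / 2)"] by (simp add: Is_def)
  also have "\<dots> \<le> integral {0..2*pi} (\<lambda>x. \<Sum>j\<in>J. G j x \<bullet> H j x)"
  proof (rule integral_le)
    show "(\<lambda>x. sqrt M / 80 * (s x powr (p / 2) - e powr (p / 2))) integrable_on {0..2*pi}"
      by (intro integrable_continuous_interval continuous_intros conts) auto
    show "(\<lambda>x. \<Sum>j\<in>J. G j x \<bullet> H j x) integrable_on {0..2*pi}"
      by (intro integrable_continuous_interval continuous_intros contG contH)
    fix x
    have inner: "z \<bullet> (of_real y * z) = y * (cmod z)\<^sup>2" for y and z :: complex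
      unfolding cmod_power2 by (simp add: inner_complex_def power2_eq_square algebra_simps)
    have "(\<Sum>j\<in>J. G j x \<bullet> H j x) = s x powr (p / 2 - 1) / (80 * sqrt M) * (\<Sum>j\<in>J. (cmod (G j x))\<^sup>2)"
      unfolding sum_distrib_left H_def inner ..
    also have "(\<Sum>j\<in>J. (cmod (G j x))\<^sup>2) = sqrt M * sqrt M * (s x - e)" unfolding s_def using M0 by simp
    also have "s x powr (p / 2 - 1) / (80 * sqrt M) * (sqrt M * sqrt M * (s x - e))
       = sqrt M / 80 * (s x powr (p / 2 - 1) * s x - s x powr (p / 2 - 1) * e)"
    proof -
      have "y / (80 * r) * (r * r * (z - e)) = r / 80 * (y * z - y * e)" if "r \<noteq> 0" for r y z :: real
        using that by (simp add: field_simps)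
      then show ?thesis using M0 by (metis real_sqrt_eq_zero_cancel_iff less_irrefl)
    qed
    also have "s x powr (p / 2 - 1) * s x = s x powr (p / 2)" using s(2)[of x] by (simp add: powr_diff)
    finally have eq: "(\<Sum>j\<in>J. G j x \<bullet> H j x) = sqrt M / 80 * (s x powr (p / 2) - s x powr (p / 2 - 1) * e)" .
    have "s x powr (p / 2 - 1) * e \<le> e powr (p / 2 - 1) * e"
      using s[of x] e p by (intro mult_right_mono powr_mono2') auto
    also have "\<dots> = e powr (p / 2)" using e by (simp add: powr_diff)
    finally show "sqrt M / 80 * (s x powr (p / 2) - e powr (p / 2)) \<le> (\<Sum>j\<in>J. G j x \<bullet> H j x)"
      unfolding eq using M0 by (intro mult_left_mono) auto
  qed
  finally have "sqrt M * ((Is - 2 * pi * e powr (p / 2)) / 80) \<le> sqrt M * (40 * (Ip + Is / 6400))"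
    using upper by (simp only: times_divide_eq_right times_divide_eq_left mult.left_commute[of "sqrt M" 40] mult.assoc)
  then have "(Is - 2 * pi * e powr (p / 2)) / 80 \<le> 40 * (Ip + Is / 6400)"
    using M0 by (subst (asm) mult_le_cancel_left_pos) auto
  then have "Is \<le> 6400 * Ip + 4 * pi * e powr (p / 2)" by (simp add: field_simps)
  then show ?thesis unfolding Is_def Ip_def s_def G_def g_def .
qed

text \<open>The constant \<open>6400\<close> is independent of \<open>p\<close>, and the annuli enter through their overlap alone.\<close>

theorem annulus_square_function:
  fixes c :: "int \<Rightarrow> complex"
  assumes A: "finite A" "A \<subseteq> {0..}" and J: "finite J" and p: "1 < p" "p < 2"
    and ab: "\<And>j. j \<in> J \<Longrightarrow> - T \<le> a j \<and> a j \<le> b j \<and> b j \<le> 0" and T: "0 \<le> T"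
    and M: "\<And>t. real (card {j \<in> J. a j \<le> t \<and> t \<le> b j}) \<le> M" and M0: "0 < M"
  shows "integral {0..2*pi} (\<lambda>x. (\<Sum>j\<in>J. (cmod (trig_sum A (\<lambda>n. of_real (annulus_multiplier (a j) (b j) n) * c n) x))\<^sup>2) powr (p / 2))
     \<le> 6400 * M powr (p / 2) * integral {0..2*pi} (\<lambda>x. ((cmod (trig_sum A c x))\<^sup>2) powr (p / 2))"
proof -
  define S where "S x = (\<Sum>j\<in>J. (cmod (trig_sum A (\<lambda>n. of_real (annulus_multiplier (a j) (b j) n) * c n) x))\<^sup>2)" for x
  define I where "I = integral {0..2*pi} (\<lambda>x. ((cmod (trig_sum A c x))\<^sup>2) powr (p / 2))"
  have S0: "0 \<le> S x" for x unfolding S_def by (simp add: sum_nonneg)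
  have "integral {0..2*pi} (\<lambda>x. (S x / M) powr (p / 2)) \<le> 6400 * I + 4 * pi * 0"
  proof (rule tendsto_le[OF _ _ integral_powr_add_tendsto])
    show "((\<lambda>e. 6400 * I + 4 * pi * e powr (p / 2)) \<longlongrightarrow> 6400 * I + 4 * pi * 0) (at_right 0)"
    proof (intro tendsto_intros)
      show "((\<lambda>e. e powr (p / 2)) \<longlongrightarrow> 0) (at_right 0)"
      proof -
        have "continuous_on {0..1} (\<lambda>e::real. e powr (p / 2))"
          using p by (intro continuous_on_powr' continuous_intros) auto
        from this[unfolded continuous_on_def, rule_format, of 0] show ?thesis
          by (simp add: at_within_Icc_at_right)
      qed
    qed
    show "\<forall>\<^sub>F e in at_right 0. integral {0..2*pi} (\<lambda>x. (S x / M + e) powr (p / 2)) \<le> 6400 * I + 4 * pi * e powr (p / 2)"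
      using annulus_square_function_perturbed[OF assms] unfolding S_def I_def
      by (intro eventually_at_rightI[of 0 1]) auto
    show "continuous_on {0..2*pi} (\<lambda>x. S x / M)" unfolding S_def using M0 by (intro continuous_intros) auto
  qed (use p M0 S0 in auto)
  also have "integral {0..2*pi} (\<lambda>x. (S x / M) powr (p / 2)) = integral {0..2*pi} (\<lambda>x. S x powr (p / 2)) / M powr (p / 2)"
    using M0 S0 by (simp add: powr_divide)
  finally show ?thesis using M0 unfolding S_def I_def by (simp add: field_simps)
qed

section \<open>Sharp frequency intervals\<close>

lemma trig_sum_shift:
  assumes "finite A"
  shows "trig_sum ((\<lambda>n. n + k) ` A) c x = exp (\<i> * of_int k * of_real x) * trig_sum A (\<lambda>n. c (n + k)) x"
proof -
  have "trig_sum ((\<lambda>n. n + k) ` A) c x = (\<Sum>n\<in>A. c (n + k) * exp (\<i> * of_int (n + k) * of_real x))"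
    by (subst sum.reindex) (auto simp: inj_on_def)
  also have "\<dots> = (\<Sum>n\<in>A. exp (\<i> * of_int k * of_real x) * (c (n + k) * exp (\<i> * of_int n * of_real x)))"
    by (intro sum.cong refl) (simp add: algebra_simps exp_add)
  finally show ?thesis by (simp add: sum_distrib_left)
qed

text \<open>A projection onto the frequencies \<open>\<ge> k\<close> is the Riesz projection conjugated with multiplication by
  \<open>exp (\<i>kx)\<close>, which does not change absolute values.\<close>

theorem half_line_projections_l2:
  fixes c :: "'i \<Rightarrow> int \<Rightarrow> complex" and k :: "'i \<Rightarrow> int"
  assumes I: "finite I" and A: "finite A" and p: "1 < p" "p \<le> 2"
  shows "integral {0..2*pi} (\<lambda>x. (\<Sum>i\<in>I. (cmod (trig_sum (A \<inter> {k i..}) (c i) x))\<^sup>2) powr (p / 2))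
    \<le> 2 / (p - 1) * integral {0..2*pi} (\<lambda>x. (\<Sum>i\<in>I. (cmod (trig_sum A (c i) x))\<^sup>2) powr (p / 2))"
proof -
  define A' where "A' = (\<lambda>(n, i). n - k i) ` (A \<times> I)"
  define c' where "c' i n = (if n + k i \<in> A then c i (n + k i) else 0)" for i n
  have A': "finite A'" using A I by (simp add: A'_def)
  have norm_eq: "cmod (trig_sum (A' \<inter> S) (c' i) x) = cmod (trig_sum (A \<inter> (\<lambda>n. n + k i) ` S) (c i) x)"
    if i: "i \<in> I" for i S x
  proof -
    have sub: "{n \<in> S. n + k i \<in> A} \<subseteq> A'"
    proof
      fix n assume "n \<in> {n \<in> S. n + k i \<in> A}"
      then show "n \<in> A'" unfolding A'_def using i by (intro image_eqI[of _ _ "(n + k i, i)"]) auto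
    qed
    have "trig_sum (A' \<inter> S) (c' i) x = trig_sum {n \<in> S. n + k i \<in> A} (\<lambda>n. c i (n + k i)) x"
    proof (rule sum.mono_neutral_cong_right)
      show "{n \<in> S. n + k i \<in> A} \<subseteq> A' \<inter> S" using sub by blast
    qed (use A' in \<open>auto simp: c'_def\<close>)
    then have "cmod (trig_sum (A' \<inter> S) (c' i) x)
       = cmod (exp (\<i> * of_int (k i) * of_real x) * trig_sum {n \<in> S. n + k i \<in> A} (\<lambda>n. c i (n + k i)) x)"
      by (simp add: norm_mult norm_exp_eq_Re)
    also have "\<dots> = cmod (trig_sum ((\<lambda>n. n + k i) ` {n \<in> S. n + k i \<in> A}) (c i) x)"
    proof (subst trig_sum_shift)
      show "finite {n \<in> S. n + k i \<in> A}" using sub A' by (rule finite_subset)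
    qed simp
    also have "(\<lambda>n. n + k i) ` {n \<in> S. n + k i \<in> A} = A \<inter> (\<lambda>n. n + k i) ` S" by auto
    finally show ?thesis .
  qed
  have *: "A \<inter> (\<lambda>n. n + k i) ` {0..} = A \<inter> {k i..}" for i
  proof -
    have "n \<in> (\<lambda>n. n + k i) ` {0..}" if "k i \<le> n" for n
      using that by (intro image_eqI[of _ _ "n - k i"]) auto
    then show ?thesis by auto
  qed
  have **: "A \<inter> (\<lambda>n. n + k i) ` UNIV = A" for i
  proof -
    have "n \<in> range (\<lambda>n. n + k i)" for n by (rule image_eqI[of _ _ "n - k i"]) auto
    then show ?thesis by blast
  qed
  have "(\<Sum>i\<in>I. (cmod (trig_sum (A' \<inter> {0..}) (c' i) x))\<^sup>2) = (\<Sum>i\<in>I. (cmod (trig_sum (A \<inter> {k i..}) (c i) x))\<^sup>2)"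
    "(\<Sum>i\<in>I. (cmod (trig_sum A' (c' i) x))\<^sup>2) = (\<Sum>i\<in>I. (cmod (trig_sum A (c i) x))\<^sup>2)" for x
    using norm_eq[where S = "{0..}" and x = x] norm_eq[where S = UNIV and x = x] by (simp_all add: * ** cong: sum.cong)
  with riesz_projection_l2[OF I A' p, of c'] show ?thesis by simp
qed

lemma annulus_profile_mono:
  assumes "x \<le> y" "y \<le> 0"
  shows "annulus_profile x \<le> annulus_profile y"
proof (rule DERIV_nonneg_imp_nondecreasing[OF assms(1)])
  fix z assume z: "x \<le> z" "z \<le> y"
  have "(annulus_profile has_real_derivative - 4 * z * exp (2 * z)) (at z)"
    unfolding annulus_profile_def[abs_def] by (auto intro!: derivative_eq_intros simp: algebra_simps)
  moreover have "0 \<le> - 4 * z * exp (2 * z)" using z assms(2) by (simp add: mult_nonpos_nonneg)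
  ultimately show "\<exists>d. (annulus_profile has_real_derivative d) (at z) \<and> 0 \<le> d" by blast
qed

lemma annulus_profile_bounds:
  assumes "y \<le> 0" shows "0 \<le> annulus_profile y" "annulus_profile y \<le> 1"
  using annulus_profile_mono[OF assms order_refl] assms by (auto simp: annulus_profile_def)

text \<open>The annulus belonging to the block from \<open>\<alpha>\<close> to \<open>\<beta>\<close> is widened by the factor 2 on both sides, so that all
  frequencies of the block, the extreme ones included, are well inside.\<close>

lemma annulus_multiplier_lower:
  assumes "0 < \<alpha>" "\<alpha> \<le> real_of_int n" "real_of_int n \<le> \<beta>"
  shows "1 / 4 \<le> annulus_multiplier (- 2 / \<alpha>) (- 1 / (2 * \<beta>)) n"
proof -
  define r s where "r = of_int n / \<beta>" and "s = of_int n / \<alpha>"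
  have n: "0 \<le> r" "r \<le> 1" "1 \<le> s"
    using assms by (auto simp: r_def s_def divide_le_eq le_divide_eq)
  have e: "of_int n * (- 1 / (2 * \<beta>)) = - r / 2" "of_int n * (- 2 / \<alpha>) = - 2 * s"
    by (simp_all add: r_def s_def)
  have "annulus_profile (- 1 / 2) \<le> annulus_profile (of_int n * (- 1 / (2 * \<beta>)))"
    unfolding e using n by (intro annulus_profile_mono) linarith+
  moreover have "annulus_profile (of_int n * (- 2 / \<alpha>)) \<le> annulus_profile (- 2)"
    unfolding e using n by (intro annulus_profile_mono) linarith+
  moreover have "2 / 3 \<le> annulus_profile (- 1 / 2)"
  proof -
    have "2 / 3 \<le> 2 / exp (1::real)" using exp_le by (intro divide_left_mono) auto
    also have "\<dots> = annulus_profile (- 1 / 2)" by (simp add: annulus_profile_def exp_minus inverse_eq_divide)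
    finally show ?thesis .
  qed
  moreover have "annulus_profile (- 2) \<le> 5 / 16"
  proof -
    have "annulus_profile (- 2) = 5 / exp (4::real)" by (simp add: annulus_profile_def exp_minus inverse_eq_divide)
    also have "(16::real) \<le> exp 4"
    proof -
      have "(2::real) ^ 4 \<le> exp 1 ^ 4" using exp_ge_add_one_self[of "1::real"] by (intro power_mono) auto
      also have "\<dots> = exp (4::real)" using exp_of_nat_mult[of 4 "1::real"] by simp
      finally show ?thesis by simp
    qed
    then have "5 / exp (4::real) \<le> 5 / 16" by (intro divide_left_mono) auto
    finally show ?thesis .
  qed
  ultimately show ?thesis unfolding annulus_multiplier_def by linarith
qed

lemma sum_nat_telescope:
  fixes f :: "nat \<Rightarrow> real"
  assumes "1 \<le> \<alpha>" "\<alpha> \<le> Suc n"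
  shows "(\<Sum>l\<in>{\<alpha>..n}. f l - f (l - 1)) = f n - f (\<alpha> - 1)"
  using sum_telescope''[of "\<alpha> - 1" n f] assms by simp

text \<open>\<open>v\<close> is the sequence of increments of \<open>1 / m\<close>, cut off outside the block. The symbol \<open>m \<ge> 1 / 4\<close> is a
  difference of two monotone sequences with values in \<open>[0, 1]\<close>, so \<open>1 / m\<close> varies by at most \<open>16 * 2\<close>
  inside the block, and its two jumps at the ends are at most \<open>4\<close> each.\<close>

lemma inverse_multiplier_variation:
  fixes \<alpha> \<beta> :: nat and m :: "nat \<Rightarrow> real"
  assumes \<alpha>: "1 \<le> \<alpha>" "\<alpha> \<le> \<beta>"
  defines "m \<equiv> \<lambda>n. annulus_multiplier (- 2 / real \<alpha>) (- 1 / (2 * real \<beta>)) (int n)"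
  obtains v :: "nat \<Rightarrow> real" where
    "(\<Sum>l\<in>{\<alpha>..\<beta>}. \<bar>v l\<bar>) \<le> 40"
    "\<And>n. (\<Sum>l\<in>{\<alpha>..\<beta>} \<inter> {..n}. v l) * m n = (if \<alpha> \<le> n \<and> n < \<beta> then 1 else 0)"
proof
  define w where "w n = (if \<alpha> \<le> n \<and> n < \<beta> then 1 / m n else 0)" for n
  define v where "v l = w l - w (l - 1)" for l
  have mlow: "1 / 4 \<le> m n" if "\<alpha> \<le> n" "n \<le> \<beta>" for n
    unfolding m_def using that \<alpha> by (intro annulus_multiplier_lower) auto
  have w4: "\<bar>w n\<bar> \<le> 4" for n
  proof (cases "\<alpha> \<le> n \<and> n < \<beta>")
    case True
    then have "1 / 4 \<le> m n" by (intro mlow) auto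
    then show ?thesis using True by (simp add: w_def abs_if field_simps)
  qed (auto simp: w_def)
 define Ea Eb where "Ea l = annulus_profile (real l * (- 2 / real \<alpha>))"
    and "Eb l = annulus_profile (real l * (- 1 / (2 * real \<beta>)))" for l :: nat
  have m: "m l = Eb l - Ea l" for l by (simp add: m_def annulus_multiplier_def Ea_def Eb_def)
  have dec: "Ea l \<le> Ea (l - 1)" "Eb l \<le> Eb (l - 1)" for l
    unfolding Ea_def Eb_def using \<alpha>
    by (intro annulus_profile_mono mult_right_mono_neg; simp add: divide_nonpos_nonneg mult_nonneg_nonpos)+
  have bnd: "0 \<le> Ea l" "Ea l \<le> 1" "0 \<le> Eb l" "Eb l \<le> 1" for l
    unfolding Ea_def Eb_def by (intro annulus_profile_bounds; simp add: mult_nonneg_nonpos)+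
 have v: "\<bar>v l\<bar> \<le> (if l = \<alpha> then 4 else 0) + (if l = \<beta> then 4 else 0)
      + 16 * (Ea (l - 1) - Ea l) + 16 * (Eb (l - 1) - Eb l)" if l: "l \<in> {\<alpha>..\<beta>}" for l
  proof (cases "l = \<alpha> \<or> l = \<beta>")
    case True
    have "\<bar>v l\<bar> \<le> 4"
    proof (cases "l = \<alpha>")
      case True
      then have "\<not> \<alpha> \<le> l - 1" using \<alpha> by linarith
      then have "w (l - 1) = 0" by (simp add: w_def)
      then show ?thesis using w4[of l] by (simp add: v_def)
    next
      case False
      then have "w l = 0" using \<open>l = \<alpha> \<or> l = \<beta>\<close> by (simp add: w_def)
      then show ?thesis using w4[of "l - 1"] by (simp add: v_def)
    qed
    then show ?thesis using True dec[of l] by auto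
  next
    case False
    with l have l': "\<alpha> < l" "l < \<beta>" by auto
    have m1: "1 / 4 \<le> m l" "1 / 4 \<le> m (l - 1)" using mlow[of l] mlow[of "l - 1"] l' by auto
    have "v l = (m (l - 1) - m l) / (m l * m (l - 1))"
    proof -
      have "\<alpha> \<le> l - 1" "l - 1 < \<beta>" using l' by auto
      then have "v l = 1 / m l - 1 / m (l - 1)" using l' by (simp add: v_def w_def)
      also have "\<dots> = (m (l - 1) - m l) / (m l * m (l - 1))"
        using m1 by (subst diff_frac_eq) auto
      finally show ?thesis .
    qed
    then have "\<bar>v l\<bar> = \<bar>m (l - 1) - m l\<bar> / (m l * m (l - 1))" using m1 by (simp add: abs_mult)
    also have "\<dots> \<le> \<bar>m (l - 1) - m l\<bar> / (1 / 4 * (1 / 4))"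
      using m1 by (intro divide_left_mono mult_mono mult_pos_pos) auto
    also have "\<dots> \<le> 16 * ((Ea (l - 1) - Ea l) + (Eb (l - 1) - Eb l))"
    proof -
      have "\<bar>(y' - x') - (y - x)\<bar> / (1 / 4 * (1 / 4)) \<le> 16 * ((x' - x) + (y' - y))"
        if "x \<le> x'" "y \<le> y'" for x x' y y' :: real
        using that by (simp add: abs_if)
      then show ?thesis using dec unfolding m by blast
    qed
    finally show ?thesis using False by simp
  qed
  have tel: "(\<Sum>l\<in>{\<alpha>..\<beta>}. f (l - 1) - f l) = f (\<alpha> - 1) - f \<beta>" for f :: "nat \<Rightarrow> real"
    using sum_nat_telescope[of \<alpha> \<beta> "\<lambda>l. - f l"] \<alpha> by simp
  have "(\<Sum>l\<in>{\<alpha>..\<beta>}. \<bar>v l\<bar>) \<le> (\<Sum>l\<in>{\<alpha>..\<beta>}. (if l = \<alpha> then 4 else 0) + (if l = \<beta> then 4 else 0)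
      + 16 * (Ea (l - 1) - Ea l) + 16 * (Eb (l - 1) - Eb l))"
    by (intro sum_mono v)
  also have "\<dots> = 4 + 4 + 16 * (Ea (\<alpha> - 1) - Ea \<beta>) + 16 * (Eb (\<alpha> - 1) - Eb \<beta>)"
    using \<alpha> unfolding sum.distrib sum_distrib_left[symmetric] tel by (simp add: sum.delta)
  also have "\<dots> \<le> 40"
  proof -
    have "16 * (Ea (\<alpha> - 1) - Ea \<beta>) \<le> 16 * (1 - 0)" "16 * (Eb (\<alpha> - 1) - Eb \<beta>) \<le> 16 * (1 - 0)"
      by (intro mult_left_mono diff_mono bnd; simp)+
    then show ?thesis by argo
  qed
  finally show "(\<Sum>l\<in>{\<alpha>..\<beta>}. \<bar>v l\<bar>) \<le> 40" .
  show "(\<Sum>l\<in>{\<alpha>..\<beta>} \<inter> {..n}. v l) * m n = (if \<alpha> \<le> n \<and> n < \<beta> then 1 else 0)" for n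
  proof -
    have "(\<Sum>l\<in>{\<alpha>..\<beta>} \<inter> {..n}. v l) = w n"
    proof (cases "\<alpha> \<le> n")
      case True
      have "{\<alpha>..\<beta>} \<inter> {..n} = {\<alpha>..min \<beta> n}" by auto
      then have "(\<Sum>l\<in>{\<alpha>..\<beta>} \<inter> {..n}. v l) = w (min \<beta> n) - w (\<alpha> - 1)"
        unfolding v_def using sum_nat_telescope[of \<alpha> "min \<beta> n" w] True \<alpha> by simp
      also have "w (\<alpha> - 1) = 0"
      proof -
        have "\<not> \<alpha> \<le> \<alpha> - 1" using \<alpha> by auto
        then show ?thesis by (simp add: w_def)
      qed
      also have "w (min \<beta> n) = w n" by (simp add: w_def min_def)
      finally show ?thesis by simp
    next
      case False
      then have "{\<alpha>..\<beta>} \<inter> {..n} = {}" by auto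
      then show ?thesis using False by (simp add: w_def)
    qed
    then show ?thesis using mlow[of n] by (auto simp: w_def)
  qed
qed

lemma weighted_Cauchy_Schwarz:
  fixes v :: "'l \<Rightarrow> real" and z :: "'l \<Rightarrow> complex"
  shows "(cmod (\<Sum>l\<in>L. of_real (v l) * z l))\<^sup>2 \<le> (\<Sum>l\<in>L. \<bar>v l\<bar>) * (\<Sum>l\<in>L. \<bar>v l\<bar> * (cmod (z l))\<^sup>2)"
proof -
  have "cmod (\<Sum>l\<in>L. of_real (v l) * z l) \<le> (\<Sum>l\<in>L. sqrt \<bar>v l\<bar> * (sqrt \<bar>v l\<bar> * cmod (z l)))"
    by (rule order_trans[OF norm_sum]) (simp add: norm_mult mult.assoc[symmetric])
  then have "(cmod (\<Sum>l\<in>L. of_real (v l) * z l))\<^sup>2 \<le> (\<Sum>l\<in>L. sqrt \<bar>v l\<bar> * (sqrt \<bar>v l\<bar> * cmod (z l)))\<^sup>2"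
    by (intro power_mono) auto
  also have "\<dots> \<le> (\<Sum>l\<in>L. (sqrt \<bar>v l\<bar>)\<^sup>2) * (\<Sum>l\<in>L. (sqrt \<bar>v l\<bar> * cmod (z l))\<^sup>2)"
    by (rule Cauchy_Schwarz_ineq_sum)
  finally show ?thesis by (simp add: power_mult_distrib)
qed

text \<open>Summation by parts: the sharp block of \<open>F\<close> is \<open>\<Sum>l. v l * P l (G j)\<close>, where \<open>P l\<close> projects onto the
  frequencies \<open>\<ge> l\<close> and \<open>G j\<close> is the smooth block. As \<open>\<Sum>l. \<bar>v l\<bar>\<close> is bounded, Cauchy--Schwarz leads to the
  \<open>\<ell>\<^sup>2\<close>-valued function with components \<open>sqrt \<bar>v l\<bar> * P l (G j)\<close>, and the
  half-line projection theorem removes the \<open>P l\<close> at the price of the factor \<open>1 / (p - 1)\<close>.\<close>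

theorem interval_square_function:
  fixes c :: "int \<Rightarrow> complex" and \<alpha> \<beta> :: "'j \<Rightarrow> nat"
  assumes A: "finite A" "A \<subseteq> {0..}" and J: "finite J" and p: "1 < p" "p < 2"
    and \<alpha>\<beta>: "\<And>j. j \<in> J \<Longrightarrow> 1 \<le> \<alpha> j \<and> \<alpha> j \<le> \<beta> j"
    and M: "\<And>y. 0 < y \<Longrightarrow> real (card {j \<in> J. real (\<alpha> j) \<le> 2 * y \<and> y / 2 \<le> real (\<beta> j)}) \<le> M" and M0: "0 < M"
  shows "integral {0..2*pi} (\<lambda>x. (\<Sum>j\<in>J. (cmod (trig_sum (A \<inter> {int (\<alpha> j)..<int (\<beta> j)}) c x))\<^sup>2) powr (p / 2))
     \<le> 20480000 / (p - 1) * M powr (p / 2) * integral {0..2*pi} (\<lambda>x. ((cmod (trig_sum A c x))\<^sup>2) powr (p / 2))"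
proof -
  let ?S = "\<lambda>x. (\<Sum>j\<in>J. (cmod (trig_sum (A \<inter> {int (\<alpha> j)..<int (\<beta> j)}) c x))\<^sup>2)"
  define a b where "a j = - 2 / real (\<alpha> j)" and "b j = - 1 / (2 * real (\<beta> j))" for j
  define g where "g j n = of_real (annulus_multiplier (a j) (b j) n) * c n" for j n
  define G where "G j x = trig_sum A (g j) x" for j x
  have "\<exists>v. (\<Sum>l\<in>{\<alpha> j..\<beta> j}. \<bar>v l\<bar>) \<le> 40 \<and>
      (\<forall>n. (\<Sum>l\<in>{\<alpha> j..\<beta> j} \<inter> {..n}. v l) * annulus_multiplier (a j) (b j) (int n) = (if \<alpha> j \<le> n \<and> n < \<beta> j then 1 else 0))"
    if "j \<in> J" for j
    unfolding a_def b_def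
    by (rule inverse_multiplier_variation[of "\<alpha> j" "\<beta> j"]) (use \<alpha>\<beta>[OF that] in blast)+
  then obtain v where v: "\<And>j. j \<in> J \<Longrightarrow> (\<Sum>l\<in>{\<alpha> j..\<beta> j}. \<bar>v j l\<bar>) \<le> 40"
    "\<And>j n. j \<in> J \<Longrightarrow> (\<Sum>l\<in>{\<alpha> j..\<beta> j} \<inter> {..n}. v j l) * annulus_multiplier (a j) (b j) (int n) = (if \<alpha> j \<le> n \<and> n < \<beta> j then 1 else 0)"
    by metis
  define I where "I = Sigma J (\<lambda>j. {\<alpha> j..\<beta> j})"
  have I: "finite I" using J by (simp add: I_def)
  define cI where "cI i n = of_real (sqrt \<bar>v (fst i) (snd i)\<bar>) * g (fst i) n" for i n
  define k where "k i = int (snd i)" for i :: "'j \<times> nat"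
  let ?G = "\<lambda>x. (\<Sum>j\<in>J. (cmod (G j x))\<^sup>2)"
  let ?P = "\<lambda>x. (\<Sum>i\<in>I. (cmod (trig_sum (A \<inter> {k i..}) (cI i) x))\<^sup>2)"
  have cI: "trig_sum B (cI i) x = of_real (sqrt \<bar>v (fst i) (snd i)\<bar>) * trig_sum B (g (fst i)) x" for B i x
    unfolding cI_def sum_distrib_left by (simp add: mult.assoc)
  have decomp: "trig_sum (A \<inter> {int (\<alpha> j)..<int (\<beta> j)}) c x
      = (\<Sum>l\<in>{\<alpha> j..\<beta> j}. of_real (v j l) * trig_sum (A \<inter> {int l..}) (g j) x)" if j: "j \<in> J" for j x
  proof -
    define e where "e n = exp (\<i> * of_int n * of_real x)" for n :: int
    have "of_real (v j l) * trig_sum (A \<inter> {int l..}) (g j) x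
       = (\<Sum>n\<in>A. if int l \<le> n then of_real (v j l) * (g j n * e n) else 0)" for l
      unfolding sum.inter_restrict[OF A(1)] sum_distrib_left e_def by (intro sum.cong) auto
    then have "(\<Sum>l\<in>{\<alpha> j..\<beta> j}. of_real (v j l) * trig_sum (A \<inter> {int l..}) (g j) x)
       = (\<Sum>l\<in>{\<alpha> j..\<beta> j}. \<Sum>n\<in>A. if int l \<le> n then of_real (v j l) * (g j n * e n) else 0)"
      by (simp only:)
    also have "\<dots> = (\<Sum>n\<in>A. \<Sum>l\<in>{\<alpha> j..\<beta> j}. if int l \<le> n then of_real (v j l) * (g j n * e n) else 0)"
      by (rule sum.swap)
    also have "\<dots> = (\<Sum>n\<in>A. if n \<in> {int (\<alpha> j)..<int (\<beta> j)} then c n * e n else 0)"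
    proof (intro sum.cong refl)
      fix n assume "n \<in> A"
      then obtain N where n: "n = int N" using A(2) by (metis atLeast_iff nonneg_int_cases subsetD)
      have "(\<Sum>l\<in>{\<alpha> j..\<beta> j}. if int l \<le> n then of_real (v j l) * (g j n * e n) else 0)
        = (\<Sum>l\<in>{\<alpha> j..\<beta> j} \<inter> {..N}. of_real (v j l) * (g j n * e n))"
        unfolding n by (subst sum.inter_restrict) (auto intro!: sum.cong)
      also have "\<dots> = of_real ((\<Sum>l\<in>{\<alpha> j..\<beta> j} \<inter> {..N}. v j l) * annulus_multiplier (a j) (b j) n) * (c n * e n)"
        unfolding of_real_mult of_real_sum sum_distrib_right g_def by (intro sum.cong) (simp_all add: mult_ac)
      also have "\<dots> = (if n \<in> {int (\<alpha> j)..<int (\<beta> j)} then c n * e n else 0)"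
        unfolding n v(2)[OF j] by simp
      finally show "(\<Sum>l\<in>{\<alpha> j..\<beta> j}. if int l \<le> n then of_real (v j l) * (g j n * e n) else 0)
         = (if n \<in> {int (\<alpha> j)..<int (\<beta> j)} then c n * e n else 0)" .
    qed
    also have "\<dots> = trig_sum (A \<inter> {int (\<alpha> j)..<int (\<beta> j)}) c x"
      unfolding e_def by (simp only: sum.inter_restrict[OF A(1)])
    finally show ?thesis ..
  qed
  have step1: "?S x
     \<le> 40 * ?P x" for x
  proof -
    have "(cmod (trig_sum (A \<inter> {int (\<alpha> j)..<int (\<beta> j)}) c x))\<^sup>2
      \<le> 40 * (\<Sum>l\<in>{\<alpha> j..\<beta> j}. \<bar>v j l\<bar> * (cmod (trig_sum (A \<inter> {int l..}) (g j) x))\<^sup>2)" if j: "j \<in> J" for j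
      unfolding decomp[OF j] using v(1)[OF j]
      by (intro order_trans[OF weighted_Cauchy_Schwarz] mult_right_mono) (auto intro: sum_nonneg)
    then have "?S x
      \<le> (\<Sum>j\<in>J. 40 * (\<Sum>l\<in>{\<alpha> j..\<beta> j}. \<bar>v j l\<bar> * (cmod (trig_sum (A \<inter> {int l..}) (g j) x))\<^sup>2))"
      by (rule sum_mono)
    also have "\<dots> = 40 * ?P x"
      unfolding cI I_def k_def sum_distrib_left[symmetric]
      by (subst sum.Sigma) (auto simp: J case_prod_unfold norm_mult power_mult_distrib)
    finally show ?thesis .
  qed
  have step2: "(\<Sum>i\<in>I. (cmod (trig_sum A (cI i) x))\<^sup>2) \<le> 40 * ?G x" for x
  proof -
    have "(\<Sum>i\<in>I. (cmod (trig_sum A (cI i) x))\<^sup>2) = (\<Sum>j\<in>J. \<Sum>l\<in>{\<alpha> j..\<beta> j}. \<bar>v j l\<bar> * (cmod (G j x))\<^sup>2)"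
      unfolding cI I_def G_def by (subst sum.Sigma) (auto simp: J case_prod_unfold norm_mult power_mult_distrib)
    also have "\<dots> \<le> (\<Sum>j\<in>J. 40 * (cmod (G j x))\<^sup>2)"
      unfolding sum_distrib_right[symmetric] using v(1) by (intro sum_mono mult_right_mono) auto
    finally show ?thesis by (simp add: sum_distrib_left)
  qed
  have iI: "(\<lambda>x. (\<Sum>i\<in>I. (cmod (trig_sum (B i) (cI i) x))\<^sup>2) powr (p / 2)) integrable_on {0..2*pi}" for B
    using p by (intro integrable_continuous_interval continuous_l2_powr continuous_intros) auto
  have iG: "(\<lambda>x. ?G x powr (p / 2)) integrable_on {0..2*pi}"
    unfolding G_def using p by (intro integrable_continuous_interval continuous_l2_powr continuous_intros) auto
  have "integral {0..2*pi} (\<lambda>x. ?S x powr (p / 2))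
    \<le> integral {0..2*pi} (\<lambda>x. 40 powr (p / 2) * ?P x powr (p / 2))"
  proof (rule integral_le)
    show "(\<lambda>x. ?S x powr (p / 2)) integrable_on {0..2*pi}"
      using p by (intro integrable_continuous_interval continuous_l2_powr continuous_intros) auto
    show "(\<lambda>x. 40 powr (p / 2) * ?P x powr (p / 2)) integrable_on {0..2*pi}"
      by (intro integrable_on_mult_right iI)
    fix x
    have "?S x powr (p / 2)
      \<le> (40 * ?P x) powr (p / 2)"
      using p by (intro powr_mono2 step1) (auto simp: sum_nonneg)
    then show "?S x powr (p / 2)
      \<le> 40 powr (p / 2) * ?P x powr (p / 2)"
      by (simp add: powr_mult sum_nonneg)
  qed
  also have "\<dots> = 40 powr (p / 2) * integral {0..2*pi} (\<lambda>x. ?P x powr (p / 2))"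
    by simp
  also have "\<dots> \<le> 40 powr (p / 2) * (2 / (p - 1) * integral {0..2*pi} (\<lambda>x. (\<Sum>i\<in>I. (cmod (trig_sum A (cI i) x))\<^sup>2) powr (p / 2)))"
    using p by (intro mult_left_mono half_line_projections_l2 I A) auto
  also have "integral {0..2*pi} (\<lambda>x. (\<Sum>i\<in>I. (cmod (trig_sum A (cI i) x))\<^sup>2) powr (p / 2))
     \<le> integral {0..2*pi} (\<lambda>x. 40 powr (p / 2) * ?G x powr (p / 2))"
  proof (rule integral_le[OF iI])
    show "(\<lambda>x. 40 powr (p / 2) * ?G x powr (p / 2)) integrable_on {0..2*pi}"
      by (intro integrable_on_mult_right iG)
    fix x
    have "(\<Sum>i\<in>I. (cmod (trig_sum A (cI i) x))\<^sup>2) powr (p / 2) \<le> (40 * ?G x) powr (p / 2)"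
      using p by (intro powr_mono2 step2) (auto simp: sum_nonneg)
    then show "(\<Sum>i\<in>I. (cmod (trig_sum A (cI i) x))\<^sup>2) powr (p / 2) \<le> 40 powr (p / 2) * ?G x powr (p / 2)"
      by (simp add: powr_mult sum_nonneg)
  qed
  also have "\<dots> = 40 powr (p / 2) * integral {0..2*pi} (\<lambda>x. ?G x powr (p / 2))" by simp
  also have "integral {0..2*pi} (\<lambda>x. ?G x powr (p / 2))
     \<le> 6400 * M powr (p / 2) * integral {0..2*pi} (\<lambda>x. ((cmod (trig_sum A c x))\<^sup>2) powr (p / 2))"
    unfolding G_def g_def
  proof (rule annulus_square_function[OF A J p _ _ _ M0, of 2])
    show "- 2 \<le> a j \<and> a j \<le> b j \<and> b j \<le> 0" if "j \<in> J" for j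
      using \<alpha>\<beta>[OF that] unfolding a_def b_def by (auto simp: field_simps)
    show "real (card {j \<in> J. a j \<le> t \<and> t \<le> b j}) \<le> M" for t
    proof (cases "t < 0")
      case True
      \<comment> \<open>the height t corresponds to the frequency y\<close>
      define y where "y = - 1 / t"
      have y: "0 < y" "t = - 1 / y" using True by (auto simp: y_def)
      have "{j \<in> J. a j \<le> t \<and> t \<le> b j} = {j \<in> J. real (\<alpha> j) \<le> 2 * y \<and> y / 2 \<le> real (\<beta> j)}"
      proof (intro Collect_cong conj_cong refl)
        fix j assume "j \<in> J"
        then have "0 < real (\<alpha> j)" "0 < real (\<beta> j)" using \<alpha>\<beta>[of j] by auto
        then show "(a j \<le> t) = (real (\<alpha> j) \<le> 2 * y)" "(t \<le> b j) = (y / 2 \<le> real (\<beta> j))"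
          unfolding a_def b_def y(2) using y(1) by (auto simp: field_simps)
      qed
      then show ?thesis using M[OF y(1)] by simp
    next
      case False
      have "b j < 0" if "j \<in> J" for j using \<alpha>\<beta>[OF that] by (simp add: b_def)
      then have empty: "{j \<in> J. a j \<le> t \<and> t \<le> b j} = {}" using False by force
      show ?thesis unfolding empty using M0 by simp
    qed
  qed simp
  finally have "integral {0..2*pi} (\<lambda>x. ?S x powr (p / 2))
    \<le> 40 powr (p / 2) * (2 / (p - 1) * (40 powr (p / 2) * (6400 * M powr (p / 2)
      * integral {0..2*pi} (\<lambda>x. ((cmod (trig_sum A c x))\<^sup>2) powr (p / 2)))))"
    using p by (simp add: mult_left_mono divide_right_mono)
  also have "\<dots> = 40 powr p * (12800 / (p - 1) * M powr (p / 2) * integral {0..2*pi} (\<lambda>x. ((cmod (trig_sum A c x))\<^sup>2) powr (p / 2)))"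
  proof -
    have "(40::real) powr p = 40 powr (p / 2) * 40 powr (p / 2)" by (simp add: powr_add[symmetric])
    then show ?thesis by simp
  qed
  also have "\<dots> \<le> 40 powr 2 * (12800 / (p - 1) * M powr (p / 2) * integral {0..2*pi} (\<lambda>x. ((cmod (trig_sum A c x))\<^sup>2) powr (p / 2)))"
  proof (intro mult_right_mono powr_mono mult_nonneg_nonneg)
    show "0 \<le> integral {0..2*pi} (\<lambda>x. ((cmod (trig_sum A c x))\<^sup>2) powr (p / 2))"
      using p by (intro integral_nonneg integrable_continuous_interval continuous_on_powr' continuous_intros) auto
  qed (use p in auto)
  finally show ?thesis by simp
qed

section \<open>Lacunary sequences\<close>

lemma lacunary_ratio_le:
  assumes "lacunary \<Lambda>"
  shows "lacunary_ratio \<Lambda> * real (\<Lambda> j) \<le> real (\<Lambda> (Suc j))"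
proof -
  have "lacunary_ratio \<Lambda> \<le> real (\<Lambda> (Suc j)) / real (\<Lambda> j)"
    unfolding lacunary_ratio_def by (intro cINF_lower bdd_belowI2[of _ 0]) auto
  moreover have "0 < real (\<Lambda> j)" using assms by (simp add: lacunary_def)
  ultimately show ?thesis by (simp add: le_divide_eq)
qed

lemma lacunary_growth:
  assumes "lacunary \<Lambda>"
  shows "(1 + real m * (lacunary_ratio \<Lambda> - 1)) * real (\<Lambda> j) \<le> real (\<Lambda> (j + m))"
proof -
  define \<rho> where "\<rho> = lacunary_ratio \<Lambda>"
  have \<rho>: "1 < \<rho>" using assms by (simp add: lacunary_def \<rho>_def)
  have "\<rho> ^ m * real (\<Lambda> j) \<le> real (\<Lambda> (j + m))"
  proof (induction m)
    case (Suc m)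
    have "\<rho> ^ Suc m * real (\<Lambda> j) = \<rho> * (\<rho> ^ m * real (\<Lambda> j))" by simp
    also have "\<dots> \<le> \<rho> * real (\<Lambda> (j + m))" using Suc \<rho> by (intro mult_left_mono) auto
    also have "\<dots> \<le> real (\<Lambda> (j + Suc m))" using lacunary_ratio_le[OF assms, of "j + m"] by (simp add: \<rho>_def)
    finally show ?case .
  qed simp
  moreover have "1 + real m * (\<rho> - 1) \<le> \<rho> ^ m"
    using Bernoulli_inequality[of "\<rho> - 1" m] \<rho> by simp
  then have "(1 + real m * (\<rho> - 1)) * real (\<Lambda> j) \<le> \<rho> ^ m * real (\<Lambda> j)" by (intro mult_right_mono) auto
  ultimately show ?thesis unfolding \<rho>_def by linarith
qed

text \<open>The first block starts at \<open>1\<close>: the frequency \<open>0\<close> has no dyadic scale and is split off.\<close>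

definition block_start :: "(nat \<Rightarrow> nat) \<Rightarrow> nat \<Rightarrow> nat" where
  "block_start \<Lambda> j = (case j of 0 \<Rightarrow> 1 | Suc i \<Rightarrow> \<Lambda> i)"

lemma block_start_le:
  assumes "lacunary \<Lambda>" shows "1 \<le> block_start \<Lambda> j \<and> block_start \<Lambda> j \<le> \<Lambda> j"
proof (cases j)
  case 0
  then show ?thesis using assms by (auto simp: block_start_def lacunary_def Suc_leI)
next
  case (Suc i)
  have "0 < \<Lambda> i" "\<Lambda> i < \<Lambda> (Suc i)" using assms by (auto simp: lacunary_def strict_mono_Suc_iff)
  then show ?thesis using Suc by (simp add: block_start_def)
qed

text \<open>Blocks that come close to a given frequency \<open>y\<close> have their endpoints, up to the two extreme ones,
  between \<open>y / 2\<close> and \<open>2 y\<close>; in \<open>m\<close> steps the sequence grows at least by the factor \<open>1 + m (\<rho> - 1)\<close>, which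
  must not exceed \<open>4\<close>.\<close>

lemma lacunary_overlap:
  assumes \<Lambda>: "lacunary \<Lambda>" and \<rho>2: "lacunary_ratio \<Lambda> < 2" and y: "0 < y"
  shows "real (card {j \<in> J. real (block_start \<Lambda> j) \<le> 2 * y \<and> y / 2 \<le> real (\<Lambda> j)}) \<le> 5 / (lacunary_ratio \<Lambda> - 1)"
proof -
  define \<rho> where "\<rho> = lacunary_ratio \<Lambda>"
  have \<rho>: "1 < \<rho>" "\<rho> < 2" using assms by (auto simp: lacunary_def \<rho>_def)
  define S where "S = {j \<in> J. real (block_start \<Lambda> j) \<le> 2 * y \<and> y / 2 \<le> real (\<Lambda> j)}"
  define k where "k = nat \<lfloor>3 / (\<rho> - 1)\<rfloor>"
  have k: "real k \<le> 3 / (\<rho> - 1)" using \<rho> by (simp add: k_def)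
  show ?thesis
  proof (cases "S = {}")
    case True
    then show ?thesis using \<rho> unfolding S_def[symmetric] \<rho>_def[symmetric] by simp
  next
    case False
    define j0 where "j0 = (LEAST j. y / 2 \<le> real (\<Lambda> j))"
    from False obtain i where "y / 2 \<le> real (\<Lambda> i)" by (auto simp: S_def)
    then have j0: "y / 2 \<le> real (\<Lambda> j0)" unfolding j0_def by (rule LeastI)
    have "S \<subseteq> {j0..j0 + 1 + k}"
    proof
      fix j assume j: "j \<in> S"
      have "j0 \<le> j" using j unfolding j0_def by (auto simp: S_def intro: Least_le)
      moreover have "j \<le> j0 + 1 + k"
      proof (rule ccontr)
        assume "\<not> j \<le> j0 + 1 + k"
        define m where "m = j - j0 - 1"
        have m: "j = Suc (j0 + m)" "k < m" using \<open>\<not> j \<le> j0 + 1 + k\<close> by (auto simp: m_def)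
        have "(1 + real m * (\<rho> - 1)) * (y / 2) \<le> (1 + real m * (\<rho> - 1)) * real (\<Lambda> j0)"
          using j0 \<rho> by (intro mult_left_mono add_nonneg_nonneg mult_nonneg_nonneg) auto
        also have "\<dots> \<le> real (\<Lambda> (j0 + m))" unfolding \<rho>_def by (rule lacunary_growth[OF \<Lambda>])
        also have "\<dots> \<le> 2 * y" using j m by (simp add: S_def block_start_def)
        finally have "(1 + real m * (\<rho> - 1)) * (y / 2) \<le> 4 * (y / 2)" by simp
        then have "1 + real m * (\<rho> - 1) \<le> 4" using y by (simp only: mult_le_cancel_right)
        then have "real m \<le> 3 / (\<rho> - 1)" using \<rho> by (simp add: field_simps)
        then have "int m \<le> \<lfloor>3 / (\<rho> - 1)\<rfloor>" by (simp add: le_floor_iff)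
        then have "m \<le> k" by (simp add: k_def)
        with m show False by simp
      qed
      ultimately show "j \<in> {j0..j0 + 1 + k}" by simp
    qed
    then have "card S \<le> card {j0..j0 + 1 + k}" by (intro card_mono) auto
    then have "real (card S) \<le> 2 + real k" by simp
    also have "\<dots> \<le> 2 / (\<rho> - 1) + 3 / (\<rho> - 1)"
      using k \<rho> by (intro add_mono) (auto simp: field_simps)
    finally show ?thesis unfolding S_def \<rho>_def by (simp add: add_divide_distrib[symmetric])
  qed
qed

definition frequency_block :: "(nat \<Rightarrow> nat) \<Rightarrow> nat \<Rightarrow> int set" where
  "frequency_block \<Lambda> j = {(case j of 0 \<Rightarrow> 0 | Suc i \<Rightarrow> int (\<Lambda> i))..<int (\<Lambda> j)}"

lemma powr_sum_le_4:
  fixes x y :: real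
  assumes "0 \<le> x" "0 \<le> y" "0 < b" "b \<le> 1"
  shows "(2 * x + 2 * y) powr b \<le> 4 * (x powr b + y powr b)"
proof -
  have "(2 * x + 2 * y) powr b \<le> (4 * max x y) powr b" using assms by (intro powr_mono2) auto
  also have "\<dots> = 4 powr b * max x y powr b" using assms by (simp add: powr_mult)
  also have "\<dots> \<le> 4 powr 1 * (x powr b + y powr b)"
    using assms by (intro mult_mono powr_mono) (auto simp: max_def)
  finally show ?thesis by simp
qed

text \<open>The mean value, which belongs to the zeroth block, is estimated separately by the norm of the
  function; it is the Fejer mean with \<open>K = 1\<close>.\<close>

theorem polynomial_square_function:
  fixes c :: "int \<Rightarrow> complex"
  assumes \<Lambda>: "lacunary \<Lambda>" and \<rho>2: "lacunary_ratio \<Lambda> < 2" and p: "1 < p" "p < 2"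
    and A: "finite A" "A \<subseteq> {0..}"
  shows "integral {0..2*pi} (\<lambda>x. (\<Sum>j<n. (cmod (trig_sum (A \<inter> frequency_block \<Lambda> j) c x))\<^sup>2) powr (p / 2))
    \<le> 409600020 / (p - 1) * (lacunary_ratio \<Lambda> - 1) powr (- p / 2)
       * integral {0..2*pi} (\<lambda>x. ((cmod (trig_sum A c x))\<^sup>2) powr (p / 2))"
proof -
  let ?S = "\<lambda>x. (\<Sum>j<n. (cmod (trig_sum (A \<inter> frequency_block \<Lambda> j) c x))\<^sup>2)"
  define M where "M = 5 / (lacunary_ratio \<Lambda> - 1)"
  have \<rho>: "0 < lacunary_ratio \<Lambda> - 1" using \<Lambda> by (simp add: lacunary_def)
  have M: "1 < M" using \<rho> \<rho>2 by (simp add: M_def field_simps)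
  define F where "F = trig_sum A c"
  define I where "I = integral {0..2*pi} (\<lambda>x. ((cmod (F x))\<^sup>2) powr (p / 2))"
  define c0 where "c0 = (if 0 \<in> A then c 0 else 0)"
  define P where "P j = trig_sum (A \<inter> {int (block_start \<Lambda> j)..<int (\<Lambda> j)}) c" for j
  have F: "continuous_on S F" for S unfolding F_def by (intro continuous_intros)
  have I0: "0 \<le> I" unfolding I_def
    using p by (intro integral_nonneg integrable_continuous_interval continuous_on_powr' continuous_intros F) auto
  have block: "trig_sum (A \<inter> frequency_block \<Lambda> j) c x = P j x + (if j = 0 then c0 else 0)" for j x
  proof (cases j)
    case (Suc i)
    then show ?thesis by (simp add: P_def frequency_block_def block_start_def)
  next
    case 0
    have L: "0 < \<Lambda> 0" using \<Lambda> by (simp add: lacunary_def)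
    have "A \<inter> frequency_block \<Lambda> 0 = (A \<inter> {int (block_start \<Lambda> 0)..<int (\<Lambda> 0)}) \<union> (A \<inter> {0})"
      using L by (auto simp: frequency_block_def block_start_def)
    then have "trig_sum (A \<inter> frequency_block \<Lambda> 0) c x = P 0 x + trig_sum (A \<inter> {0}) c x"
      unfolding P_def by (simp only:) (rule sum.union_disjoint, use A in \<open>auto simp: block_start_def\<close>)
    also have "trig_sum (A \<inter> {0}) c x = c0" by (simp add: c0_def)
    finally show ?thesis using 0 by simp
  qed
  have pt: "?S x
     \<le> 2 * (\<Sum>j<n. (cmod (P j x))\<^sup>2) + 2 * (cmod c0)\<^sup>2" for x
  proof -
    have "(cmod (y + z))\<^sup>2 \<le> 2 * (cmod y)\<^sup>2 + 2 * (cmod z)\<^sup>2" for y z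
    proof -
      have "(cmod (y + z))\<^sup>2 \<le> (cmod y + cmod z)\<^sup>2" by (simp add: norm_triangle_ineq power_mono)
      also have "\<dots> \<le> 2 * (cmod y)\<^sup>2 + 2 * (cmod z)\<^sup>2" using sum_squares_bound[of "cmod y" "cmod z"]
        by (simp add: power2_sum)
      finally show ?thesis .
    qed
    then have "?S x
       \<le> (\<Sum>j<n. 2 * (cmod (P j x))\<^sup>2 + 2 * (cmod (if j = 0 then c0 else 0))\<^sup>2)"
      unfolding block by (intro sum_mono)
    also have "\<dots> = 2 * (\<Sum>j<n. (cmod (P j x))\<^sup>2) + (\<Sum>j<n. if j = 0 then 2 * (cmod c0)\<^sup>2 else 0)"
      unfolding sum.distrib sum_distrib_left by (intro arg_cong2[of _ _ _ _ "(+)"] sum.cong) auto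
    also have "(\<Sum>j<n. if j = 0 then 2 * (cmod c0)\<^sup>2 else 0) \<le> 2 * (cmod c0)\<^sup>2" by (simp add: sum.delta)
    finally show ?thesis by simp
  qed
  have c0I: "2 * pi * ((cmod c0)\<^sup>2) powr (p / 2) \<le> I"
  proof -
    have c: "continuous_on {0..2*pi} (\<lambda>x. (\<Sum>i\<in>{()}. (cmod (F x))\<^sup>2) powr (p / 2))"
      using p by (intro continuous_l2_powr F) auto
    have "integral {0..2*pi} (\<lambda>x. (\<Sum>i\<in>{()}. (cmod (fejer_mean 1 F x))\<^sup>2) powr (p / 2))
      \<le> (\<integral>x. (\<Sum>i\<in>{()}. (cmod (F x))\<^sup>2) powr (p / 2) \<partial>circle)"
      using p by (intro fejer_mean_contraction continuous_imp_integrable_real c F) auto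
    also have "\<dots> = integral {0..2*pi} (\<lambda>x. (\<Sum>i\<in>{()}. (cmod (F x))\<^sup>2) powr (p / 2))"
      by (intro lebesgue_integral_eq_integral continuous_imp_integrable_real c) auto
    also have "\<dots> = I" by (simp add: I_def)
    finally show ?thesis
      by (simp add: fejer_mean_def F_def fourier_coeff_trig_sum[OF A(1)] c0_def[symmetric])
  qed
  have cont: "continuous_on S (P j)" for S j unfolding P_def by (intro continuous_intros)
  have iP: "(\<lambda>x. (\<Sum>j<n. (cmod (P j x))\<^sup>2) powr (p / 2)) integrable_on {0..2*pi}"
    using p by (intro integrable_continuous_interval continuous_l2_powr cont) auto
  have "integral {0..2*pi} (\<lambda>x. ?S x powr (p / 2))
    \<le> integral {0..2*pi} (\<lambda>x. 4 * ((\<Sum>j<n. (cmod (P j x))\<^sup>2) powr (p / 2) + ((cmod c0)\<^sup>2) powr (p / 2)))"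
  proof (rule integral_le)
    show "(\<lambda>x. ?S x powr (p / 2)) integrable_on {0..2*pi}"
      using p by (intro integrable_continuous_interval continuous_l2_powr continuous_intros) auto
    show "(\<lambda>x. 4 * ((\<Sum>j<n. (cmod (P j x))\<^sup>2) powr (p / 2) + ((cmod c0)\<^sup>2) powr (p / 2))) integrable_on {0..2*pi}"
      by (intro integrable_on_mult_right integrable_add iP integrable_const_ivl)
    fix x
    have "?S x powr (p / 2)
      \<le> (2 * (\<Sum>j<n. (cmod (P j x))\<^sup>2) + 2 * (cmod c0)\<^sup>2) powr (p / 2)"
      using p by (intro powr_mono2 pt) (auto simp: sum_nonneg)
    also have "\<dots> \<le> 4 * ((\<Sum>j<n. (cmod (P j x))\<^sup>2) powr (p / 2) + ((cmod c0)\<^sup>2) powr (p / 2))"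
      using p by (intro powr_sum_le_4) (auto simp: sum_nonneg)
    finally show "?S x powr (p / 2)
      \<le> 4 * ((\<Sum>j<n. (cmod (P j x))\<^sup>2) powr (p / 2) + ((cmod c0)\<^sup>2) powr (p / 2))" .
  qed
  also have "\<dots> = 4 * (integral {0..2*pi} (\<lambda>x. (\<Sum>j<n. (cmod (P j x))\<^sup>2) powr (p / 2)) + 2 * pi * ((cmod c0)\<^sup>2) powr (p / 2))"
    by (simp only: integral_mult_right integral_add[OF iP integrable_const_ivl]) simp
  also have "\<dots> \<le> 4 * (20480000 / (p - 1) * M powr (p / 2) * I + I)"
  proof (intro mult_left_mono add_mono c0I)
    show "integral {0..2*pi} (\<lambda>x. (\<Sum>j<n. (cmod (P j x))\<^sup>2) powr (p / 2)) \<le> 20480000 / (p - 1) * M powr (p / 2) * I"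
      unfolding P_def I_def F_def M_def
      using \<rho> by (intro interval_square_function A p lacunary_overlap block_start_le \<Lambda> \<rho>2) auto
  qed simp
  also have "\<dots> \<le> 4 * (20480000 / (p - 1) * M powr (p / 2) * I + 1 / (p - 1) * M powr (p / 2) * I)"
  proof -
    have "1 * 1 \<le> 1 / (p - 1) * M powr (p / 2)"
      using p M by (intro mult_mono ge_one_powr_ge_zero) auto
    then have "1 * 1 * I \<le> 1 / (p - 1) * M powr (p / 2) * I" using I0 by (rule mult_right_mono)
    then have "I \<le> 1 / (p - 1) * M powr (p / 2) * I" by (simp only: mult_1_left)
    then show ?thesis by (intro mult_left_mono add_left_mono) simp_all
  qed
  also have "\<dots> = 81920004 / (p - 1) * I * M powr (p / 2)" by (simp add: field_simps)
  also have "\<dots> \<le> 81920004 / (p - 1) * I * (5 * (lacunary_ratio \<Lambda> - 1) powr (- p / 2))"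
  proof (intro mult_left_mono)
    have "M powr (p / 2) = 5 powr (p / 2) * (lacunary_ratio \<Lambda> - 1) powr (- p / 2)"
      using \<rho> by (simp add: M_def powr_divide powr_minus_divide)
    also have "\<dots> \<le> 5 powr 1 * (lacunary_ratio \<Lambda> - 1) powr (- p / 2)"
      using p by (intro mult_right_mono powr_mono) auto
    finally show "M powr (p / 2) \<le> 5 * (lacunary_ratio \<Lambda> - 1) powr (- p / 2)" by simp
  qed (use I0 p in auto)
  finally show ?thesis unfolding I_def F_def by (simp add: mult_ac)
qed

text \<open>For an analytic function the symmetric partial sums see only the frequencies \<open>\<ge> 0\<close>, so that each
  block is a single interval of frequencies.\<close>

lemma LP_block_analytic:
  assumes \<Lambda>: "lacunary \<Lambda>" and supp: "\<And>n. n < 0 \<Longrightarrow> fourier_coeff f n = 0"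
  shows "LP_block \<Lambda> j f x = trig_sum (frequency_block \<Lambda> j) (fourier_coeff f) x"
proof -
  have S: "fourier_partial_sum N f x = trig_sum {0..<int N} (fourier_coeff f) x" for N
    unfolding fourier_partial_sum_def
    by (rule sum.mono_neutral_right) (use supp in auto)
  show ?thesis
  proof (cases j)
    case 0
    then show ?thesis by (simp add: S frequency_block_def)
  next
    case (Suc i)
    have "\<Lambda> i < \<Lambda> (Suc i)" using \<Lambda> by (auto simp: lacunary_def strict_mono_Suc_iff)
    then have "{0..<int (\<Lambda> (Suc i))} = {0..<int (\<Lambda> i)} \<union> {int (\<Lambda> i)..<int (\<Lambda> (Suc i))}" by auto
    then have "trig_sum {0..<int (\<Lambda> (Suc i))} (fourier_coeff f) x
      = trig_sum {0..<int (\<Lambda> i)} (fourier_coeff f) x + trig_sum {int (\<Lambda> i)..<int (\<Lambda> (Suc i))} (fourier_coeff f) x"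
      by (simp only:) (rule sum.union_disjoint, auto)
    then show ?thesis using Suc by (simp add: S frequency_block_def)
  qed
qed

lemma ennreal_powr_ennreal: "0 \<le> r \<Longrightarrow> ennreal_powr (ennreal r) a = ennreal (r powr a)"
  by (simp add: ennreal_powr_def)

lemma ennreal_powr_mono:
  assumes "x \<le> y" "0 \<le> a"
  shows "ennreal_powr x a \<le> ennreal_powr y a"
proof (cases "y = \<infinity>")
  case False
  then obtain s where s: "y = ennreal s" "0 \<le> s" by (cases y) auto
  with assms obtain r where r: "x = ennreal r" "0 \<le> r" by (cases x) (auto simp: top_unique)
  then show ?thesis using assms s by (auto simp: ennreal_powr_ennreal intro!: ennreal_leI powr_mono2)
qed (simp add: ennreal_powr_def)

lemma partial_square_sums_tendsto:
  fixes a :: "nat \<Rightarrow> real"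
  assumes a: "\<And>j. 0 \<le> a j" and p: "0 < p"
  shows "(\<lambda>n. ennreal ((\<Sum>j<n. a j) powr (p / 2)))
     \<longlonglongrightarrow> ennreal_powr (ennreal_powr (\<Sum>j. ennreal (a j)) (1 / 2)) p"
proof (cases "summable a")
  case True
  have s0: "0 \<le> suminf a" using True a by (rule suminf_nonneg)
  have "(\<Sum>j. ennreal (a j)) = ennreal (suminf a)" using a True by (rule suminf_ennreal2)
  then have "ennreal_powr (ennreal_powr (\<Sum>j. ennreal (a j)) (1 / 2)) p = ennreal (suminf a powr (p / 2))"
    using s0 by (simp add: ennreal_powr_ennreal powr_powr)
  moreover have "(\<lambda>n. (\<Sum>j<n. a j) powr (p / 2)) \<longlonglongrightarrow> suminf a powr (p / 2)"
    by (intro tendsto_powr' summable_LIMSEQ[OF True] tendsto_const)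
       (use p a in \<open>auto simp: sum_nonneg intro!: always_eventually\<close>)
  ultimately show ?thesis by simp
next
  case False
  then have top: "(\<Sum>j. ennreal (a j)) = top" using summable_suminf_not_top[of a] a by blast
  have "(\<lambda>n. \<Sum>j<n. ennreal (a j)) \<longlonglongrightarrow> top"
    unfolding top[symmetric] by (rule summable_LIMSEQ) simp
  then have "(\<lambda>n. ennreal (\<Sum>j<n. a j)) \<longlonglongrightarrow> top" using a by simp
  then have at_top: "filterlim (\<lambda>n. \<Sum>j<n. a j) at_top sequentially"
    unfolding ennreal_tendsto_top_eq_at_top .
  have "filterlim (\<lambda>n. (\<Sum>j<n. a j) powr (p / 2)) at_top sequentially"
    unfolding filterlim_at_top
  proof
    fix Z :: real
    define z where "z = max Z 1"
    have "\<forall>\<^sub>F n in sequentially. z powr (2 / p) \<le> (\<Sum>j<n. a j)"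
      using at_top unfolding filterlim_at_top by blast
    then show "\<forall>\<^sub>F n in sequentially. Z \<le> (\<Sum>j<n. a j) powr (p / 2)"
    proof eventually_elim
      case (elim n)
      have "(z powr (2 / p)) powr (p / 2) \<le> (\<Sum>j<n. a j) powr (p / 2)"
        using elim p by (intro powr_mono2) auto
      moreover have "(z powr (2 / p)) powr (p / 2) = z" using p by (simp add: powr_powr z_def)
      ultimately show ?case by (simp add: z_def)
    qed
  qed
  then have "(\<lambda>n. ennreal ((\<Sum>j<n. a j) powr (p / 2))) \<longlonglongrightarrow> top"
    unfolding ennreal_tendsto_top_eq_at_top .
  then show ?thesis by (simp add: top ennreal_powr_def)
qed

lemma nn_integral_le_of_tendsto:
  assumes m: "\<And>n. u n \<in> borel_measurable M" and lim: "\<And>x. (\<lambda>n. u n x) \<longlonglongrightarrow> v x"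
    and le: "\<forall>\<^sub>F n in sequentially. (\<integral>\<^sup>+x. u n x \<partial>M) \<le> C"
  shows "(\<integral>\<^sup>+x. v x \<partial>M) \<le> (C::ennreal)"
proof -
  have "(\<integral>\<^sup>+x. v x \<partial>M) = (\<integral>\<^sup>+x. liminf (\<lambda>n. u n x) \<partial>M)"
    using lim_imp_Liminf[OF _ lim] by simp
  also have "\<dots> \<le> liminf (\<lambda>n. \<integral>\<^sup>+x. u n x \<partial>M)" by (intro nn_integral_liminf m)
  also have "\<dots> \<le> C" by (intro Liminf_le le) simp
  finally show ?thesis .
qed

text \<open>Finitely many blocks of the Fejer means of \<open>f\<close> are covered by the polynomial case, and the Fejer means
  have at most the norm of \<open>f\<close>. Their blocks converge pointwise to those of \<open>f\<close>, so Fatou's lemma applies,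
  first in the order of the Fejer mean and then in the number of blocks.\<close>

theorem square_function_bound:
  assumes \<Lambda>: "lacunary \<Lambda>" and \<rho>2: "lacunary_ratio \<Lambda> < 2" and p: "1 < p" "p < 2"
    and f: "f \<in> analytic_Hardy p" and norm: "circle_Lp_norm p f = 1"
  shows "circle_eLp_norm p (square_function \<Lambda> f)
     \<le> ennreal (409600020 / (p - 1) * (lacunary_ratio \<Lambda> - 1) powr (- 1 / 2))"
proof -
  define C where "C = 409600020 / (p - 1) * (lacunary_ratio \<Lambda> - 1) powr (- p / 2)"
  have \<rho>: "0 < lacunary_ratio \<Lambda> - 1" using \<Lambda> by (simp add: lacunary_def)
  have C0: "0 \<le> C" using p by (simp add: C_def)
  have fm: "f \<in> borel_measurable circle"
    using f by (auto simp: analytic_Hardy_def circle_Lp_def intro: measurable_restrict_space1)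
  have supp: "fourier_coeff f n = 0" if "n < 0" for n
    using f that by (auto simp: analytic_Hardy_def)
  have LP: "LP_block \<Lambda> j f x = trig_sum (frequency_block \<Lambda> j) (fourier_coeff f) x" for j x
    by (rule LP_block_analytic[OF \<Lambda>]) (rule supp)
  have restrict: "(\<integral>\<^sup>+x\<in>{0..2*pi}. g x \<partial>lebesgue) = (\<integral>\<^sup>+x. g x \<partial>circle)" for g
    by (subst nn_integral_restrict_space) auto
  have nnf: "(\<integral>\<^sup>+x. ennreal (((cmod (f x))\<^sup>2) powr (p / 2)) \<partial>circle) = ennreal (2 * pi)"
  proof -
    have e: "ennreal_powr (ennreal (cmod (f x))) p = ennreal (((cmod (f x))\<^sup>2) powr (p / 2))" for x
      by (simp add: ennreal_powr_ennreal power2_powr)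
    define y where "y = ennreal (1 / (2 * pi)) * (\<integral>\<^sup>+x. ennreal (((cmod (f x))\<^sup>2) powr (p / 2)) \<partial>circle)"
    have "ennreal_powr y (1 / p) = 1"
      using norm unfolding circle_Lp_norm_def circle_eLp_norm_def restrict e y_def .
    then obtain r where r: "y = ennreal r" "0 \<le> r" "r powr (1 / p) = 1"
      by (cases y) (auto simp: ennreal_powr_def ennreal_eq_1 split: if_splits)
    have "r = (r powr (1 / p)) powr p" using r(2) p by (simp add: powr_powr)
    then have "y = 1" using r by simp
    then have "ennreal (2 * pi) * (ennreal (1 / (2 * pi)) * (\<integral>\<^sup>+x. ennreal (((cmod (f x))\<^sup>2) powr (p / 2)) \<partial>circle)) = ennreal (2 * pi)"
      by (simp add: y_def)
    then show ?thesis by (simp add: mult.assoc[symmetric] ennreal_mult[symmetric])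
  qed
  have if': "integrable circle (\<lambda>x. ((cmod (f x))\<^sup>2) powr (p / 2))"
    by (intro integrableI_nonneg) (use fm nnf in auto)
  have If: "(\<integral>x. ((cmod (f x))\<^sup>2) powr (p / 2) \<partial>circle) = 2 * pi"
    using nn_integral_eq_integral[OF if'] nnf by simp
  have intf: "integrable circle f"
  proof (rule Bochner_Integration.integrable_bound)
    show "integrable circle (\<lambda>x. 1 + ((cmod (f x))\<^sup>2) powr (p / 2))"
      by (intro Bochner_Integration.integrable_add if' continuous_imp_integrable_real) simp
    have "cmod (f x) \<le> 1 + ((cmod (f x))\<^sup>2) powr (p / 2)" for x
    proof (cases "cmod (f x) \<le> 1")
      case False
      then have "cmod (f x) powr 1 \<le> cmod (f x) powr p" using p by (intro powr_mono) auto
      also have "\<dots> = ((cmod (f x))\<^sup>2) powr (p / 2)" by (simp add: power2_powr)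
      finally show ?thesis using False by simp
    qed (simp add: add_increasing2)
    then show "AE x in circle. cmod (f x) \<le> norm (1 + ((cmod (f x))\<^sup>2) powr (p / 2))" by simp
  qed (rule fm)
  define cK where "cK K n = of_real (fejer_weight K n) * fourier_coeff f n" for K n
  let ?Q = "\<lambda>n K x. (\<Sum>j<n. (cmod (trig_sum (frequency_block \<Lambda> j) (cK K) x))\<^sup>2)"
  have poly: "integral {0..2*pi} (\<lambda>x. ?Q n K x powr (p / 2)) \<le> C * (2 * pi)"
    if K: "0 < K" for K n
  proof -
    let ?A = "{0..int K}"
    have "trig_sum (?A \<inter> frequency_block \<Lambda> j) (cK K) x = trig_sum (frequency_block \<Lambda> j) (cK K) x" for j x
      by (rule sum.mono_neutral_left) (auto simp: frequency_block_def cK_def fejer_weight_def split: nat.splits)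
    then have "integral {0..2*pi} (\<lambda>x. ?Q n K x powr (p / 2))
       \<le> C * integral {0..2*pi} (\<lambda>x. ((cmod (trig_sum ?A (cK K) x))\<^sup>2) powr (p / 2))"
      using polynomial_square_function[OF \<Lambda> \<rho>2 p, where A = ?A and n = n and c = "cK K"] unfolding C_def by simp
    also have "trig_sum ?A (cK K) x = fejer_mean K f x" for x
      unfolding fejer_mean_trig_sum cK_def
      by (rule sum.mono_neutral_left) (use supp in auto)
    then have "integral {0..2*pi} (\<lambda>x. ((cmod (trig_sum ?A (cK K) x))\<^sup>2) powr (p / 2))
       = integral {0..2*pi} (\<lambda>x. (\<Sum>i\<in>{()}. (cmod (fejer_mean K f x))\<^sup>2) powr (p / 2))" by simp
    also have "\<dots> \<le> (\<integral>x. (\<Sum>i\<in>{()}. (cmod (f x))\<^sup>2) powr (p / 2) \<partial>circle)"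
      using p if' by (intro fejer_mean_contraction intf K) auto
    also have "\<dots> = 2 * pi" using If by simp
    finally show ?thesis using C0 by (simp add: mult_left_mono)
  qed
  have cont: "continuous_on S (\<lambda>x. (\<Sum>j<n. (cmod (trig_sum (frequency_block \<Lambda> j) c x))\<^sup>2) powr (p / 2))" for S c n
    using p by (intro continuous_l2_powr continuous_intros) auto
  have meas: "(\<lambda>x. ennreal ((\<Sum>j<n. (cmod (trig_sum (frequency_block \<Lambda> j) c x))\<^sup>2) powr (p / 2))) \<in> borel_measurable circle" for c n
    by (intro measurable_compose[OF _ measurable_ennreal] continuous_measurable_circle cont)
  have part: "(\<integral>\<^sup>+x. ennreal ((\<Sum>j<n. (cmod (LP_block \<Lambda> j f x))\<^sup>2) powr (p / 2)) \<partial>circle) \<le> ennreal (C * (2 * pi))" for n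
  proof (rule nn_integral_le_of_tendsto[OF meas])
    show "(\<lambda>K. ennreal (?Q n K x powr (p / 2)))
      \<longlonglongrightarrow> ennreal ((\<Sum>j<n. (cmod (LP_block \<Lambda> j f x))\<^sup>2) powr (p / 2))" for x
    proof -
      have "(\<lambda>K. cK K m) \<longlonglongrightarrow> of_real 1 * fourier_coeff f m" for m
        unfolding cK_def by (intro tendsto_intros fejer_weight_tendsto)
      then have "(\<lambda>K. trig_sum (frequency_block \<Lambda> j) (cK K) x) \<longlonglongrightarrow> LP_block \<Lambda> j f x" for j
        unfolding LP by (intro tendsto_intros) simp
      then show ?thesis
        by (intro tendsto_ennrealI tendsto_powr' tendsto_intros) (use p in \<open>auto simp: sum_nonneg intro!: always_eventually\<close>)
    qed
    show "\<forall>\<^sub>F K in sequentially. (\<integral>\<^sup>+x. ennreal (?Q n K x powr (p / 2)) \<partial>circle) \<le> ennreal (C * (2 * pi))"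
      using eventually_gt_at_top[of 0]
    proof eventually_elim
      case (elim K)
      have i: "integrable circle (\<lambda>x. ?Q n K x powr (p / 2))"
        by (intro continuous_imp_integrable_real cont)
      have "(\<integral>\<^sup>+x. ennreal (?Q n K x powr (p / 2)) \<partial>circle)
        = ennreal (\<integral>x. ?Q n K x powr (p / 2) \<partial>circle)"
        by (intro nn_integral_eq_integral i) simp
      also have "(\<integral>x. ?Q n K x powr (p / 2) \<partial>circle)
        = integral {0..2*pi} (\<lambda>x. ?Q n K x powr (p / 2))"
        by (intro lebesgue_integral_eq_integral i) simp
      finally show ?case using poly[OF elim] by (simp add: ennreal_leI)
    qed
  qed
  have "(\<integral>\<^sup>+x. ennreal_powr (square_function \<Lambda> f x) p \<partial>circle) \<le> ennreal (C * (2 * pi))"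
  proof (rule nn_integral_le_of_tendsto)
    show "(\<lambda>n. ennreal ((\<Sum>j<n. (cmod (LP_block \<Lambda> j f x))\<^sup>2) powr (p / 2))) \<longlonglongrightarrow> ennreal_powr (square_function \<Lambda> f x) p" for x
      unfolding square_function_def using p by (intro partial_square_sums_tendsto) auto
    show "(\<lambda>x. ennreal ((\<Sum>j<n. (cmod (LP_block \<Lambda> j f x))\<^sup>2) powr (p / 2))) \<in> borel_measurable circle" for n
      unfolding LP by (rule meas)
  qed (use part in simp)
  then have "circle_eLp_norm p (square_function \<Lambda> f) \<le> ennreal_powr (ennreal (1 / (2 * pi)) * ennreal (C * (2 * pi))) (1 / p)"
    unfolding circle_eLp_norm_def restrict using p by (intro ennreal_powr_mono mult_left_mono) auto
  also have "ennreal (1 / (2 * pi)) * ennreal (C * (2 * pi)) = ennreal C"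
    using C0 by (simp add: ennreal_mult[symmetric])
  also have "ennreal_powr (ennreal C) (1 / p) = ennreal (C powr (1 / p))"
    using C0 by (rule ennreal_powr_ennreal)
  also have "C powr (1 / p) \<le> 409600020 / (p - 1) * (lacunary_ratio \<Lambda> - 1) powr (- 1 / 2)"
  proof -
    have "C powr (1 / p) = (409600020 / (p - 1)) powr (1 / p) * (lacunary_ratio \<Lambda> - 1) powr (- 1 / 2)"
    proof -
      have "- p / 2 * (1 / p) = - 1 / 2" using p by simp
      then have "((lacunary_ratio \<Lambda> - 1) powr (- p / 2)) powr (1 / p) = (lacunary_ratio \<Lambda> - 1) powr (- 1 / 2)"
        by (simp only: powr_powr)
      then show ?thesis unfolding C_def by (subst powr_mult) (use p in simp_all)
    qed
    also have "\<dots> \<le> (409600020 / (p - 1)) powr 1 * (lacunary_ratio \<Lambda> - 1) powr (- 1 / 2)"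
      using p by (intro mult_right_mono powr_mono) (auto simp: le_divide_eq)
    finally show ?thesis using p by simp
  qed
  finally show ?thesis by (simp add: ennreal_leI)
qed

theorem theorem1:
  shows "\<exists>C\<^sub>0::real. 0 < C\<^sub>0 \<and>
    (\<forall>(p::real) (\<Lambda>::nat \<Rightarrow> nat).
       1 < p \<longrightarrow> p < 2 \<longrightarrow> lacunary \<Lambda> \<longrightarrow> lacunary_ratio \<Lambda> \<in> {1<..<2} \<longrightarrow>
       (SUP f\<in>{f \<in> analytic_Hardy p. circle_Lp_norm p f = 1}.
          circle_eLp_norm p (square_function \<Lambda> f))
       \<le> ennreal (C\<^sub>0 / (p - 1) * (lacunary_ratio \<Lambda> - 1) powr (- 1 / 2)))"
proof (intro exI[of _ 409600020] conjI allI impI SUP_least)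
  fix p :: real and \<Lambda> f
  assume "1 < p" "p < 2" "lacunary \<Lambda>" "lacunary_ratio \<Lambda> \<in> {1<..<2}"
    "f \<in> {f \<in> analytic_Hardy p. circle_Lp_norm p f = 1}"
  then show "circle_eLp_norm p (square_function \<Lambda> f)
     \<le> ennreal (409600020 / (p - 1) * (lacunary_ratio \<Lambda> - 1) powr (- 1 / 2))"
    by (intro square_function_bound) auto
qed simp

end
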